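(* Let $\mathbb{K}\in\{\mathbb{R},\mathbb{C}\}$ and let $G=\bigcup_{n\in\mathbb{N}}G_n$ be a $C^\infty_{\mathbb K}$-Lie group which is an ascending union of $C^\infty_{\mathbb K}$-Lie groups $G_n$. If $G=\varinjlim G_n$ as a topological group and $G$ admits a direct limit chart, then $G=\varinjlim G_n$ as a $C^\infty_{\mathbb K}$-Lie group.
   Context: Conventions. $\mathbb N=\{1,2,\dots\}$, $\mathbb N_0=\mathbb N\cup\{0\}$. For Hausdorff locally convex $\mathbb K$-vector spaces $E,F$, an open set $U\subseteq E$ and $r\in\mathbb N_0\cup\{\infty\}$, a map $f\colon U\to F$ is $C^r_{\mathbb K}$ if it is continuous and, for all $k\in\mathbb N$ with $k\le r$, the iterated directional derivatives $d^kf(x,y_1,\dots,y_k)=D_{y_1}\cdots D_{y_k}f(x)$ exist for all $x\in U$, $y_1,\dots,y_k\in E$ and define a continuous map $d^kf\colon U\times E^k\to F$. $C^\infty_{\mathbb K}$-Lie groups are modelled on Hausdorff locally convex $\mathbb K$-vector spaces (no completeness assumed), and their underlying spaces are Hausdorff. Topological groups and general locally convex spaces are not assumed Hausdorff. Writing $G=\bigcup_{n}G_n$ for a $C^\infty_{\mathbb K}$-Lie group $G$ means: each $G_n$ is a $C^\infty_{\mathbb K}$-Lie group, $G_n\subseteq G_{n+1}$, $G$ is the union of the $G_n$, and all inclusion maps $G_n\to G_{n+1}$ and $G_n\to G$ are $C^\infty_{\mathbb K}$-homomorphisms (they need not be topological embeddings). $G=\varinjlim G_n$ in a category (here: topological groups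 with continuous homomorphisms; $C^\infty_{\mathbb K}$-Lie groups with $C^\infty_{\mathbb K}$-homomorphisms) means that $G$ with the inclusion maps is a direct limit cone: for each object $Y$ and all morphisms $\psi_n\colon G_n\to Y$ with $\psi_{n+1}|_{G_n}=\psi_n$ there is a unique morphism $\psi\colon G\to Y$ with $\psi|_{G_n}=\psi_n$ for all $n$. Direct limit chart. Let $E$ and $E_n$ be the modelling spaces of $G$ and $G_n$. A chart $\phi\colon U\to V\subseteq E$ of $G$ is a direct limit chart if, for some $n_0\in\mathbb N$: (a) there are continuous linear maps $j_{n,m}\colon E_m\to E_n$ for $n\ge m\ge n_0$ and $j_n\colon E_n\to E$ for $n\geq n_0$ such that $((E_n)_{n\ge n_0},(j_{n,m})_{n\ge m\ge n_0})$ is a direct system of locally convex spaces, $j_n\circ j_{n,m}=j_m$, $E=\bigcup_{n\ge n_0}j_n(E_n)$, and $(E,(j_n)_{n\ge n_0})$ is the direct limit of this system in the category of locally convex spaces and continuous linear maps; (b) there are charts $\phi_n\colon U_n\to V_n\subseteq E_n$ of $G_n$ such that $U_m\subseteq U_n$ and $j_{n,m}(V_m)\subseteq V_n$ for $n\ge m\ge n_0$, $U=\bigcup_{n\ge n_0}U_n$, $V=\bigcup_{n\ge n_0}j_n(V_n)$, and $\phi|_{U_n}=j_n\circ\phi_n$ for each $n\ge n_0$. $G$ admits a direct limit chart if there is a direct limit chart with $1\in U$. *)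

theory Defs
  imports "HOL-Analysis.Analysis" "HOL-Algebra.Module" "HOL-Library.Extended_Nat"
begin

section \<open>Locally convex spaces over the real or complex numbers\<close>

text \<open>
  The ground field is a set \<open>K\<close> of complex numbers, either \<open>\<real>\<close> or \<open>UNIV\<close>. Vector spaces are
  modules of HOL-Algebra with explicit carrier, so that a sequence of different spaces
  can live on one type; the ring multiplication and unit which the record type \<open>module\<close>
  inherits are not used. Scalar multiplication is only constrained for scalars in \<open>K\<close>.
\<close>

definition scalar_field :: "complex set \<Rightarrow> complex ring" where
  "scalar_field K = \<lparr>carrier = K, mult = (*), one = 1, zero = 0, add = (+)\<rparr>"

record 'v tvs = "(complex, 'v) module" +
  vtop :: "'v topology"

definition topological_vector_space :: "complex set \<Rightarrow> 'v tvs \<Rightarrow> bool" where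
  "topological_vector_space K E \<longleftrightarrow>
     module (scalar_field K) E \<and>
     topspace (vtop E) = carrier E \<and>
     continuous_map (prod_topology (vtop E) (vtop E)) (vtop E) (\<lambda>(x, y). x \<oplus>\<^bsub>E\<^esub> y) \<and>
     continuous_map (prod_topology (top_of_set K) (vtop E)) (vtop E) (\<lambda>(c, x). c \<odot>\<^bsub>E\<^esub> x)"

definition convex_in :: "'v tvs \<Rightarrow> 'v set \<Rightarrow> bool" where
  "convex_in E C \<longleftrightarrow>
     C \<subseteq> carrier E \<and>
     (\<forall>x\<in>C. \<forall>y\<in>C. \<forall>t\<in>{0..1::real}.
        (complex_of_real (1 - t) \<odot>\<^bsub>E\<^esub> x) \<oplus>\<^bsub>E\<^esub> (complex_of_real t \<odot>\<^bsub>E\<^esub> y) \<in> C)"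

definition locally_convex_space :: "complex set \<Rightarrow> 'v tvs \<Rightarrow> bool" where
  "locally_convex_space K E \<longleftrightarrow>
     topological_vector_space K E \<and>
     (\<forall>W. openin (vtop E) W \<and> \<zero>\<^bsub>E\<^esub> \<in> W \<longrightarrow>
        (\<exists>C O'. convex_in E C \<and> openin (vtop E) O' \<and> \<zero>\<^bsub>E\<^esub> \<in> O' \<and> O' \<subseteq> C \<and> C \<subseteq> W))"

definition continuous_linear :: "complex set \<Rightarrow> 'v tvs \<Rightarrow> 'w tvs \<Rightarrow> ('v \<Rightarrow> 'w) \<Rightarrow> bool" where
  "continuous_linear K E F f \<longleftrightarrow>
     f \<in> carrier E \<rightarrow> carrier F \<and>
     (\<forall>x\<in>carrier E. \<forall>y\<in>carrier E. f (x \<oplus>\<^bsub>E\<^esub> y) = f x \<oplus>\<^bsub>F\<^esub> f y) \<and>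
     (\<forall>c\<in>K. \<forall>x\<in>carrier E. f (c \<odot>\<^bsub>E\<^esub> x) = c \<odot>\<^bsub>F\<^esub> f x) \<and>
     continuous_map (vtop E) (vtop F) f"

definition prod_tvs :: "'v tvs \<Rightarrow> 'w tvs \<Rightarrow> ('v \<times> 'w) tvs" where
  "prod_tvs E F =
     \<lparr>carrier = carrier E \<times> carrier F,
      mult = (\<lambda>(a, b) (c, d). (a \<otimes>\<^bsub>E\<^esub> c, b \<otimes>\<^bsub>F\<^esub> d)),
      one = (\<one>\<^bsub>E\<^esub>, \<one>\<^bsub>F\<^esub>),
      zero = (\<zero>\<^bsub>E\<^esub>, \<zero>\<^bsub>F\<^esub>),
      add = (\<lambda>(a, b) (c, d). (a \<oplus>\<^bsub>E\<^esub> c, b \<oplus>\<^bsub>F\<^esub> d)),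
      smult = (\<lambda>c (x, y). (c \<odot>\<^bsub>E\<^esub> x, c \<odot>\<^bsub>F\<^esub> y)),
      vtop = prod_topology (vtop E) (vtop F)\<rparr>"


section \<open>Maps of class \<open>C\<^sup>r\<close>\<close>

definition has_dir_deriv ::
    "complex set \<Rightarrow> 'v tvs \<Rightarrow> 'w tvs \<Rightarrow> ('v \<Rightarrow> 'w) \<Rightarrow> 'v \<Rightarrow> 'v \<Rightarrow> 'w \<Rightarrow> bool" where
  "has_dir_deriv K E F f y x d \<longleftrightarrow>
     limitin (vtop F) (\<lambda>t. inverse t \<odot>\<^bsub>F\<^esub> (f (x \<oplus>\<^bsub>E\<^esub> (t \<odot>\<^bsub>E\<^esub> y)) \<ominus>\<^bsub>F\<^esub> f x)) d (at 0 within K)"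

definition dir_deriv ::
    "complex set \<Rightarrow> 'v tvs \<Rightarrow> 'w tvs \<Rightarrow> ('v \<Rightarrow> 'w) \<Rightarrow> 'v \<Rightarrow> 'v \<Rightarrow> 'w" where
  "dir_deriv K E F f y x = (THE d. has_dir_deriv K E F f y x d)"

text \<open>\<open>iter_deriv K E F f [y\<^sub>1, \<dots>, y\<^sub>k] x\<close> is \<open>D\<^bsub>y\<^sub>1\<^esub> \<dots> D\<^bsub>y\<^sub>k\<^esub> f(x)\<close>.\<close>

primrec iter_deriv ::
    "complex set \<Rightarrow> 'v tvs \<Rightarrow> 'w tvs \<Rightarrow> ('v \<Rightarrow> 'w) \<Rightarrow> 'v list \<Rightarrow> 'v \<Rightarrow> 'w" where
  "iter_deriv K E F f [] = f"
| "iter_deriv K E F f (y # ys) = dir_deriv K E F (iter_deriv K E F f ys) y"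

text \<open>
  In the last clause a tuple \<open>(y\<^sub>1, \<dots>, y\<^sub>k)\<close> of \<open>E\<^sup>k\<close> is a function on \<open>{..<k}\<close>, with \<open>y\<^sub>1\<close>
  its value at \<open>0\<close>. The space \<open>F\<close> is Hausdorff in all uses of this definition, so the
  existence of the directional derivatives makes the definite description in \<open>dir_deriv\<close>
  denote them.
\<close>

definition C_map ::
    "complex set \<Rightarrow> enat \<Rightarrow> 'v tvs \<Rightarrow> 'w tvs \<Rightarrow> 'v set \<Rightarrow> ('v \<Rightarrow> 'w) \<Rightarrow> bool" where
  "C_map K r E F U f \<longleftrightarrow>
     continuous_map (subtopology (vtop E) U) (vtop F) f \<and>
     (\<forall>k::nat. 1 \<le> k \<and> enat k \<le> r \<longrightarrow>
        (\<forall>x\<in>U. \<forall>y\<in>carrier E. \<forall>ys. set ys \<subseteq> carrier E \<and> Suc (length ys) = k \<longrightarrow>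
           (\<exists>d. has_dir_deriv K E F (iter_deriv K E F f ys) y x d)) \<and>
        continuous_map
          (prod_topology (subtopology (vtop E) U) (product_topology (\<lambda>_. vtop E) {..<k}))
          (vtop F)
          (\<lambda>(x, y). iter_deriv K E F f (map y [0..<k]) x))"


section \<open>Manifolds and Lie groups\<close>

text \<open>
  A chart is a pair \<open>(U, \<phi>)\<close>; its image is \<open>V = \<phi> ` U\<close>, and the values of \<open>\<phi>\<close> outside \<open>U\<close>
  are irrelevant. The atlas stored in a manifold need not be maximal; \<open>chart\<close> describes the
  members of the maximal atlas which it generates.
\<close>

record ('m, 'v) manifold =
  mtop :: "'m topology"
  model :: "'v tvs"
  atlas :: "('m set \<times> ('m \<Rightarrow> 'v)) set"

definition local_chart :: "('m, 'v) manifold \<Rightarrow> 'm set \<Rightarrow> ('m \<Rightarrow> 'v) \<Rightarrow> bool" where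
  "local_chart M U \<phi> \<longleftrightarrow>
     openin (mtop M) U \<and>
     openin (vtop (model M)) (\<phi> ` U) \<and>
     homeomorphic_map (subtopology (mtop M) U) (subtopology (vtop (model M)) (\<phi> ` U)) \<phi>"

definition compatible ::
    "complex set \<Rightarrow> 'v tvs \<Rightarrow> 'm set \<Rightarrow> ('m \<Rightarrow> 'v) \<Rightarrow> 'm set \<Rightarrow> ('m \<Rightarrow> 'v) \<Rightarrow> bool" where
  "compatible K E U \<phi> U' \<phi>' \<longleftrightarrow>
     C_map K \<infinity> E E (\<phi> ` (U \<inter> U')) (\<phi>' \<circ> inv_into U \<phi>) \<and>
     C_map K \<infinity> E E (\<phi>' ` (U \<inter> U')) (\<phi> \<circ> inv_into U' \<phi>')"

definition smooth_manifold :: "complex set \<Rightarrow> ('m, 'v) manifold \<Rightarrow> bool" where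
  "smooth_manifold K M \<longleftrightarrow>
     locally_convex_space K (model M) \<and> Hausdorff_space (vtop (model M)) \<and>
     Hausdorff_space (mtop M) \<and>
     (\<forall>(U, \<phi>)\<in>atlas M. local_chart M U \<phi>) \<and>
     (\<Union>(U, \<phi>)\<in>atlas M. U) = topspace (mtop M) \<and>
     (\<forall>(U, \<phi>)\<in>atlas M. \<forall>(U', \<phi>')\<in>atlas M. compatible K (model M) U \<phi> U' \<phi>')"

definition chart :: "complex set \<Rightarrow> ('m, 'v) manifold \<Rightarrow> 'm set \<Rightarrow> ('m \<Rightarrow> 'v) \<Rightarrow> bool" where
  "chart K M U \<phi> \<longleftrightarrow>
     local_chart M U \<phi> \<and> (\<forall>(U', \<phi>')\<in>atlas M. compatible K (model M) U \<phi> U' \<phi>')"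

definition smooth_map ::
    "complex set \<Rightarrow> ('m, 'v) manifold \<Rightarrow> ('n, 'w) manifold \<Rightarrow> ('m \<Rightarrow> 'n) \<Rightarrow> bool" where
  "smooth_map K M N f \<longleftrightarrow>
     continuous_map (mtop M) (mtop N) f \<and>
     (\<forall>(U, \<phi>)\<in>atlas M. \<forall>(W, \<kappa>)\<in>atlas N.
        C_map K \<infinity> (model M) (model N) (\<phi> ` (U \<inter> f -` W)) (\<kappa> \<circ> f \<circ> inv_into U \<phi>))"

definition prod_manifold :: "('m, 'v) manifold \<Rightarrow> ('n, 'w) manifold \<Rightarrow> ('m \<times> 'n, 'v \<times> 'w) manifold" where
  "prod_manifold M N =
     \<lparr>mtop = prod_topology (mtop M) (mtop N),
      model = prod_tvs (model M) (model N),
      atlas = {(U \<times> W, map_prod \<phi> \<kappa>) | U \<phi> W \<kappa>. (U, \<phi>) \<in> atlas M \<and> (W, \<kappa>) \<in> atlas N}\<rparr>"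

record ('g, 'v) lie = "'g monoid" +
  man :: "('g, 'v) manifold"

definition lie_group :: "complex set \<Rightarrow> ('g, 'v) lie \<Rightarrow> bool" where
  "lie_group K G \<longleftrightarrow>
     group G \<and> smooth_manifold K (man G) \<and> topspace (mtop (man G)) = carrier G \<and>
     smooth_map K (prod_manifold (man G) (man G)) (man G) (\<lambda>(x, y). x \<otimes>\<^bsub>G\<^esub> y) \<and>
     smooth_map K (man G) (man G) (\<lambda>x. inv\<^bsub>G\<^esub> x)"

definition lie_hom :: "complex set \<Rightarrow> ('g, 'v) lie \<Rightarrow> ('h, 'w) lie \<Rightarrow> ('g \<Rightarrow> 'h) \<Rightarrow> bool" where
  "lie_hom K G H f \<longleftrightarrow> f \<in> hom G H \<and> smooth_map K (man G) (man H) f"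

definition topological_group :: "('g, 'z) monoid_scheme \<Rightarrow> 'g topology \<Rightarrow> bool" where
  "topological_group G T \<longleftrightarrow>
     group G \<and> topspace T = carrier G \<and>
     continuous_map (prod_topology T T) T (\<lambda>(x, y). x \<otimes>\<^bsub>G\<^esub> y) \<and>
     continuous_map T T (\<lambda>x. inv\<^bsub>G\<^esub> x)"

definition topgroup_hom ::
    "('g, 'y) monoid_scheme \<Rightarrow> 'g topology \<Rightarrow> ('h, 'z) monoid_scheme \<Rightarrow> 'h topology \<Rightarrow> ('g \<Rightarrow> 'h) \<Rightarrow> bool" where
  "topgroup_hom G T H S f \<longleftrightarrow> f \<in> hom G H \<and> continuous_map T S f"


section \<open>Ascending unions and direct limits\<close>

text \<open>Sequences are indexed by all of \<open>nat\<close> instead of the positive integers.\<close>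

definition lie_ascending_union ::
    "complex set \<Rightarrow> ('g, 'v) lie \<Rightarrow> (nat \<Rightarrow> ('g, 'w) lie) \<Rightarrow> bool" where
  "lie_ascending_union K G Gs \<longleftrightarrow>
     lie_group K G \<and> (\<forall>n. lie_group K (Gs n)) \<and>
     (\<forall>n. carrier (Gs n) \<subseteq> carrier (Gs (Suc n))) \<and>
     carrier G = (\<Union>n. carrier (Gs n)) \<and>
     (\<forall>n. lie_hom K (Gs n) (Gs (Suc n)) (\<lambda>x. x)) \<and>
     (\<forall>n. lie_hom K (Gs n) G (\<lambda>x. x))"

text \<open>
  A formula cannot quantify over all objects of a category when these live on different types.
  The universal properties below are therefore relative to the types of the test objects,
  which are passed as type arguments. A topological group \<open>G = (\<Union>n. Gs n)\<close> need only be tested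
  on its own type, and a locally convex space which is the union of the images of spaces
  \<open>Es n\<close> on a type \<open>'w\<close> only on the type \<open>nat \<times> 'w\<close>: the universal property for test objects
  on all other types follows (\<open>topgroup_direct_limit_any_type\<close>, \<open>lcs_direct_limit_any_type\<close>).
  Where uniqueness is asserted, morphisms are made extensional, since only their values on the
  carrier matter.
\<close>

definition topgroup_direct_limit ::
    "'h itself \<Rightarrow> ('g, 'y) monoid_scheme \<Rightarrow> 'g topology \<Rightarrow>
      (nat \<Rightarrow> ('g, 'z) monoid_scheme) \<Rightarrow> (nat \<Rightarrow> 'g topology) \<Rightarrow> bool" where
  "topgroup_direct_limit (ty :: 'h itself) G T Gs Ts \<longleftrightarrow>
     topological_group G T \<and> (\<forall>n. topological_group (Gs n) (Ts n)) \<and>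
     (\<forall>n. topgroup_hom (Gs n) (Ts n) (Gs (Suc n)) (Ts (Suc n)) (\<lambda>x. x)) \<and>
     (\<forall>n. topgroup_hom (Gs n) (Ts n) G T (\<lambda>x. x)) \<and>
     (\<forall>(Y :: 'h monoid) S \<psi>s.
        topological_group Y S \<and>
        (\<forall>n. topgroup_hom (Gs n) (Ts n) Y S (\<psi>s n)) \<and>
        (\<forall>n. \<forall>x\<in>carrier (Gs n). \<psi>s (Suc n) x = \<psi>s n x) \<longrightarrow>
        (\<exists>!\<psi>. \<psi> \<in> extensional (carrier G) \<and> topgroup_hom G T Y S \<psi> \<and>
               (\<forall>n. \<forall>x\<in>carrier (Gs n). \<psi> x = \<psi>s n x)))"

definition lie_direct_limit ::
    "'h itself \<Rightarrow> 'e itself \<Rightarrow> complex set \<Rightarrow> ('g, 'v) lie \<Rightarrow> (nat \<Rightarrow> ('g, 'w) lie) \<Rightarrow> bool" where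
  "lie_direct_limit (ty :: 'h itself) (tz :: 'e itself) K G Gs \<longleftrightarrow>
     lie_group K G \<and> (\<forall>n. lie_group K (Gs n)) \<and>
     (\<forall>n. lie_hom K (Gs n) (Gs (Suc n)) (\<lambda>x. x)) \<and>
     (\<forall>n. lie_hom K (Gs n) G (\<lambda>x. x)) \<and>
     (\<forall>(Y :: ('h, 'e) lie) \<psi>s.
        lie_group K Y \<and>
        (\<forall>n. lie_hom K (Gs n) Y (\<psi>s n)) \<and>
        (\<forall>n. \<forall>x\<in>carrier (Gs n). \<psi>s (Suc n) x = \<psi>s n x) \<longrightarrow>
        (\<exists>!\<psi>. \<psi> \<in> extensional (carrier G) \<and> lie_hom K G Y \<psi> \<and>
               (\<forall>n. \<forall>x\<in>carrier (Gs n). \<psi> x = \<psi>s n x)))"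

text \<open>\<open>j n m\<close> is the bonding map from \<open>Es m\<close> to \<open>Es n\<close>, for \<open>n \<ge> m \<ge> n0\<close>.\<close>

definition lcs_direct_system ::
    "complex set \<Rightarrow> nat \<Rightarrow> (nat \<Rightarrow> 'w tvs) \<Rightarrow> (nat \<Rightarrow> nat \<Rightarrow> 'w \<Rightarrow> 'w) \<Rightarrow> bool" where
  "lcs_direct_system K n0 Es j \<longleftrightarrow>
     (\<forall>n\<ge>n0. locally_convex_space K (Es n)) \<and>
     (\<forall>m\<ge>n0. \<forall>n\<ge>m. continuous_linear K (Es m) (Es n) (j n m)) \<and>
     (\<forall>n\<ge>n0. \<forall>x\<in>carrier (Es n). j n n x = x) \<and>
     (\<forall>l\<ge>n0. \<forall>m\<ge>l. \<forall>n\<ge>m. \<forall>x\<in>carrier (Es l). j n m (j m l x) = j n l x)"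

definition lcs_direct_limit ::
    "'f itself \<Rightarrow> complex set \<Rightarrow> nat \<Rightarrow> (nat \<Rightarrow> 'w tvs) \<Rightarrow> (nat \<Rightarrow> nat \<Rightarrow> 'w \<Rightarrow> 'w) \<Rightarrow>
      'v tvs \<Rightarrow> (nat \<Rightarrow> 'w \<Rightarrow> 'v) \<Rightarrow> bool" where
  "lcs_direct_limit (ty :: 'f itself) K n0 Es j E js \<longleftrightarrow>
     locally_convex_space K E \<and>
     (\<forall>n\<ge>n0. continuous_linear K (Es n) E (js n)) \<and>
     (\<forall>m\<ge>n0. \<forall>n\<ge>m. \<forall>x\<in>carrier (Es m). js n (j n m x) = js m x) \<and>
     (\<forall>(F :: 'f tvs) fs.
        locally_convex_space K F \<and>
        (\<forall>n\<ge>n0. continuous_linear K (Es n) F (fs n)) \<and>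
        (\<forall>m\<ge>n0. \<forall>n\<ge>m. \<forall>x\<in>carrier (Es m). fs n (j n m x) = fs m x) \<longrightarrow>
        (\<exists>!f. f \<in> extensional (carrier E) \<and> continuous_linear K E F f \<and>
              (\<forall>n\<ge>n0. \<forall>x\<in>carrier (Es n). f (js n x) = fs n x)))"

definition direct_limit_chart ::
    "complex set \<Rightarrow> ('g, 'v) lie \<Rightarrow> (nat \<Rightarrow> ('g, 'w) lie) \<Rightarrow> 'g set \<Rightarrow> ('g \<Rightarrow> 'v) \<Rightarrow> bool" where
  "direct_limit_chart K G Gs U \<phi> \<longleftrightarrow>
     chart K (man G) U \<phi> \<and>
     (\<exists>n0 j js Us \<phi>s.
        (let E = model (man G); Es = (\<lambda>n. model (man (Gs n))) in
           lcs_direct_system K n0 Es j \<and>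
           lcs_direct_limit TYPE(nat \<times> 'w) K n0 Es j E js \<and>
           carrier E = (\<Union>n\<in>{n0..}. js n ` carrier (Es n))) \<and>
        (\<forall>n\<ge>n0. chart K (man (Gs n)) (Us n) (\<phi>s n)) \<and>
        (\<forall>m\<ge>n0. \<forall>n\<ge>m. Us m \<subseteq> Us n \<and> j n m ` (\<phi>s m ` Us m) \<subseteq> \<phi>s n ` Us n) \<and>
        U = (\<Union>n\<in>{n0..}. Us n) \<and>
        \<phi> ` U = (\<Union>n\<in>{n0..}. js n ` (\<phi>s n ` Us n)) \<and>
        (\<forall>n\<ge>n0. \<forall>x\<in>Us n. \<phi> x = js n (\<phi>s n x)))"

definition admits_direct_limit_chart ::
    "complex set \<Rightarrow> ('g, 'v) lie \<Rightarrow> (nat \<Rightarrow> ('g, 'w) lie) \<Rightarrow> bool" where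
  "admits_direct_limit_chart K G Gs \<longleftrightarrow> (\<exists>U \<phi>. direct_limit_chart K G Gs U \<phi> \<and> \<one>\<^bsub>G\<^esub> \<in> U)"


section \<open>Independence of the type of the test objects\<close>

lemma topgroup_direct_limit_any_type:
  fixes G :: "('g, 'y) monoid_scheme" and Gs :: "nat \<Rightarrow> ('g, 'z) monoid_scheme"
  assumes lim: "topgroup_direct_limit TYPE('g) G T Gs Ts"
    and un: "carrier G = (\<Union>n. carrier (Gs n))"
  shows "topgroup_direct_limit TYPE('h) G T Gs Ts"
proof -
  have tG: "topological_group G T" and tGs: "\<And>n. topological_group (Gs n) (Ts n)"
    and step: "\<And>n. topgroup_hom (Gs n) (Ts n) (Gs (Suc n)) (Ts (Suc n)) (\<lambda>x. x)"
    and incl: "\<And>n. topgroup_hom (Gs n) (Ts n) G T (\<lambda>x. x)"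
    using lim by (auto simp: topgroup_direct_limit_def)
  have univ: "\<exists>!\<psi>. \<psi> \<in> extensional (carrier G) \<and> topgroup_hom G T Y S \<psi> \<and>
               (\<forall>n. \<forall>x\<in>carrier (Gs n). \<psi> x = \<psi>s n x)"
    if "topological_group Y S" "\<forall>n. topgroup_hom (Gs n) (Ts n) Y S (\<psi>s n)"
      "\<forall>n. \<forall>x\<in>carrier (Gs n). \<psi>s (Suc n) x = \<psi>s n x"
    for Y :: "'g monoid" and S \<psi>s
    using lim that by (simp add: topgroup_direct_limit_def)
  have grG: "group G" and topG: "topspace T = carrier G"
    using tG by (auto simp: topological_group_def)
  interpret G: group G by (fact grG)
  have asc: "carrier (Gs m) \<subseteq> carrier (Gs n)" if "m \<le> n" for m n
    using that
  proof (induction n rule: dec_induct)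
    case (step n)
    then show ?case
      using \<open>\<And>n. topgroup_hom (Gs n) (Ts n) (Gs (Suc n)) (Ts (Suc n)) (\<lambda>x. x)\<close>[of n]
      by (auto simp: topgroup_hom_def hom_def Pi_def)
  qed simp
  have sub: "carrier (Gs n) \<subseteq> carrier G" for n
    using un by blast
  have multG: "x \<otimes>\<^bsub>Gs n\<^esub> y = x \<otimes>\<^bsub>G\<^esub> y" if "x \<in> carrier (Gs n)" "y \<in> carrier (Gs n)" for x y n
    using incl[of n] that by (auto simp: topgroup_hom_def hom_def)
  have topGs: "topspace (Ts n) = carrier (Gs n)" for n
    using tGs[of n] by (auto simp: topological_group_def)
  have "\<exists>!\<psi>. \<psi> \<in> extensional (carrier G) \<and> topgroup_hom G T Y S \<psi> \<and>
               (\<forall>n. \<forall>x\<in>carrier (Gs n). \<psi> x = \<psi>s n x)"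
    if tY: "topological_group Y S"
      and homs: "\<forall>n. topgroup_hom (Gs n) (Ts n) Y S (\<psi>s n)"
      and comp: "\<forall>n. \<forall>x\<in>carrier (Gs n). \<psi>s (Suc n) x = \<psi>s n x"
    for Y :: "'h monoid" and S \<psi>s
  proof -
    have topY: "topspace S = carrier Y" and grY: "group Y"
      using tY by (auto simp: topological_group_def)
    interpret Y: group Y by (fact grY)
    have comp': "\<psi>s n x = \<psi>s m x" if "m \<le> n" "x \<in> carrier (Gs m)" for m n x
      using that(1)
    proof (induction n rule: dec_induct)
      case (step n)
      then show ?case using comp asc[of m n] that(2) by auto
    qed simp
    define \<psi> where "\<psi> = restrict (\<lambda>x. \<psi>s (LEAST n. x \<in> carrier (Gs n)) x) (carrier G)"
    have \<psi>: "\<psi> x = \<psi>s n x" if "x \<in> carrier (Gs n)" for n x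
    proof -
      have "x \<in> carrier (Gs (LEAST n. x \<in> carrier (Gs n)))" "(LEAST n. x \<in> carrier (Gs n)) \<le> n"
        using that by (auto intro: LeastI Least_le)
      then show ?thesis
        using comp' sub[of n] that by (auto simp: \<psi>_def)
    qed
    have \<psi>hom: "\<psi> \<in> hom G Y"
    proof (rule homI)
      fix x assume "x \<in> carrier G"
      then obtain n where "x \<in> carrier (Gs n)" using un by blast
      then show "\<psi> x \<in> carrier Y"
        using homs by (auto simp: \<psi> topgroup_hom_def hom_def Pi_def)
    next
      fix x y assume "x \<in> carrier G" "y \<in> carrier G"
      then obtain m n where "x \<in> carrier (Gs m)" "y \<in> carrier (Gs n)" using un by blast
      then have xy: "x \<in> carrier (Gs (max m n))" "y \<in> carrier (Gs (max m n))"
        using asc[of m "max m n"] asc[of n "max m n"] by auto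
      then have "x \<otimes>\<^bsub>G\<^esub> y \<in> carrier (Gs (max m n))"
        using multG[OF xy] tGs[of "max m n"] group.is_monoid monoid.m_closed
        unfolding topological_group_def by metis
      then show "\<psi> (x \<otimes>\<^bsub>G\<^esub> y) = \<psi> x \<otimes>\<^bsub>Y\<^esub> \<psi> y"
        using homs xy multG[OF xy, symmetric]
        by (simp add: \<psi> topgroup_hom_def hom_def)
    qed
    have \<psi>cl: "\<psi> x \<in> carrier Y" if "x \<in> carrier G" for x
      using \<psi>hom that by (auto simp: hom_def)
    have \<psi>inv: "\<psi> (inv\<^bsub>G\<^esub> x) = inv\<^bsub>Y\<^esub> \<psi> x" if "x \<in> carrier G" for x
      using group_hom.hom_inv[of G Y \<psi> x] \<psi>hom that
      by (simp add: group_hom_def group_hom_axioms_def)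
    define T' where "T' = pullback_topology (carrier G) \<psi> S"
    have topT': "topspace T' = carrier G"
      using \<psi>cl topY by (auto simp: T'_def topspace_pullback_topology)
    have cont\<psi>: "continuous_map T' S \<psi>"
      using continuous_map_pullback[of S S id "carrier G" \<psi>] by (simp add: T'_def)
    let ?G = "monoid.truncate G"
    have [simp]: "carrier ?G = carrier G" "mult ?G = mult G" "one ?G = one G"
      by (simp_all add: monoid.truncate_def)
    have invG: "inv\<^bsub>?G\<^esub> x = inv\<^bsub>G\<^esub> x" for x
      by (simp add: m_inv_def)
    have "group ?G"
      by (rule groupI) (auto simp: G.m_assoc intro: G.l_inv)
    moreover have "continuous_map (prod_topology T' T') T' (\<lambda>(x, y). x \<otimes>\<^bsub>G\<^esub> y)"
      unfolding T'_def
    proof (rule continuous_map_pullback', fold T'_def)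
      have "continuous_map (prod_topology T' T') S
          ((\<lambda>(x, y). x \<otimes>\<^bsub>Y\<^esub> y) \<circ> (\<lambda>p. (\<psi> (fst p), \<psi> (snd p))))"
        using tY cont\<psi>
        by (intro continuous_map_compose[where X' = "prod_topology S S"])
          (auto simp: topological_group_def continuous_map_pairwise o_def
            intro!: continuous_map_compose[unfolded o_def, OF continuous_map_fst cont\<psi>]
              continuous_map_compose[unfolded o_def, OF continuous_map_snd cont\<psi>])
      then show "continuous_map (prod_topology T' T') S (\<psi> \<circ> (\<lambda>(x, y). x \<otimes>\<^bsub>G\<^esub> y))"
        by (rule continuous_map_eq) (use \<psi>hom in \<open>auto simp: topT' hom_def\<close>)
    qed (auto simp: topT')
    moreover have "continuous_map T' T' (\<lambda>x. inv\<^bsub>G\<^esub> x)"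
    proof -
      have "continuous_map T' S ((\<lambda>x. inv\<^bsub>Y\<^esub> x) \<circ> \<psi>)"
        using tY cont\<psi> continuous_map_compose by (auto simp: topological_group_def)
      then have "continuous_map T' S (\<psi> \<circ> (\<lambda>x. inv\<^bsub>G\<^esub> x))"
        by (rule continuous_map_eq) (auto simp: topT' \<psi>inv)
      then have "continuous_map T' (pullback_topology (carrier G) \<psi> S) (\<lambda>x. inv\<^bsub>G\<^esub> x)"
        by (rule continuous_map_pullback') (auto simp: topT')
      then show ?thesis by (simp add: T'_def)
    qed
    ultimately have tG': "topological_group ?G T'"
      by (simp add: topological_group_def topT' invG)
    have "topgroup_hom (Gs n) (Ts n) ?G T' (\<lambda>x. x)" for n
    proof -
      have "continuous_map (Ts n) S (\<psi>s n)"
        using homs by (simp add: topgroup_hom_def)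
      then have "continuous_map (Ts n) S (\<psi> \<circ> (\<lambda>x. x))"
        by (rule continuous_map_eq) (auto simp: topGs \<psi>)
      then have "continuous_map (Ts n) T' (\<lambda>x. x)"
        unfolding T'_def by (rule continuous_map_pullback') (use topGs sub in auto)
      then show ?thesis
        using incl[of n] by (auto simp: topgroup_hom_def hom_def)
    qed
    then have "\<exists>!\<theta>. \<theta> \<in> extensional (carrier G) \<and> topgroup_hom G T ?G T' \<theta> \<and>
               (\<forall>n. \<forall>x\<in>carrier (Gs n). \<theta> x = x)"
      using tG' by (intro univ[of ?G T' "\<lambda>_ x. x"]) simp_all
    then obtain \<theta> where \<theta>: "topgroup_hom G T ?G T' \<theta>" "\<forall>n. \<forall>x\<in>carrier (Gs n). \<theta> x = x"
      by (elim ex1E conjE)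
    have "continuous_map T S (\<psi> \<circ> \<theta>)"
      using \<theta>(1) cont\<psi> continuous_map_compose by (auto simp: topgroup_hom_def)
    then have "continuous_map T S \<psi>"
      by (rule continuous_map_eq) (use \<theta>(2) topG un in auto)
    then have "topgroup_hom G T Y S \<psi>"
      using \<psi>hom by (simp add: topgroup_hom_def)
    moreover have ext: "\<psi> \<in> extensional (carrier G)" by (simp add: \<psi>_def)
    moreover have val: "\<forall>n. \<forall>x\<in>carrier (Gs n). \<psi> x = \<psi>s n x" using \<psi> by simp
    moreover have "\<psi>' = \<psi>" if "\<psi>' \<in> extensional (carrier G)"
        "\<forall>n. \<forall>x\<in>carrier (Gs n). \<psi>' x = \<psi>s n x" for \<psi>'
    proof (rule extensionalityI[OF that(1) ext])
      fix z assume "z \<in> carrier G"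
      then obtain n where "z \<in> carrier (Gs n)" using un by auto
      then show "\<psi>' z = \<psi> z" using that(2) val by simp
    qed
    ultimately show ?thesis by (intro ex1I[of _ \<psi>]) (assumption | elim conjE | intro conjI)+
  qed
  then show ?thesis
    using tG tGs step incl by (auto simp: topgroup_direct_limit_def)
qed

text \<open>The subspace \<open>h ` C\<close> of \<open>F\<close>, transported along the bijection \<open>h\<close> to a space on \<open>C\<close>.\<close>

definition transport_tvs :: "'u set \<Rightarrow> ('u \<Rightarrow> 'v) \<Rightarrow> 'v tvs \<Rightarrow> 'u tvs" where
  "transport_tvs C h F =
     \<lparr>carrier = C, mult = undefined, one = undefined,
      zero = inv_into C h \<zero>\<^bsub>F\<^esub>,
      add = (\<lambda>x y. inv_into C h (h x \<oplus>\<^bsub>F\<^esub> h y)),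
      smult = (\<lambda>c x. inv_into C h (c \<odot>\<^bsub>F\<^esub> h x)),
      vtop = pullback_topology C h (vtop F)\<rparr>"

lemma locally_convex_space_transport:
  assumes F: "locally_convex_space K F" and K: "\<real> \<subseteq> K"
    and inj: "inj_on h C" and sub: "h ` C \<subseteq> carrier F" and zero: "\<zero>\<^bsub>F\<^esub> \<in> h ` C"
    and add: "\<And>x y. x \<in> C \<Longrightarrow> y \<in> C \<Longrightarrow> h x \<oplus>\<^bsub>F\<^esub> h y \<in> h ` C"
    and smult: "\<And>c x. c \<in> K \<Longrightarrow> x \<in> C \<Longrightarrow> c \<odot>\<^bsub>F\<^esub> h x \<in> h ` C"
  shows "locally_convex_space K (transport_tvs C h F)"
proof -
  let ?F = "transport_tvs C h F"
  let ?g = "inv_into C h"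
  have tF: "topological_vector_space K F" and topF: "topspace (vtop F) = carrier F"
    and modF: "module (scalar_field K) F"
    using F by (auto simp: locally_convex_space_def topological_vector_space_def)
  interpret F: module "scalar_field K" F by (fact modF)
  have [simp]: "carrier ?F = C" "\<zero>\<^bsub>?F\<^esub> = ?g \<zero>\<^bsub>F\<^esub>"
    "x \<oplus>\<^bsub>?F\<^esub> y = ?g (h x \<oplus>\<^bsub>F\<^esub> h y)" "c \<odot>\<^bsub>?F\<^esub> x = ?g (c \<odot>\<^bsub>F\<^esub> h x)" for x y c
    by (simp_all add: transport_tvs_def)
  have vt: "vtop ?F = pullback_topology C h (vtop F)"
    by (simp add: transport_tvs_def)
  have [simp]: "carrier (scalar_field K) = K" "\<one>\<^bsub>scalar_field K\<^esub> = 1"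
    "a \<oplus>\<^bsub>scalar_field K\<^esub> b = a + b" "a \<otimes>\<^bsub>scalar_field K\<^esub> b = a * b"
    "\<zero>\<^bsub>scalar_field K\<^esub> = 0" for a b
    by (simp_all add: scalar_field_def)
  have hC: "h x \<in> carrier F" if "x \<in> C" for x using sub that by blast
  have g0: "?g \<zero>\<^bsub>F\<^esub> \<in> C" "h (?g \<zero>\<^bsub>F\<^esub>) = \<zero>\<^bsub>F\<^esub>"
    using zero by (auto intro: inv_into_into f_inv_into_f)
  have ga: "?g (h x \<oplus>\<^bsub>F\<^esub> h y) \<in> C" "h (?g (h x \<oplus>\<^bsub>F\<^esub> h y)) = h x \<oplus>\<^bsub>F\<^esub> h y"
    if "x \<in> C" "y \<in> C" for x y
    using add[OF that] by (auto intro: inv_into_into f_inv_into_f)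
  have gs: "?g (c \<odot>\<^bsub>F\<^esub> h x) \<in> C" "h (?g (c \<odot>\<^bsub>F\<^esub> h x)) = c \<odot>\<^bsub>F\<^esub> h x"
    if "c \<in> K" "x \<in> C" for c x
    using smult[OF that] by (auto intro: inv_into_into f_inv_into_f)
  have eqI: "x = y" if "x \<in> C" "y \<in> C" "h x = h y" for x y
    using inj that by (auto simp: inj_on_def)
  have Kr: "complex_of_real t \<in> K" for t using K by auto
  have m1: "-1 \<in> K" "1 \<in> K" using Kr[of "-1"] Kr[of 1] by simp_all
  have "abelian_group ?F"
  proof (rule abelian_groupI)
    fix x assume "x \<in> carrier ?F"
    then have x: "x \<in> C" by simp
    have "((-1) \<odot>\<^bsub>F\<^esub> h x) \<oplus>\<^bsub>F\<^esub> h x = ((-1) \<odot>\<^bsub>F\<^esub> h x) \<oplus>\<^bsub>F\<^esub> (1 \<odot>\<^bsub>F\<^esub> h x)"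
      using F.smult_one[of "h x"] hC[OF x] by simp
    also have "\<dots> = (-1 + 1) \<odot>\<^bsub>F\<^esub> h x"
      using F.smult_l_distr[of "-1" 1 "h x"] m1 hC[OF x] by simp
    also have "\<dots> = \<zero>\<^bsub>F\<^esub>"
      using F.smult_l_null[of "h x"] hC[OF x] by simp
    finally have "?g ((-1) \<odot>\<^bsub>F\<^esub> h x) \<oplus>\<^bsub>?F\<^esub> x = \<zero>\<^bsub>?F\<^esub>"
      using gs[OF m1(1) x] by simp
    then show "\<exists>y\<in>carrier ?F. y \<oplus>\<^bsub>?F\<^esub> x = \<zero>\<^bsub>?F\<^esub>"
      using gs[OF m1(1) x] by (intro bexI[of _ "?g ((-1) \<odot>\<^bsub>F\<^esub> h x)"]) simp_all
  next
    fix x y z assume "x \<in> carrier ?F" "y \<in> carrier ?F" "z \<in> carrier ?F"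
    then show "(x \<oplus>\<^bsub>?F\<^esub> y) \<oplus>\<^bsub>?F\<^esub> z = x \<oplus>\<^bsub>?F\<^esub> (y \<oplus>\<^bsub>?F\<^esub> z)"
      by (simp add: ga hC F.a_assoc)
  next
    fix x y assume "x \<in> carrier ?F" "y \<in> carrier ?F"
    then show "x \<oplus>\<^bsub>?F\<^esub> y = y \<oplus>\<^bsub>?F\<^esub> x"
      using F.a_comm[of "h x" "h y"] hC by simp
  qed (simp_all add: g0 ga hC inj)
  then have "module (scalar_field K) ?F"
  proof (rule moduleI[OF F.R.is_cring])
    fix a b x assume "a \<in> carrier (scalar_field K)" "b \<in> carrier (scalar_field K)" "x \<in> carrier ?F"
    then have *: "a \<in> K" "b \<in> K" "x \<in> C" by simp_all
    moreover have "a + b \<in> K" using F.R.a_closed[of a b] * by simp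
    ultimately show "(a \<oplus>\<^bsub>scalar_field K\<^esub> b) \<odot>\<^bsub>?F\<^esub> x = a \<odot>\<^bsub>?F\<^esub> x \<oplus>\<^bsub>?F\<^esub> b \<odot>\<^bsub>?F\<^esub> x"
      using F.smult_l_distr[of a b "h x"] hC by (simp add: gs)
  next
    fix a x y assume "a \<in> carrier (scalar_field K)" "x \<in> carrier ?F" "y \<in> carrier ?F"
    then show "a \<odot>\<^bsub>?F\<^esub> (x \<oplus>\<^bsub>?F\<^esub> y) = a \<odot>\<^bsub>?F\<^esub> x \<oplus>\<^bsub>?F\<^esub> a \<odot>\<^bsub>?F\<^esub> y"
      using F.smult_r_distr[of a "h x" "h y"] hC by (simp add: gs ga)
  next
    fix a b x assume "a \<in> carrier (scalar_field K)" "b \<in> carrier (scalar_field K)" "x \<in> carrier ?F"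
    then show "(a \<otimes>\<^bsub>scalar_field K\<^esub> b) \<odot>\<^bsub>?F\<^esub> x = a \<odot>\<^bsub>?F\<^esub> (b \<odot>\<^bsub>?F\<^esub> x)"
      using F.smult_assoc1[of a b "h x"] hC by (simp add: gs)
  next
    fix x assume "x \<in> carrier ?F"
    then show "\<one>\<^bsub>scalar_field K\<^esub> \<odot>\<^bsub>?F\<^esub> x = x"
      using F.smult_one[of "h x"] hC inj by simp
  qed (auto simp: gs)
  moreover have top: "topspace (vtop ?F) = C"
    using hC topF by (auto simp: vt topspace_pullback_topology)
  moreover have conth: "continuous_map (vtop ?F) (vtop F) h"
    using continuous_map_pullback[of "vtop F" "vtop F" id C h] by (simp add: vt)
  have "continuous_map (prod_topology (vtop ?F) (vtop ?F)) (vtop ?F) (\<lambda>(x, y). x \<oplus>\<^bsub>?F\<^esub> y)"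
    (is "continuous_map ?P _ ?a")
  proof -
    have "continuous_map ?P (vtop F) ((\<lambda>(x, y). x \<oplus>\<^bsub>F\<^esub> y) \<circ> (\<lambda>p. (h (fst p), h (snd p))))"
      using tF
      by (intro continuous_map_compose[where X' = "prod_topology (vtop F) (vtop F)"])
        (auto simp: topological_vector_space_def continuous_map_pairwise o_def
            intro!: continuous_map_compose[unfolded o_def, OF continuous_map_fst conth]
              continuous_map_compose[unfolded o_def, OF continuous_map_snd conth])
    then have "continuous_map ?P (vtop F) (h \<circ> ?a)"
      by (rule continuous_map_eq) (auto simp: top ga)
    then have "continuous_map ?P (pullback_topology C h (vtop F)) ?a"
      by (rule continuous_map_pullback') (auto simp: top ga)
    then show ?thesis by (simp add: vt)
  qed
  moreover have "continuous_map (prod_topology (top_of_set K) (vtop ?F)) (vtop ?F)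
      (\<lambda>(c, x). c \<odot>\<^bsub>?F\<^esub> x)" (is "continuous_map ?P _ ?a")
  proof -
    have "continuous_map ?P (vtop F) ((\<lambda>(c, x). c \<odot>\<^bsub>F\<^esub> x) \<circ> (\<lambda>p. (fst p, h (snd p))))"
      using tF
      by (intro continuous_map_compose[where X' = "prod_topology (top_of_set K) (vtop F)"])
        (auto simp: topological_vector_space_def continuous_map_pairwise o_def continuous_map_fst
            intro!: continuous_map_compose[unfolded o_def, OF continuous_map_snd conth])
    then have "continuous_map ?P (vtop F) (h \<circ> ?a)"
      by (rule continuous_map_eq) (auto simp: top gs)
    then have "continuous_map ?P (pullback_topology C h (vtop F)) ?a"
      by (rule continuous_map_pullback') (auto simp: top gs)
    then show ?thesis by (simp add: vt)
  qed
  ultimately have "topological_vector_space K ?F"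
    by (simp add: topological_vector_space_def)
  moreover have "\<exists>D O'. convex_in ?F D \<and> openin (vtop ?F) O' \<and> \<zero>\<^bsub>?F\<^esub> \<in> O' \<and> O' \<subseteq> D \<and> D \<subseteq> W"
    if W: "openin (vtop ?F) W" "\<zero>\<^bsub>?F\<^esub> \<in> W" for W
  proof -
    obtain U where U: "openin (vtop F) U" "W = h -` U \<inter> C"
      using W(1) unfolding vt openin_pullback_topology by blast
    then have "\<zero>\<^bsub>F\<^esub> \<in> U" using W(2) g0 by simp
    with F U(1) have "\<exists>D O'. convex_in F D \<and> openin (vtop F) O' \<and> \<zero>\<^bsub>F\<^esub> \<in> O' \<and> O' \<subseteq> D \<and> D \<subseteq> U"
      by (simp add: locally_convex_space_def)
    then obtain D O' where D: "convex_in F D" "openin (vtop F) O'" "\<zero>\<^bsub>F\<^esub> \<in> O'" "O' \<subseteq> D" "D \<subseteq> U"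
      by (elim exE conjE)
    have "convex_in ?F (h -` D \<inter> C)"
    proof -
      have "(complex_of_real (1 - t) \<odot>\<^bsub>?F\<^esub> x) \<oplus>\<^bsub>?F\<^esub> (complex_of_real t \<odot>\<^bsub>?F\<^esub> y) \<in> h -` D \<inter> C"
        if "x \<in> h -` D \<inter> C" "y \<in> h -` D \<inter> C" "t \<in> {0..1}" for x y t
      proof -
        have "(complex_of_real (1 - t) \<odot>\<^bsub>F\<^esub> h x) \<oplus>\<^bsub>F\<^esub> (complex_of_real t \<odot>\<^bsub>F\<^esub> h y) \<in> D"
          using D(1) that unfolding convex_in_def by blast
        then show ?thesis
          using that gs[OF Kr, of x "1 - t"] gs[OF Kr, of y t]
            ga[of "?g (complex_of_real (1 - t) \<odot>\<^bsub>F\<^esub> h x)" "?g (complex_of_real t \<odot>\<^bsub>F\<^esub> h y)"]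
          by simp
      qed
      then show ?thesis by (auto simp: convex_in_def)
    qed
    moreover have "openin (vtop ?F) (h -` O' \<inter> C)"
      using D(2) by (auto simp: vt openin_pullback_topology)
    ultimately show ?thesis
      using D U(2) g0 by (intro exI[of _ "h -` D \<inter> C"] exI[of _ "h -` O' \<inter> C"]) auto
  qed
  ultimately show ?thesis
    by (simp add: locally_convex_space_def)
qed

lemma lcs_direct_limit_any_type:
  fixes Es :: "nat \<Rightarrow> 'w tvs" and E :: "'v tvs"
  assumes K: "K = \<real> \<or> K = UNIV"
    and sys: "lcs_direct_system K n0 Es j"
    and lim: "lcs_direct_limit TYPE(nat \<times> 'w) K n0 Es j E js"
    and un: "carrier E = (\<Union>n\<in>{n0..}. js n ` carrier (Es n))"
  shows "lcs_direct_limit TYPE('f) K n0 Es j E js"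
proof -
  have univ: "\<exists>!f. f \<in> extensional (carrier E) \<and> continuous_linear K E F f \<and>
              (\<forall>n\<ge>n0. \<forall>x\<in>carrier (Es n). f (js n x) = fs n x)"
    if "locally_convex_space K F" "\<forall>n\<ge>n0. continuous_linear K (Es n) F (fs n)"
      "\<forall>m\<ge>n0. \<forall>n\<ge>m. \<forall>x\<in>carrier (Es m). fs n (j n m x) = fs m x"
    for F :: "(nat \<times> 'w) tvs" and fs
    using lim that by (simp add: lcs_direct_limit_def)
  have "\<exists>!f. f \<in> extensional (carrier E) \<and> continuous_linear K E F f \<and>
              (\<forall>n\<ge>n0. \<forall>x\<in>carrier (Es n). f (js n x) = fs n x)"
    if F: "locally_convex_space K F"
      and fs: "\<forall>n\<ge>n0. continuous_linear K (Es n) F (fs n)"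
      and comp: "\<forall>m\<ge>n0. \<forall>n\<ge>m. \<forall>x\<in>carrier (Es m). fs n (j n m x) = fs m x"
    for F :: "'f tvs" and fs
  proof -
    have modE: "module (scalar_field K) (Es n)" "topspace (vtop (Es n)) = carrier (Es n)" if "n \<ge> n0" for n
      using sys that
      by (auto simp: lcs_direct_system_def locally_convex_space_def topological_vector_space_def)
    have modF: "module (scalar_field K) F" "topspace (vtop F) = carrier F"
      using F by (auto simp: locally_convex_space_def topological_vector_space_def)
    interpret F: module "scalar_field K" F by (fact modF)
    have fadd: "fs n (x \<oplus>\<^bsub>Es n\<^esub> y) = fs n x \<oplus>\<^bsub>F\<^esub> fs n y" and fcl: "fs n x \<in> carrier F"
      if "n \<ge> n0" "x \<in> carrier (Es n)" "y \<in> carrier (Es n)" for n x y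
      using fs that by (auto simp: continuous_linear_def)
    have fsm: "fs n (c \<odot>\<^bsub>Es n\<^esub> x) = c \<odot>\<^bsub>F\<^esub> fs n x" if "n \<ge> n0" "c \<in> K" "x \<in> carrier (Es n)" for n c x
      using fs that by (auto simp: continuous_linear_def)
    define h where "h = (\<lambda>(n, x). fs n x)"
    define A where "A = (SIGMA n:{n0..}. carrier (Es n))"
    define C where "C = inv_into A h ` (h ` A)"
    have hC: "h ` C = h ` A" and inj: "inj_on h C"
      by (auto simp: C_def image_image f_inv_into_f inj_on_def)
    have hA: "z \<in> h ` A \<longleftrightarrow> (\<exists>n\<ge>n0. \<exists>x\<in>carrier (Es n). z = fs n x)" for z
      by (force simp: h_def A_def)
    have sub: "h ` C \<subseteq> carrier F"
      unfolding hC by (auto simp: h_def A_def fcl)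
    have zero: "\<zero>\<^bsub>F\<^esub> \<in> h ` C"
    proof -
      interpret E0: module "scalar_field K" "Es n0" by (rule modE) simp
      have "fs n0 \<zero>\<^bsub>Es n0\<^esub> = fs n0 \<zero>\<^bsub>Es n0\<^esub> \<oplus>\<^bsub>F\<^esub> fs n0 \<zero>\<^bsub>Es n0\<^esub>"
        using fadd[of n0 "\<zero>\<^bsub>Es n0\<^esub>" "\<zero>\<^bsub>Es n0\<^esub>"] by simp
      then have "fs n0 \<zero>\<^bsub>Es n0\<^esub> = \<zero>\<^bsub>F\<^esub>"
        using fcl[of n0 "\<zero>\<^bsub>Es n0\<^esub>" "\<zero>\<^bsub>Es n0\<^esub>"] F.add.l_cancel_one' by auto
      then show ?thesis
        unfolding hC hA by (intro exI[of _ n0]) (auto intro!: bexI[of _ "\<zero>\<^bsub>Es n0\<^esub>"])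
    qed
    have add: "h x \<oplus>\<^bsub>F\<^esub> h y \<in> h ` C" if "x \<in> C" "y \<in> C" for x y
    proof -
      obtain m a n b where *: "m \<ge> n0" "a \<in> carrier (Es m)" "h x = fs m a"
          "n \<ge> n0" "b \<in> carrier (Es n)" "h y = fs n b"
        using imageI[OF \<open>x \<in> C\<close>, of h] imageI[OF \<open>y \<in> C\<close>, of h] unfolding hC hA by blast
      let ?N = "max m n"
      interpret N: module "scalar_field K" "Es ?N" by (rule modE) (use * in simp)
      have ab: "j ?N m a \<in> carrier (Es ?N)" "j ?N n b \<in> carrier (Es ?N)"
        using sys * by (auto simp: lcs_direct_system_def continuous_linear_def Pi_def)
      have "h x \<oplus>\<^bsub>F\<^esub> h y = fs ?N (j ?N m a \<oplus>\<^bsub>Es ?N\<^esub> j ?N n b)"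
        using fadd[OF _ ab] comp * by simp
      then show ?thesis
        unfolding hC hA using ab * by (intro exI[of _ ?N]) auto
    qed
    have smult: "c \<odot>\<^bsub>F\<^esub> h x \<in> h ` C" if "c \<in> K" "x \<in> C" for c x
    proof -
      obtain n a where *: "n \<ge> n0" "a \<in> carrier (Es n)" "h x = fs n a"
        using imageI[OF \<open>x \<in> C\<close>, of h] unfolding hC hA by blast
      interpret N: module "scalar_field K" "Es n" by (rule modE) (use * in simp)
      have "c \<odot>\<^bsub>Es n\<^esub> a \<in> carrier (Es n)"
        using N.smult_closed[of c a] that * by (simp add: scalar_field_def)
      then show ?thesis
        unfolding hC hA using fsm * that by metis
    qed
    let ?F = "transport_tvs C h F"
    let ?g = "inv_into C h"
    have F': "locally_convex_space K ?F"
      by (rule locally_convex_space_transport[OF F _ inj sub zero add smult]) (use K in auto)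
    have sim [simp]: "carrier ?F = C"
      "x \<oplus>\<^bsub>?F\<^esub> y = ?g (h x \<oplus>\<^bsub>F\<^esub> h y)" "c \<odot>\<^bsub>?F\<^esub> x = ?g (c \<odot>\<^bsub>F\<^esub> h x)" for x y c
      by (simp_all add: transport_tvs_def)
    have vt: "vtop ?F = pullback_topology C h (vtop F)"
      by (simp add: transport_tvs_def)
    have conth: "continuous_map (vtop ?F) (vtop F) h"
      using continuous_map_pullback[of "vtop F" "vtop F" id C h] by (simp add: vt)
    have fin: "fs n x \<in> h ` C" if "n \<ge> n0" "x \<in> carrier (Es n)" for n x
      unfolding hC hA using that by blast
    have "continuous_linear K (Es n) ?F (?g \<circ> fs n)" if n: "n \<ge> n0" for n
    proof -
      have "continuous_map (vtop (Es n)) (vtop F) (fs n)"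
        using fs n by (simp add: continuous_linear_def)
      then have "continuous_map (vtop (Es n)) (vtop F) (h \<circ> (?g \<circ> fs n))"
        by (rule continuous_map_eq) (auto simp: modE n fin f_inv_into_f)
      then have "continuous_map (vtop (Es n)) (vtop ?F) (?g \<circ> fs n)"
        unfolding vt
        by (rule continuous_map_pullback') (auto simp: modE n intro!: inv_into_into fin)
      then show ?thesis
        by (auto simp: continuous_linear_def n fin f_inv_into_f fadd fsm inv_into_into)
    qed
    moreover have "\<forall>m\<ge>n0. \<forall>n\<ge>m. \<forall>x\<in>carrier (Es m). (?g \<circ> fs n) (j n m x) = (?g \<circ> fs m) x"
      using comp by simp
    ultimately have "\<exists>!f. f \<in> extensional (carrier E) \<and> continuous_linear K E ?F f \<and>
              (\<forall>n\<ge>n0. \<forall>x\<in>carrier (Es n). f (js n x) = (?g \<circ> fs n) x)"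
      using F' by (intro univ[of ?F "\<lambda>n. ?g \<circ> fs n"]) simp_all
    then obtain f where f: "continuous_linear K E ?F f"
        "\<forall>n\<ge>n0. \<forall>x\<in>carrier (Es n). f (js n x) = ?g (fs n x)"
      unfolding o_def by (elim ex1E conjE)
    have E: "locally_convex_space K E"
      using lim by (simp add: lcs_direct_limit_def)
    then interpret E: module "scalar_field K" E
      by (simp add: locally_convex_space_def topological_vector_space_def)
    have topE: "topspace (vtop E) = carrier E"
      using E by (simp add: locally_convex_space_def topological_vector_space_def)
    define f' where "f' = restrict (h \<circ> f) (carrier E)"
    have fC: "f x \<in> C" if "x \<in> carrier E" for x
      using f(1) that by (auto simp: continuous_linear_def Pi_def)
    have "continuous_map (vtop E) (vtop F) (h \<circ> f)"
      using f(1) conth continuous_map_compose by (auto simp: continuous_linear_def)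
    then have "continuous_map (vtop E) (vtop F) f'"
      by (rule continuous_map_eq) (auto simp: f'_def topE)
    moreover have "c \<odot>\<^bsub>E\<^esub> x \<in> carrier E" if "c \<in> K" "x \<in> carrier E" for c x
      using E.smult_closed[of c x] that by (simp add: scalar_field_def)
    ultimately have "continuous_linear K E F f'"
      using f(1) fC sub add smult
      by (auto simp: continuous_linear_def f'_def f_inv_into_f)
    moreover have ext: "f' \<in> extensional (carrier E)" by (simp add: f'_def)
    moreover have val: "\<forall>n\<ge>n0. \<forall>x\<in>carrier (Es n). f' (js n x) = fs n x"
      using f(2) un by (auto simp: f'_def fin f_inv_into_f)
    moreover have "g' = f'" if "g' \<in> extensional (carrier E)"
        "\<forall>n\<ge>n0. \<forall>x\<in>carrier (Es n). g' (js n x) = fs n x" for g'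
    proof (rule extensionalityI[OF that(1) ext])
      fix z assume "z \<in> carrier E"
      then obtain n x where "n \<ge> n0" "x \<in> carrier (Es n)" "z = js n x"
        using un by auto
      then show "g' z = f' z" using that(2) val by simp
    qed
    ultimately show ?thesis by (intro ex1I[of _ f']) (assumption | elim conjE | intro conjI)+
  qed
  then show ?thesis
    using lim by (simp add: lcs_direct_limit_def)
qed

end

theory Submission
  imports Defs
begin

text \<open>The topological direct limit property provides the limit homomorphism \<open>\<psi>\<close> of a compatible
family \<open>\<psi>s n\<close> as a continuous homomorphism into a Lie group \<open>Y\<close>, and makes it unique. What has
to be proved is that \<open>\<psi>\<close> is smooth. As \<open>\<psi> x = \<psi> p \<psi>(p\<inverse> x)\<close> and left translations are smooth, it
suffices to do so near \<open>1\<close>.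

Read \<open>\<psi>\<close> in the direct limit chart and in a chart of \<open>Y\<close> around its neutral element \<open>e\<close>; this is
a map \<open>g\<close> between open sets of the modelling spaces \<open>E\<close> and \<open>F\<close>. A point and a direction of \<open>E\<close>
both come from some stage, and so does a short segment of the line which they span. Directional
derivatives of \<open>g\<close> therefore exist, because \<open>\<psi>s n\<close> is smooth; but nothing at the finite stages
makes them jointly continuous in point and direction. The group structure does. Differentiating
\<open>\<psi> b = \<psi> a \<psi>(a\<inverse> b)\<close> with respect to \<open>b\<close> at \<open>b = a\<close> gives
  \<open>D\<^sub>y g(x) = D\<^bsub>(0, L A(x, y))\<^esub> \<mu> (g x, e)\<close>,
where \<open>\<mu>\<close> is the multiplication of \<open>Y\<close> in the chart, \<open>A(x, y)\<close> is the tangent vector \<open>y\<close> at \<open>x\<close>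
translated to \<open>1\<close>, and \<open>L\<close> is the tangent map at \<open>1\<close> (lemma \<open>has_dir_deriv_g\<close>). The tangent maps
of the \<open>\<psi>s n\<close> are compatible and \<open>E\<close> is a direct limit of locally convex spaces, so \<open>L\<close> is
continuous and linear (\<open>limit_tangent\<close>). The right-hand side contains \<open>g\<close> itself but none of its
derivatives: if \<open>g\<close> is \<open>C\<^sup>r\<close>, then so is its derivative, and \<open>g\<close> is \<open>C\<^bsup>r+1\<^esup>\<close> (\<open>C_map_g\<close>).

This argument needs the calculus of \<open>C\<^sup>r\<close> maps between locally convex spaces that need not be
complete. It rests on a mean value theorem for convex sets (\<open>mean_value_convex\<close>), which replaces
integrals, and on three closure properties of the class \<open>C\<^sup>r\<close>: the chain rule (\<open>C_map_compose\<close>), the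
passage from \<open>f\<close> to its derivative as a map of point and direction (\<open>C_map_dir_deriv\<close>), and its
converse (\<open>C_map_Suc\<close>). The usual proof of the chain rule is an induction over \<open>r\<close> that replaces a
map by its tangent map; as this changes the spaces, and with them their types, it is not available
as an induction here. Instead all iterated derivatives of a composition are written down, as a sum
over partitions of the list of directions (\<open>tower_compose\<close>).\<close>

section \<open>Locally convex spaces and the mean value theorem\<close>

lemma scalar_field_simps [simp]:
  "carrier (scalar_field K) = K" "\<one>\<^bsub>scalar_field K\<^esub> = 1" "\<zero>\<^bsub>scalar_field K\<^esub> = 0"
  "a \<oplus>\<^bsub>scalar_field K\<^esub> b = a + b" "a \<otimes>\<^bsub>scalar_field K\<^esub> b = a * b"
  by (simp_all add: scalar_field_def)

locale lcs =
  fixes K :: "complex set" and E :: "'v tvs" (structure)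
  assumes ground: "K = \<real> \<or> K = UNIV"
    and lcs: "locally_convex_space K E"

lemma (in lcs) is_module: "module (scalar_field K) E"
  using lcs by (simp add: locally_convex_space_def topological_vector_space_def)

sublocale lcs \<subseteq> module "scalar_field K" E
  by (rule is_module)

lemma eventually_at_0_within_iff:
  "eventually P (at (0::complex) within K) \<longleftrightarrow>
     (\<exists>e>0. \<forall>t\<in>K. t \<noteq> 0 \<and> norm t < e \<longrightarrow> P t)"
  by (auto simp: eventually_at dist_norm)

lemma trivial_limit_at_0_ground:
  assumes "K = \<real> \<or> K = UNIV" shows "at (0::complex) within K \<noteq> bot"
proof -
  have "\<not> eventually (\<lambda>_. False) (at (0::complex) within K)"
  proof
    assume "eventually (\<lambda>_. False) (at (0::complex) within K)"
    then obtain e where e: "e > 0" "\<forall>t\<in>K. t \<noteq> 0 \<and> norm t < e \<longrightarrow> False"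
      by (auto simp: eventually_at_0_within_iff)
    have "complex_of_real (e/2) \<in> K" using assms by auto
    with e show False by fastforce
  qed
  then show ?thesis by (simp add: trivial_limit_def)
qed

lemma limitin_eventually_carrier:
  "limitin T f l F \<Longrightarrow> eventually (\<lambda>a. f a \<in> topspace T) F"
  using limitinD openin_topspace limitin_topspace by metis

lemma limitin_ident_atin: "x \<in> topspace T \<Longrightarrow> limitin T (\<lambda>x. x) x (atin T x)"
  using continuous_map_atin[of T T "\<lambda>x. x"] continuous_map_id[of T] by (simp add: id_def)

context lcs
begin

lemma scalar_of_real [simp, intro]: "complex_of_real r \<in> K"
  using ground by auto

lemma scalar_closed [simp, intro]:
  "0 \<in> K" "1 \<in> K" "-1 \<in> K" "a \<in> K \<Longrightarrow> b \<in> K \<Longrightarrow> a + b \<in> K" "a \<in> K \<Longrightarrow> b \<in> K \<Longrightarrow> a * b \<in> K"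
  "a \<in> K \<Longrightarrow> b \<in> K \<Longrightarrow> a - b \<in> K" "a \<in> K \<Longrightarrow> inverse a \<in> K" "a \<in> K \<Longrightarrow> - a \<in> K"
  using ground by auto

lemma topspace_vtop [simp]: "topspace (vtop E) = carrier E"
  using lcs by (simp add: locally_convex_space_def topological_vector_space_def)

lemma scale_closed [simp, intro]: "c \<in> K \<Longrightarrow> x \<in> carrier E \<Longrightarrow> c \<odot> x \<in> carrier E"
  using smult_closed by simp

lemma scale_one [simp]: "x \<in> carrier E \<Longrightarrow> 1 \<odot> x = x"
  using smult_one by simp

lemma scale_zero [simp]: "x \<in> carrier E \<Longrightarrow> 0 \<odot> x = \<zero>"
  using smult_l_null by simp

lemma scale_scale: "a \<in> K \<Longrightarrow> b \<in> K \<Longrightarrow> x \<in> carrier E \<Longrightarrow> a \<odot> (b \<odot> x) = (a * b) \<odot> x"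
  using smult_assoc1 by simp

lemma scale_add_right: "a \<in> K \<Longrightarrow> x \<in> carrier E \<Longrightarrow> y \<in> carrier E \<Longrightarrow> a \<odot> (x \<oplus> y) = a \<odot> x \<oplus> a \<odot> y"
  using smult_r_distr by simp

lemma scale_add_left: "a \<in> K \<Longrightarrow> b \<in> K \<Longrightarrow> x \<in> carrier E \<Longrightarrow> (a + b) \<odot> x = a \<odot> x \<oplus> b \<odot> x"
  using smult_l_distr by simp

lemma scale_neg: "c \<in> K \<Longrightarrow> x \<in> carrier E \<Longrightarrow> c \<odot> (\<ominus> x) = \<ominus> (c \<odot> x)"
  using smult_r_minus by simp

lemma scale_neg_one: "x \<in> carrier E \<Longrightarrow> (-1) \<odot> x = \<ominus> x"
proof -
  assume x: "x \<in> carrier E"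
  have "(-1) \<odot> x \<oplus> x = \<zero>"
    using scale_add_left[of "-1" 1 x] x by simp
  then show ?thesis using minus_equality[of "(-1) \<odot> x" x] x by simp
qed

lemma scale_diff_right: "a \<in> K \<Longrightarrow> x \<in> carrier E \<Longrightarrow> y \<in> carrier E \<Longrightarrow> a \<odot> (x \<ominus> y) = a \<odot> x \<ominus> a \<odot> y"
  by (simp add: minus_eq scale_add_right scale_neg)

lemma diff_self [simp]: "x \<in> carrier E \<Longrightarrow> x \<ominus> x = \<zero>"
  by (simp add: minus_eq r_neg)

lemma diff_add_cancel [simp]: "x \<in> carrier E \<Longrightarrow> y \<in> carrier E \<Longrightarrow> (x \<oplus> y) \<ominus> x = y"
proof -
  assume xy: "x \<in> carrier E" "y \<in> carrier E"
  then have "(x \<oplus> y) \<oplus> \<ominus> x = y \<oplus> (x \<oplus> \<ominus> x)"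
    using a_comm[of x y] a_assoc[of y x "\<ominus> x"] by simp
  then show ?thesis using xy r_neg[of x] by (simp add: minus_eq)
qed

lemma add_diff_cancel [simp]: "x \<in> carrier E \<Longrightarrow> y \<in> carrier E \<Longrightarrow> x \<oplus> (y \<ominus> x) = y"
proof -
  assume "x \<in> carrier E" "y \<in> carrier E"
  then have "x \<oplus> (y \<oplus> \<ominus> x) = y" using a_lcomm[of x y "\<ominus> x"] r_neg[of x] by simp
  then show ?thesis by (simp add: minus_eq)
qed

lemma diff_zero [simp]: "x \<in> carrier E \<Longrightarrow> x \<ominus> \<zero> = x"
  by (metis add_diff_cancel l_zero minus_closed zero_closed)

lemma diff_diff_add:
  "x \<in> carrier E \<Longrightarrow> y \<in> carrier E \<Longrightarrow> z \<in> carrier E \<Longrightarrow> (x \<ominus> y) \<oplus> (y \<ominus> z) = x \<ominus> z"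
  by (simp add: minus_eq a_assoc r_neg1)

lemma add_diff_add:
  "x \<in> carrier E \<Longrightarrow> y \<in> carrier E \<Longrightarrow> z \<in> carrier E \<Longrightarrow> w \<in> carrier E \<Longrightarrow>
    (x \<oplus> y) \<ominus> (z \<oplus> w) = (x \<ominus> z) \<oplus> (y \<ominus> w)"
  by (simp add: minus_eq minus_add a_ac)

lemma lim_add:
  assumes "limitin (vtop E) f l A" "limitin (vtop E) g m A"
  shows "limitin (vtop E) (\<lambda>a. f a \<oplus> g a) (l \<oplus> m) A"
proof -
  have "limitin (prod_topology (vtop E) (vtop E)) (\<lambda>a. (f a, g a)) (l, m) A"
    using assms by (simp add: limitin_pairwise o_def)
  then show ?thesis
    using continuous_map_limit[of "prod_topology (vtop E) (vtop E)" "vtop E" "\<lambda>(x,y). x \<oplus> y"] lcs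
    by (fastforce simp: locally_convex_space_def topological_vector_space_def o_def)
qed

lemma lim_scale:
  assumes "(c \<longlongrightarrow> c0) A" "c0 \<in> K" "eventually (\<lambda>a. c a \<in> K) A" "limitin (vtop E) f l A"
  shows "limitin (vtop E) (\<lambda>a. c a \<odot> f a) (c0 \<odot> l) A"
proof -
  have "limitin (prod_topology (top_of_set K) (vtop E)) (\<lambda>a. (c a, f a)) (c0, l) A"
    using assms by (simp add: limitin_pairwise o_def limitin_subtopology)
  then show ?thesis
    using continuous_map_limit[of "prod_topology (top_of_set K) (vtop E)" "vtop E" "\<lambda>(c,x). c \<odot> x"] lcs
    by (fastforce simp: locally_convex_space_def topological_vector_space_def o_def)
qed

lemma lim_scale_const:
  "c \<in> K \<Longrightarrow> limitin (vtop E) f l A \<Longrightarrow> limitin (vtop E) (\<lambda>a. c \<odot> f a) (c \<odot> l) A"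
  using lim_scale[of "\<lambda>_. c" c A f l] by simp

text \<open>Local convexity is postulated at the origin only; translation carries it to other points. The convex
  set need not be open, so it comes with an open set inside it.\<close>

lemma nhd_convex:
  assumes W: "openin (vtop E) W" "d \<in> W"
  obtains C N where "convex_in E C" "openin (vtop E) N" "d \<in> N" "N \<subseteq> C" "C \<subseteq> W"
proof -
  have d: "d \<in> carrier E" using W openin_subset by fastforce
  have tr: "continuous_map (vtop E) (vtop E) (\<lambda>x. c \<oplus> x)" if "c \<in> carrier E" for c
    unfolding continuous_map_atin using that
    by (intro ballI lim_add limitin_ident_atin) auto
  define W0 where "W0 = {x \<in> carrier E. d \<oplus> x \<in> W}"
  have "openin (vtop E) W0"
    unfolding W0_def using openin_continuous_map_preimage[OF tr[OF d] W(1)] by simp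
  moreover have "\<zero> \<in> W0" using d W by (simp add: W0_def)
  ultimately obtain C0 N0 where C0: "convex_in E C0" "openin (vtop E) N0" "\<zero> \<in> N0" "N0 \<subseteq> C0" "C0 \<subseteq> W0"
    using lcs unfolding locally_convex_space_def by blast
  define C where "C = (\<lambda>x. d \<oplus> x) ` C0"
  define N where "N = {x \<in> carrier E. \<ominus> d \<oplus> x \<in> N0}"
  have C0c: "C0 \<subseteq> carrier E" using C0(1) by (simp add: convex_in_def)
  have "convex_in E C"
  proof -
    have "(complex_of_real (1 - t) \<odot> (d \<oplus> x)) \<oplus> (complex_of_real t \<odot> (d \<oplus> y)) \<in> C"
      if xy: "x \<in> C0" "y \<in> C0" "t \<in> {0..1}" for x y and t :: real
    proof -
      have xy': "x \<in> carrier E" "y \<in> carrier E" using xy C0c by auto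
      let ?a = "complex_of_real (1 - t)" and ?b = "complex_of_real t"
      have "(?a \<odot> (d \<oplus> x)) \<oplus> (?b \<odot> (d \<oplus> y)) = (?a \<odot> d \<oplus> ?b \<odot> d) \<oplus> (?a \<odot> x \<oplus> ?b \<odot> y)"
        using xy' d by (simp add: scale_add_right a_ac del: of_real_diff)
      also have "?a \<odot> d \<oplus> ?b \<odot> d = d"
        using scale_add_left[of ?a ?b d] d by simp
      finally show ?thesis
        using C0(1) xy by (auto simp: C_def convex_in_def)
    qed
    then show ?thesis using C0c d unfolding convex_in_def by (auto simp: C_def)
  qed
  moreover have "openin (vtop E) N"
    unfolding N_def using openin_continuous_map_preimage[OF tr[of "\<ominus> d"] C0(2)] d by simp
  moreover have "d \<in> N" using d C0 by (simp add: N_def l_neg)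
  moreover have "N \<subseteq> C"
  proof
    fix x assume x: "x \<in> N"
    then have "x = d \<oplus> (\<ominus> d \<oplus> x)" using d by (simp add: N_def r_neg2)
    then show "x \<in> C" using x C0(4) by (auto simp: N_def C_def)
  qed
  moreover have "C \<subseteq> W" using C0(5) by (auto simp: C_def W0_def)
  ultimately show ?thesis by (rule that)
qed

text \<open>The slope over an interval is a convex combination of the slopes over the two parts into which a
  point divides it. Hence the intervals with slope in \<open>C\<close> are closed under juxtaposition, and since
  the short ones near any point have this property, bisection yields it for \<open>[0, 1]\<close>.\<close>

lemma mean_value_convex:
  fixes \<gamma> :: "real \<Rightarrow> 'v"
  assumes C: "convex_in E C"
    and cl: "\<And>s. s \<in> {0..1} \<Longrightarrow> \<gamma> s \<in> carrier E"
    and der: "\<And>s. s \<in> {0..1} \<Longrightarrow> \<exists>\<delta>>0. \<forall>h. h \<noteq> 0 \<and> \<bar>h\<bar> < \<delta> \<and> s + h \<in> {0..1} \<longrightarrow>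
                complex_of_real (inverse h) \<odot> (\<gamma> (s + h) \<ominus> \<gamma> s) \<in> C"
  shows "\<gamma> 1 \<ominus> \<gamma> 0 \<in> C"
proof -
  define q where "q = (\<lambda>a b. complex_of_real (inverse (b - a)) \<odot> (\<gamma> b \<ominus> \<gamma> a))"
  have sym: "q b a = q a b" if "a \<in> {0..1}" "b \<in> {0..1}" for a b
  proof -
    have "q b a = complex_of_real (inverse (a - b)) \<odot> ((-1) \<odot> (\<gamma> b \<ominus> \<gamma> a))"
      using cl that by (simp add: q_def scale_neg_one minus_eq minus_add a_comm)
    also have "\<dots> = (complex_of_real (inverse (a - b)) * (-1)) \<odot> (\<gamma> b \<ominus> \<gamma> a)"
      using cl that by (intro scale_scale) auto
    also have "complex_of_real (inverse (a - b)) * (-1) = complex_of_real (inverse (b - a))"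
      using inverse_minus_eq[of "a - b"] by (metis minus_diff_eq mult_minus1_right of_real_minus)
    finally show ?thesis by (simp add: q_def)
  qed
  have comb: "q a c \<in> C" if "q a b \<in> C" "q b c \<in> C" "0 \<le> a" "a < b" "b < c" "c \<le> 1" for a b c
  proof -
    define t where "t = (c - b) / (c - a)"
    have t: "t \<in> {0..1}" using that by (auto simp: t_def field_simps)
    have g: "\<gamma> a \<in> carrier E" "\<gamma> b \<in> carrier E" "\<gamma> c \<in> carrier E" using cl that by auto
    have 1: "complex_of_real (1 - t) \<odot> q a b = complex_of_real (inverse (c - a)) \<odot> (\<gamma> b \<ominus> \<gamma> a)"
    proof -
      have "(1 - t) * inverse (b - a) = inverse (c - a)" using that by (simp add: t_def field_simps)
      then show ?thesis using g
        unfolding q_def by (subst scale_scale) (simp_all only: of_real_mult[symmetric] scalar_of_real minus_closed)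
    qed
    have 2: "complex_of_real t \<odot> q b c = complex_of_real (inverse (c - a)) \<odot> (\<gamma> c \<ominus> \<gamma> b)"
    proof -
      have "t * inverse (c - b) = inverse (c - a)" using that by (simp add: t_def field_simps)
      then show ?thesis using g
        unfolding q_def by (subst scale_scale) (simp_all only: of_real_mult[symmetric] scalar_of_real minus_closed)
    qed
    have "(complex_of_real (1 - t) \<odot> q a b) \<oplus> (complex_of_real t \<odot> q b c) =
          complex_of_real (inverse (c - a)) \<odot> ((\<gamma> b \<ominus> \<gamma> a) \<oplus> (\<gamma> c \<ominus> \<gamma> b))"
      unfolding 1 2 using g by (simp add: scale_add_right del: of_real_inverse)
    also have "(\<gamma> b \<ominus> \<gamma> a) \<oplus> (\<gamma> c \<ominus> \<gamma> b) = \<gamma> c \<ominus> \<gamma> a"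
      using g diff_diff_add[of "\<gamma> c" "\<gamma> b" "\<gamma> a"] by (simp add: a_comm)
    finally have "(complex_of_real (1 - t) \<odot> q a b) \<oplus> (complex_of_real t \<odot> q b c) = q a c"
      by (simp add: q_def)
    moreover have "(complex_of_real (1 - t) \<odot> q a b) \<oplus> (complex_of_real t \<odot> q b c) \<in> C"
      using C that t unfolding convex_in_def by blast
    ultimately show ?thesis by simp
  qed
  define P where "P = (\<lambda>a b. 0 \<le> a \<and> a < b \<and> b \<le> 1 \<longrightarrow> q a b \<in> C)"
  have "P 0 1"
  proof (rule Bolzano)
    fix a b c :: real assume *: "P a b" "P b c" "a \<le> b" "b \<le> c"
    show "P a c"
      unfolding P_def
    proof
      assume "0 \<le> a \<and> a < c \<and> c \<le> 1"
      then show "q a c \<in> C"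
        using * comb[of a b c] by (cases "a = b"; cases "b = c") (auto simp: P_def)
    qed
  next
    fix x :: real assume x: "0 \<le> x" "x \<le> 1"
    then obtain \<delta> where \<delta>: "\<delta> > 0"
      "\<And>h. h \<noteq> 0 \<Longrightarrow> \<bar>h\<bar> < \<delta> \<Longrightarrow> x + h \<in> {0..1} \<Longrightarrow>
        complex_of_real (inverse h) \<odot> (\<gamma> (x + h) \<ominus> \<gamma> x) \<in> C"
      using der[of x] by auto
    have qx: "q x y \<in> C" if "y \<noteq> x" "\<bar>y - x\<bar> < \<delta>" "y \<in> {0..1}" for y
      using \<delta>(2)[of "y - x"] that by (simp add: q_def)
    show "\<exists>d>0. \<forall>a b. a \<le> x \<and> x \<le> b \<and> b - a < d \<longrightarrow> P a b"
    proof (intro exI[of _ \<delta>] conjI allI impI \<delta>(1))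
      fix a b :: real assume ab: "a \<le> x \<and> x \<le> b \<and> b - a < \<delta>"
      show "P a b"
        unfolding P_def
      proof
        assume "0 \<le> a \<and> a < b \<and> b \<le> 1"
        then show "q a b \<in> C"
          using ab x qx[of b] qx[of a] sym[of a x] comb[of a x b]
          by (cases "a = x"; cases "b = x") auto
      qed
    qed
  qed simp
  then show ?thesis using cl by (simp add: P_def q_def)
qed

end

text \<open>Base point, direction and even the function may move with \<open>t\<close>. The filter product over
  \<open>s \<in> [0, 1]\<close> expresses convergence that is uniform along the segment from \<open>z t\<close> to
  \<open>z t \<oplus> t \<odot> w t\<close>; the derivatives on this segment end up in a small convex set, and the mean value
  theorem puts the difference quotient into it.\<close>

lemma lim_difference_quotient:
  fixes E :: "'v tvs" and F :: "'w tvs"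
  assumes E: "lcs K E" and F: "lcs K F"
    and U: "openin (vtop E) U"
    and seg: "eventually (\<lambda>(t, s). z t \<oplus>\<^bsub>E\<^esub> (complex_of_real s * t) \<odot>\<^bsub>E\<^esub> w t \<in> U)
               ((at 0 within K) \<times>\<^sub>F principal {0..1})"
    and good: "eventually (\<lambda>t. z t \<in> carrier E \<and> w t \<in> carrier E \<and>
               (\<forall>x\<in>U. h t x \<in> carrier F \<and> has_dir_deriv K E F (h t) (w t) x (h' t x)))
               (at 0 within K)"
    and lim: "limitin (vtop F) (\<lambda>(t, s). h' t (z t \<oplus>\<^bsub>E\<^esub> (complex_of_real s * t) \<odot>\<^bsub>E\<^esub> w t)) d
               ((at 0 within K) \<times>\<^sub>F principal {0..1})"
  shows "limitin (vtop F) (\<lambda>t. inverse t \<odot>\<^bsub>F\<^esub> (h t (z t \<oplus>\<^bsub>E\<^esub> t \<odot>\<^bsub>E\<^esub> w t) \<ominus>\<^bsub>F\<^esub> h t (z t))) d (at 0 within K)"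
proof -
  interpret E: lcs K E by fact
  interpret F: lcs K F by fact
  have ev_prod: "eventually (\<lambda>t. \<forall>s\<in>{0..1::real}. P t s) (at 0 within K)"
    if ev: "eventually (\<lambda>(t, s). P t s) ((at (0::complex) within K) \<times>\<^sub>F principal {0..1})" for P
  proof -
    obtain Pf Pg where P: "eventually Pf (at (0::complex) within K)" "eventually Pg (principal {0..1::real})"
      "\<forall>x y. Pf x \<longrightarrow> Pg y \<longrightarrow> P x y"
      using ev unfolding eventually_prod_filter by auto
    show ?thesis
      using P(1) by (rule eventually_mono) (use P(2,3) in \<open>simp add: eventually_principal\<close>)
  qed
  show ?thesis
    unfolding limitin_def
  proof (intro conjI allI impI)
    show "d \<in> topspace (vtop F)" by (rule limitin_topspace[OF lim])
  next
    fix W assume W: "openin (vtop F) W \<and> d \<in> W"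
    then obtain C N where C: "convex_in F C" "openin (vtop F) N" "d \<in> N" "N \<subseteq> C" "C \<subseteq> W"
      using F.nhd_convex[of W d] by blast
    have "eventually (\<lambda>(t, s). h' t (z t \<oplus>\<^bsub>E\<^esub> (complex_of_real s * t) \<odot>\<^bsub>E\<^esub> w t) \<in> N)
             ((at 0 within K) \<times>\<^sub>F principal {0..1})"
      using limitinD[OF lim C(2,3)] by (simp add: case_prod_unfold)
    from ev_prod[OF this] have evN:
      "eventually (\<lambda>t. \<forall>s\<in>{0..1}. h' t (z t \<oplus>\<^bsub>E\<^esub> (complex_of_real s * t) \<odot>\<^bsub>E\<^esub> w t) \<in> N) (at 0 within K)" .
    have evK: "eventually (\<lambda>t. t \<in> K \<and> t \<noteq> 0) (at 0 within K)"
      unfolding eventually_at_0_within_iff by (rule exI[of _ 1]) auto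
    have "eventually (\<lambda>t. t \<in> K \<and> t \<noteq> 0 \<and>
            z t \<in> carrier E \<and> w t \<in> carrier E \<and>
            (\<forall>x\<in>U. h t x \<in> carrier F \<and> has_dir_deriv K E F (h t) (w t) x (h' t x)) \<and>
            (\<forall>s\<in>{0..1}. z t \<oplus>\<^bsub>E\<^esub> (complex_of_real s * t) \<odot>\<^bsub>E\<^esub> w t \<in> U) \<and>
            (\<forall>s\<in>{0..1}. h' t (z t \<oplus>\<^bsub>E\<^esub> (complex_of_real s * t) \<odot>\<^bsub>E\<^esub> w t) \<in> N)) (at 0 within K)"
      using eventually_conj[OF evK eventually_conj[OF good eventually_conj[OF ev_prod[OF seg] evN]]] by (simp add: conj_assoc)
    then show "eventually (\<lambda>t. inverse t \<odot>\<^bsub>F\<^esub> (h t (z t \<oplus>\<^bsub>E\<^esub> t \<odot>\<^bsub>E\<^esub> w t) \<ominus>\<^bsub>F\<^esub> h t (z t)) \<in> W) (at 0 within K)"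
    proof (rule eventually_mono, elim conjE)
      fix t assume t: "t \<in> K" "t \<noteq> 0"
        and zw: "z t \<in> carrier E" "w t \<in> carrier E"
        and hder: "\<forall>x\<in>U. h t x \<in> carrier F \<and> has_dir_deriv K E F (h t) (w t) x (h' t x)"
        and inU: "\<forall>s\<in>{0..1}. z t \<oplus>\<^bsub>E\<^esub> (complex_of_real s * t) \<odot>\<^bsub>E\<^esub> w t \<in> U"
        and inN: "\<forall>s\<in>{0..1}. h' t (z t \<oplus>\<^bsub>E\<^esub> (complex_of_real s * t) \<odot>\<^bsub>E\<^esub> w t) \<in> N"
      define x where "x = (\<lambda>s::real. z t \<oplus>\<^bsub>E\<^esub> (complex_of_real s * t) \<odot>\<^bsub>E\<^esub> w t)"
      define \<gamma> where "\<gamma> = (\<lambda>s. inverse t \<odot>\<^bsub>F\<^esub> h t (x s))"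
      have xU: "x s \<in> U" if "s \<in> {0..1}" for s using inU that by (simp add: x_def)
      have hx: "h t (x s) \<in> carrier F" if "s \<in> {0..1}" for s using hder xU[OF that] by blast
      have "\<gamma> 1 \<ominus>\<^bsub>F\<^esub> \<gamma> 0 \<in> C"
      proof (rule F.mean_value_convex[OF C(1)])
        show "\<gamma> s \<in> carrier F" if "s \<in> {0..1}" for s
          using hx[OF that] t by (simp add: \<gamma>_def)
      next
        fix s :: real assume s: "s \<in> {0..1}"
        have "limitin (vtop F) (\<lambda>\<tau>. inverse \<tau> \<odot>\<^bsub>F\<^esub> (h t (x s \<oplus>\<^bsub>E\<^esub> \<tau> \<odot>\<^bsub>E\<^esub> w t) \<ominus>\<^bsub>F\<^esub> h t (x s)))
                (h' t (x s)) (at 0 within K)"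
          using hder xU[OF s] by (simp add: has_dir_deriv_def)
        then have "eventually (\<lambda>\<tau>. inverse \<tau> \<odot>\<^bsub>F\<^esub> (h t (x s \<oplus>\<^bsub>E\<^esub> \<tau> \<odot>\<^bsub>E\<^esub> w t) \<ominus>\<^bsub>F\<^esub> h t (x s)) \<in> N) (at 0 within K)"
          by (rule limitinD[OF _ C(2)]) (use inN s in \<open>simp add: x_def\<close>)
        then obtain e where e: "e > 0" "\<And>\<tau>. \<tau> \<in> K \<Longrightarrow> \<tau> \<noteq> 0 \<Longrightarrow> norm \<tau> < e \<Longrightarrow>
            inverse \<tau> \<odot>\<^bsub>F\<^esub> (h t (x s \<oplus>\<^bsub>E\<^esub> \<tau> \<odot>\<^bsub>E\<^esub> w t) \<ominus>\<^bsub>F\<^esub> h t (x s)) \<in> N"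
          unfolding eventually_at_0_within_iff by auto
        show "\<exists>\<delta>>0. \<forall>k. k \<noteq> 0 \<and> \<bar>k\<bar> < \<delta> \<and> s + k \<in> {0..1} \<longrightarrow>
                complex_of_real (inverse k) \<odot>\<^bsub>F\<^esub> (\<gamma> (s + k) \<ominus>\<^bsub>F\<^esub> \<gamma> s) \<in> C"
        proof (intro exI[of _ "e / norm t"] conjI allI impI)
          show "0 < e / norm t" using e t by simp
          fix k :: real assume k: "k \<noteq> 0 \<and> \<bar>k\<bar> < e / norm t \<and> s + k \<in> {0..1}"
          let ?\<tau> = "complex_of_real k * t"
          have \<tau>: "?\<tau> \<in> K" "?\<tau> \<noteq> 0" "norm ?\<tau> < e"
            using k t by (simp_all add: norm_mult field_simps)
          have xk: "x (s + k) = x s \<oplus>\<^bsub>E\<^esub> ?\<tau> \<odot>\<^bsub>E\<^esub> w t"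
            using t zw by (simp add: x_def distrib_right E.scale_add_left E.a_assoc)
          have "complex_of_real (inverse k) \<odot>\<^bsub>F\<^esub> (\<gamma> (s + k) \<ominus>\<^bsub>F\<^esub> \<gamma> s)
              = complex_of_real (inverse k) \<odot>\<^bsub>F\<^esub> (inverse t \<odot>\<^bsub>F\<^esub> (h t (x (s + k)) \<ominus>\<^bsub>F\<^esub> h t (x s)))"
            using hx s k t by (simp add: \<gamma>_def F.scale_diff_right)
          also have "\<dots> = inverse ?\<tau> \<odot>\<^bsub>F\<^esub> (h t (x (s + k)) \<ominus>\<^bsub>F\<^esub> h t (x s))"
            using hx[of "s+k"] hx[of s] s k t by (simp add: F.scale_scale inverse_mult_distrib)
          also have "\<dots> \<in> N" using e(2)[OF \<tau>] unfolding xk .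
          finally show "complex_of_real (inverse k) \<odot>\<^bsub>F\<^esub> (\<gamma> (s + k) \<ominus>\<^bsub>F\<^esub> \<gamma> s) \<in> C" using C(4) by blast
        qed
      qed
      moreover have "\<gamma> 1 \<ominus>\<^bsub>F\<^esub> \<gamma> 0 = inverse t \<odot>\<^bsub>F\<^esub> (h t (z t \<oplus>\<^bsub>E\<^esub> t \<odot>\<^bsub>E\<^esub> w t) \<ominus>\<^bsub>F\<^esub> h t (z t))"
        using hx[of 1] hx[of 0] t zw by (simp add: \<gamma>_def x_def F.scale_diff_right)
      ultimately show "inverse t \<odot>\<^bsub>F\<^esub> (h t (z t \<oplus>\<^bsub>E\<^esub> t \<odot>\<^bsub>E\<^esub> w t) \<ominus>\<^bsub>F\<^esub> h t (z t)) \<in> W" using C(5) by auto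
    qed
  qed
qed

section \<open>Families of iterated derivatives\<close>

lemma limitin_filterlim_compose:
  "limitin T f l G \<Longrightarrow> filterlim g G A \<Longrightarrow> limitin T (\<lambda>a. f (g a)) l A"
  by (auto simp: limitin_def filterlim_iff)

lemma limitin_cong_eventually:
  "eventually (\<lambda>a. f a = g a) A \<Longrightarrow> limitin T f l A \<longleftrightarrow> limitin T g l A"
  by (auto intro: limitin_transform_eventually elim: limitin_transform_eventually[rotated] elim!: eventually_mono)

context lcs
begin

lemma lim_carrier:
  assumes "limitin (vtop E) f l A"
  shows "l \<in> carrier E" "eventually (\<lambda>a. f a \<in> carrier E) A"
  using limitin_topspace[OF assms] limitin_eventually_carrier[OF assms] by simp_all

lemma eventually_scalar: "eventually (\<lambda>t. t \<in> K \<and> t \<noteq> 0) (at 0 within K)"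
  unfolding eventually_at_0_within_iff by (rule exI[of _ 1]) auto

end

locale hausdorff_lcs = lcs +
  assumes Hausdorff: "Hausdorff_space (vtop E)"

lemma (in hausdorff_lcs) lim_unique:
  "limitin (vtop E) f l (at 0 within K) \<Longrightarrow> limitin (vtop E) f m (at 0 within K) \<Longrightarrow> l = m"
  using limitin_Hausdorff_unique[OF _ _ trivial_limit_at_0_ground[OF ground] Hausdorff] .

text \<open>The derivative of a curve at the parameter \<open>0\<close>.\<close>

definition curve_deriv :: "complex set \<Rightarrow> 'v tvs \<Rightarrow> (complex \<Rightarrow> 'v) \<Rightarrow> 'v \<Rightarrow> bool" where
  "curve_deriv K E c d \<longleftrightarrow> limitin (vtop E) (\<lambda>t. inverse t \<odot>\<^bsub>E\<^esub> (c t \<ominus>\<^bsub>E\<^esub> c 0)) d (at 0 within K)"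

text \<open>Sums are taken over lists, because the terms of the chain rule come as a list which may contain
  repetitions.\<close>

definition vsum :: "'v tvs \<Rightarrow> 'v list \<Rightarrow> 'v" where
  "vsum E xs = foldr (\<lambda>x s. x \<oplus>\<^bsub>E\<^esub> s) xs \<zero>\<^bsub>E\<^esub>"

lemma vsum_simps [simp]: "vsum E [] = \<zero>\<^bsub>E\<^esub>" "vsum E (x # xs) = x \<oplus>\<^bsub>E\<^esub> vsum E xs"
  by (simp_all add: vsum_def)

context lcs
begin

lemma vsum_closed [simp, intro]: "set xs \<subseteq> carrier E \<Longrightarrow> vsum E xs \<in> carrier E"
  by (induction xs) auto

lemma vsum_append:
  "set xs \<subseteq> carrier E \<Longrightarrow> set ys \<subseteq> carrier E \<Longrightarrow> vsum E (xs @ ys) = vsum E xs \<oplus> vsum E ys"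
  by (induction xs) (auto simp: a_assoc)

lemma vsum_concat:
  "(\<And>xs. xs \<in> set xss \<Longrightarrow> set xs \<subseteq> carrier E) \<Longrightarrow> vsum E (concat xss) = vsum E (map (vsum E) xss)"
proof (induction xss)
  case (Cons xs xss)
  then have "set xs \<subseteq> carrier E" "set (concat xss) \<subseteq> carrier E" by auto
  then show ?case using Cons by (simp add: vsum_append del: set_concat)
qed simp

lemma lim_vsum:
  "(\<And>f. f \<in> set fs \<Longrightarrow> limitin (vtop E) (f' f) (l f) A) \<Longrightarrow>
     limitin (vtop E) (\<lambda>a. vsum E (map (\<lambda>f. f' f a) fs)) (vsum E (map l fs)) A"
  by (induction fs) (auto intro!: lim_add)

lemma has_dir_deriv_eq_curve_deriv:
  "x \<in> carrier E \<Longrightarrow> y \<in> carrier E \<Longrightarrow>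
     has_dir_deriv K E F f y x d \<longleftrightarrow> curve_deriv K F (\<lambda>t. f (x \<oplus> t \<odot> y)) d"
  by (simp add: has_dir_deriv_def curve_deriv_def)

lemma curve_deriv_cong:
  assumes "eventually (\<lambda>t. c t = c' t) (at 0 within K)" "c 0 = c' 0"
  shows "curve_deriv K E c d \<longleftrightarrow> curve_deriv K E c' d"
  unfolding curve_deriv_def
  by (rule limitin_cong_eventually) (use assms in \<open>auto elim!: eventually_mono\<close>)

lemma curve_deriv_const: "x \<in> carrier E \<Longrightarrow> curve_deriv K E (\<lambda>t. x) \<zero>"
proof -
  assume x: "x \<in> carrier E"
  have "limitin (vtop E) (\<lambda>t::complex. \<zero>) \<zero> (at 0 within K)" by simp
  then show ?thesis
    unfolding curve_deriv_def
    by (rule limitin_transform_eventually[rotated]) (use eventually_scalar x in \<open>auto elim!: eventually_mono\<close>)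
qed

lemma curve_deriv_add:
  assumes "curve_deriv K E c c'" "curve_deriv K E d d'"
    and cl: "eventually (\<lambda>t. c t \<in> carrier E) (at 0 within K)" "c 0 \<in> carrier E"
      "eventually (\<lambda>t. d t \<in> carrier E) (at 0 within K)" "d 0 \<in> carrier E"
  shows "curve_deriv K E (\<lambda>t. c t \<oplus> d t) (c' \<oplus> d')"
  unfolding curve_deriv_def
proof (rule limitin_transform_eventually)
  show "limitin (vtop E) (\<lambda>t. (inverse t \<odot> (c t \<ominus> c 0)) \<oplus> (inverse t \<odot> (d t \<ominus> d 0))) (c' \<oplus> d') (at 0 within K)"
    using assms(1,2) unfolding curve_deriv_def by (rule lim_add)
  show "eventually (\<lambda>t. (inverse t \<odot> (c t \<ominus> c 0)) \<oplus> (inverse t \<odot> (d t \<ominus> d 0)) =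
      inverse t \<odot> ((c t \<oplus> d t) \<ominus> (c 0 \<oplus> d 0))) (at 0 within K)"
    using eventually_conj[OF eventually_scalar eventually_conj[OF cl(1,3)]]
    by (rule eventually_mono) (use cl(2,4) in \<open>auto simp: add_diff_add scale_add_right\<close>)
qed

lemma curve_deriv_vsum:
  assumes "\<And>f. f \<in> set fs \<Longrightarrow> curve_deriv K E (c f) (c' f)"
    and "\<And>f. f \<in> set fs \<Longrightarrow> eventually (\<lambda>t. c f t \<in> carrier E) (at 0 within K)"
    and "\<And>f. f \<in> set fs \<Longrightarrow> c f 0 \<in> carrier E"
  shows "curve_deriv K E (\<lambda>t. vsum E (map (\<lambda>f. c f t) fs)) (vsum E (map c' fs))"
  using assms
proof (induction fs)
  case Nil
  then show ?case using curve_deriv_const[of \<zero>] by simp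
next
  case (Cons f fs)
  have "eventually (\<lambda>t. \<forall>g\<in>set fs. c g t \<in> carrier E) (at 0 within K)"
    using Cons.prems(2) by (subst eventually_ball_finite_distrib) auto
  then have "eventually (\<lambda>t. vsum E (map (\<lambda>f. c f t) fs) \<in> carrier E) (at 0 within K)"
    by (rule eventually_mono) (intro vsum_closed, auto)
  moreover have "vsum E (map (\<lambda>f. c f 0) fs) \<in> carrier E"
    using Cons.prems(3) by (intro vsum_closed) auto
  ultimately show ?case
    using Cons by (auto intro!: curve_deriv_add)
qed

text \<open>Differentiable curves are continuous.\<close>

lemma curve_deriv_lim:
  assumes c: "curve_deriv K E c c'" and cl: "c 0 \<in> carrier E" "eventually (\<lambda>t. c t \<in> carrier E) (at 0 within K)"
  shows "limitin (vtop E) c (c 0) (at 0 within K)"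
proof (rule limitin_transform_eventually)
  have "limitin (vtop E) (\<lambda>t. t \<odot> (inverse t \<odot> (c t \<ominus> c 0))) (0 \<odot> c') (at 0 within K)"
    using c eventually_scalar unfolding curve_deriv_def
    by (intro lim_scale tendsto_ident_at) (auto elim!: eventually_mono)
  then show "limitin (vtop E) (\<lambda>t. c 0 \<oplus> t \<odot> (inverse t \<odot> (c t \<ominus> c 0))) (c 0) (at 0 within K)"
    using lim_add[of "\<lambda>_. c 0" "c 0" "at 0 within K" "\<lambda>t. t \<odot> (inverse t \<odot> (c t \<ominus> c 0))" \<zero>] cl(1)
      lim_carrier(1)[OF c[unfolded curve_deriv_def]] by simp
  show "eventually (\<lambda>t. c 0 \<oplus> t \<odot> (inverse t \<odot> (c t \<ominus> c 0)) = c t) (at 0 within K)"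
    using eventually_conj[OF eventually_scalar cl(2)]
    by (rule eventually_mono) (use cl(1) in \<open>auto simp: scale_scale\<close>)
qed

lemma lim_line:
  assumes "x \<in> carrier E" "y \<in> carrier E"
  shows "limitin (vtop E) (\<lambda>t. x \<oplus> t \<odot> y) x (at 0 within K)"
proof -
  have "limitin (vtop E) (\<lambda>t. x \<oplus> t \<odot> y) (x \<oplus> 0 \<odot> y) (at 0 within K)"
    using eventually_scalar assms
    by (intro lim_add lim_scale tendsto_ident_at) (auto elim!: eventually_mono)
  then show ?thesis using assms by simp
qed

lemma line_in_open:
  assumes "openin (vtop E) U" "x \<in> U" "y \<in> carrier E"
  shows "eventually (\<lambda>t. x \<oplus> t \<odot> y \<in> U) (at 0 within K)"
proof -
  have "x \<in> carrier E" using openin_subset[OF assms(1)] assms(2) by auto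
  from limitinD[OF lim_line[OF this assms(3)] assms(1,2)] show ?thesis .
qed

lemma curve_deriv_line:
  assumes "x \<in> carrier E" "y \<in> carrier E"
  shows "curve_deriv K E (\<lambda>t. x \<oplus> t \<odot> y) y"
proof -
  have "limitin (vtop E) (\<lambda>t::complex. y) y (at 0 within K)" using assms by simp
  then show ?thesis
    unfolding curve_deriv_def
    by (rule limitin_transform_eventually[rotated, OF _ eventually_mono[OF eventually_scalar]])
      (use assms in \<open>auto simp: scale_scale\<close>)
qed

end

text \<open>A tuple of \<open>k\<close> directions is a function on \<open>{..<k}\<close>, as in the definition of \<open>C_map\<close>.\<close>

abbreviation jointly_continuous ::
    "'v tvs \<Rightarrow> 'w tvs \<Rightarrow> 'v set \<Rightarrow> nat \<Rightarrow> ('v \<Rightarrow> 'v list \<Rightarrow> 'w) \<Rightarrow> bool" where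
  "jointly_continuous E F U k D \<equiv>
     continuous_map (prod_topology (subtopology (vtop E) U) (product_topology (\<lambda>_. vtop E) {..<k}))
       (vtop F) (\<lambda>(x, y). D x (map y [0..<k]))"

text \<open>A family \<open>D\<close> behaving like \<open>D x [y\<^sub>1, \<dots>, y\<^sub>k] = D\<^bsub>y\<^sub>1\<^esub> \<dots> D\<^bsub>y\<^sub>k\<^esub> f(x)\<close>. Iterated derivatives are
  defined by description; to identify them, it is enough to exhibit such a family by formulas.\<close>

definition deriv_tower ::
    "complex set \<Rightarrow> nat \<Rightarrow> 'v tvs \<Rightarrow> 'w tvs \<Rightarrow> 'v set \<Rightarrow> ('v \<Rightarrow> 'v list \<Rightarrow> 'w) \<Rightarrow> bool" where
  "deriv_tower K r E F U D \<longleftrightarrow>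
     (\<forall>k\<le>r. jointly_continuous E F U k D) \<and>
     (\<forall>x\<in>U. \<forall>y\<in>carrier E. \<forall>ys. set ys \<subseteq> carrier E \<and> length ys < r \<longrightarrow>
        has_dir_deriv K E F (\<lambda>x. D x ys) y x (D x (y # ys)))"

text \<open>Joint continuity may be checked by passing to limits, with the points and the directions converging
  independently along one filter. The filters needed live on the product space itself, which fixes
  the type of \<open>A\<close>.\<close>

lemma continuous_map_jointlyI:
  fixes D :: "'v \<Rightarrow> 'v list \<Rightarrow> 'w"
  assumes "U \<subseteq> topspace S"
    and lim: "\<And>(A :: ('v \<times> (nat \<Rightarrow> 'v)) filter) X x \<eta>s ys.
       limitin S X x A \<Longrightarrow> x \<in> U \<Longrightarrow> eventually (\<lambda>a. X a \<in> U) A \<Longrightarrow>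
       list_all2 (\<lambda>\<eta> y. limitin S \<eta> y A) \<eta>s ys \<Longrightarrow> length ys = k \<Longrightarrow>
       limitin T (\<lambda>a. D (X a) (map (\<lambda>\<eta>. \<eta> a) \<eta>s)) (D x ys) A"
  shows "continuous_map (prod_topology (subtopology S U) (product_topology (\<lambda>_. S) {..<k})) T
           (\<lambda>(x, y). D x (map y [0..<k]))" (is "continuous_map ?P _ _")
  unfolding continuous_map_atin
proof
  fix p assume p: "p \<in> topspace ?P"
  obtain x y where xy: "p = (x, y)" by fastforce
  have id: "limitin ?P (\<lambda>a. a) p (atin ?P p)" by (rule limitin_ident_atin[OF p])
  have "limitin (subtopology S U) fst x (atin ?P p)"
    and y: "limitin (product_topology (\<lambda>_. S) {..<k}) snd y (atin ?P p)"
    using id unfolding xy by (simp_all add: limitin_pairwise o_def)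
  then have x: "x \<in> U" "eventually (\<lambda>a. fst a \<in> U) (atin ?P p)" "limitin S fst x (atin ?P p)"
    by (simp_all add: limitin_subtopology)
  have "limitin T (\<lambda>a. D (fst a) (map (\<lambda>\<eta>. \<eta> a) (map (\<lambda>i a. snd a i) [0..<k])))
          (D x (map y [0..<k])) (atin ?P p)"
  proof (rule lim[OF x(3,1,2)])
    show "list_all2 (\<lambda>\<eta> y. limitin S \<eta> y (atin ?P p)) (map (\<lambda>i a. snd a i) [0..<k]) (map y [0..<k])"
      using y by (auto simp: limitin_componentwise list_all2_conv_all_nth)
  qed simp
  then show "limitin T (\<lambda>(x, y). D x (map y [0..<k])) (case p of (x, y) \<Rightarrow> D x (map y [0..<k])) (atin ?P p)"
    by (simp add: xy case_prod_unfold o_def)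
qed

locale tower = E: lcs K E + F: hausdorff_lcs K F
  for K :: "complex set" and E :: "'v tvs" and F :: "'w tvs" +
  fixes r :: nat and U :: "'v set" and D :: "'v \<Rightarrow> 'v list \<Rightarrow> 'w"
  assumes open_dom: "openin (vtop E) U"
    and tower: "deriv_tower K r E F U D"
begin

lemma dom_carrier: "x \<in> U \<Longrightarrow> x \<in> carrier E"
  using openin_subset[OF open_dom] by auto

text \<open>The use of joint continuity: passing to the limit along a filter on any type.\<close>

lemma tower_lim:
  assumes X: "limitin (vtop E) X x A" "x \<in> U"
    and Y: "list_all2 (\<lambda>\<eta> y. limitin (vtop E) \<eta> y A) \<eta>s ys" and len: "length ys \<le> r"
  shows "limitin (vtop F) (\<lambda>a. D (X a) (map (\<lambda>\<eta>. \<eta> a) \<eta>s)) (D x ys) A"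
proof -
  define k where "k = length ys"
  have kk: "length \<eta>s = k" "k \<le> r" using Y len by (auto simp: k_def list_all2_lengthD)
  define p where "p = (\<lambda>a. (X a, \<lambda>i\<in>{..<k}. (\<eta>s ! i) a))"
  have lims: "limitin (vtop E) (\<eta>s ! i) (ys ! i) A" if "i < k" for i
    using Y that by (auto simp: list_all2_conv_all_nth k_def)
  have "eventually (\<lambda>a. \<forall>i\<in>{..<k}. (\<eta>s ! i) a \<in> carrier E) A"
    using E.lim_carrier(2)[OF lims] by (subst eventually_ball_finite_distrib) auto
  then have "eventually (\<lambda>a. (\<lambda>i\<in>{..<k}. (\<eta>s ! i) a) \<in> topspace (product_topology (\<lambda>_. vtop E) {..<k})) A"
    by (rule eventually_mono) auto
  then have "limitin (product_topology (\<lambda>_. vtop E) {..<k}) (\<lambda>a. \<lambda>i\<in>{..<k}. (\<eta>s ! i) a)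
          (\<lambda>i\<in>{..<k}. ys ! i) A"
    using lims unfolding limitin_componentwise by simp
  moreover have "limitin (subtopology (vtop E) U) X x A"
    using X limitinD[OF X(1) open_dom X(2)] by (simp add: limitin_subtopology)
  ultimately have "limitin (prod_topology (subtopology (vtop E) U) (product_topology (\<lambda>_. vtop E) {..<k}))
      p (x, \<lambda>i\<in>{..<k}. ys ! i) A"
    by (simp add: limitin_pairwise p_def o_def)
  moreover have "jointly_continuous E F U k D"
    using tower kk(2) by (simp add: deriv_tower_def)
  ultimately have "limitin (vtop F) ((\<lambda>(x, y). D x (map y [0..<k])) \<circ> p)
      ((\<lambda>(x, y). D x (map y [0..<k])) (x, \<lambda>i\<in>{..<k}. ys ! i)) A"
    by (rule continuous_map_limit[rotated])
  moreover have "map (\<lambda>i\<in>{..<k}. ys ! i) [0..<k] = ys"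
    unfolding k_def by (rule nth_equalityI) auto
  moreover have "map (\<lambda>i\<in>{..<k}. (\<eta>s ! i) a) [0..<k] = map (\<lambda>\<eta>. \<eta> a) \<eta>s" for a
    using kk by (intro nth_equalityI) auto
  ultimately show ?thesis by (simp add: p_def o_def)
qed

lemma tower_closed:
  assumes "x \<in> U" "set ys \<subseteq> carrier E" "length ys \<le> r"
  shows "D x ys \<in> carrier F"
proof -
  have "limitin (vtop F) (\<lambda>a::unit. D x (map (\<lambda>\<eta>. \<eta> a) (map (\<lambda>y _. y) ys))) (D x ys) bot"
    by (rule tower_lim) (use assms dom_carrier in \<open>auto simp: list_all2_conv_all_nth limitin_trivial\<close>)
  then show ?thesis using F.lim_carrier(1) by blast
qed

lemma tower_deriv:
  "x \<in> U \<Longrightarrow> y \<in> carrier E \<Longrightarrow> set ys \<subseteq> carrier E \<Longrightarrow> length ys < r \<Longrightarrow>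
     has_dir_deriv K E F (\<lambda>x. D x ys) y x (D x (y # ys))"
  using tower by (simp add: deriv_tower_def)

text \<open>Difference quotients at moving points, in moving directions, converge to the derivative at the
  limits. All uses of the mean value theorem go through this lemma.\<close>

lemma tower_difference_quotient:
  assumes z: "limitin (vtop E) z z0 (at 0 within K)" "z0 \<in> U"
    and w: "limitin (vtop E) w w0 (at 0 within K)"
    and us: "list_all2 (\<lambda>\<eta> y. limitin (vtop E) \<eta> y (at 0 within K)) us ys" and len: "length ys < r"
  shows "limitin (vtop F) (\<lambda>t. inverse t \<odot>\<^bsub>F\<^esub>
           (D (z t \<oplus>\<^bsub>E\<^esub> t \<odot>\<^bsub>E\<^esub> w t) (map (\<lambda>\<eta>. \<eta> t) us) \<ominus>\<^bsub>F\<^esub> D (z t) (map (\<lambda>\<eta>. \<eta> t) us)))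
           (D z0 (w0 # ys)) (at 0 within K)"
proof -
  let ?A = "at (0::complex) within K" and ?B = "(at (0::complex) within K) \<times>\<^sub>F principal {0..1::real}"
  have len_us: "length us = length ys" using us by (rule list_all2_lengthD)
  have fst: "limitin T (\<lambda>p. f (fst p)) l ?B" if "limitin T f l ?A" for T and f :: "complex \<Rightarrow> 'c" and l
    by (rule limitin_filterlim_compose[OF that filterlim_fst])
  have st: "((\<lambda>(t, s). complex_of_real s * t) \<longlongrightarrow> 0) ?B"
  proof (rule tendsto_0_le)
    have "((\<lambda>t::complex. t) \<longlongrightarrow> 0) ?A" by (rule tendsto_ident_at)
    then show "((\<lambda>p. fst p) \<longlongrightarrow> 0) ?B"
      by (rule filterlim_compose) (rule filterlim_fst)
    show "eventually (\<lambda>p. norm (case p of (t, s) \<Rightarrow> complex_of_real s * t) \<le> norm (fst p) * 1) ?B"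
      unfolding eventually_prod_filter
      by (rule exI[of _ "\<lambda>_. True"], rule exI[of _ "\<lambda>s. s \<in> {0..1}"])
        (auto simp: norm_mult eventually_principal mult_left_le_one_le)
  qed
  have stK: "eventually (\<lambda>p. (case p of (t, s) \<Rightarrow> complex_of_real s * t) \<in> K) ?B"
    unfolding eventually_prod_filter
    by (rule exI[of _ "\<lambda>t. t \<in> K"], rule exI[of _ "\<lambda>s. True"])
      (use E.eventually_scalar in \<open>auto elim!: eventually_mono\<close>)
  have zB: "limitin (vtop E) (\<lambda>(t, s). z t \<oplus>\<^bsub>E\<^esub> (complex_of_real s * t) \<odot>\<^bsub>E\<^esub> w t) z0 ?B"
  proof -
    have "limitin (vtop E) (\<lambda>p. z (fst p) \<oplus>\<^bsub>E\<^esub> (case p of (t, s) \<Rightarrow> complex_of_real s * t) \<odot>\<^bsub>E\<^esub> w (fst p))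
        (z0 \<oplus>\<^bsub>E\<^esub> 0 \<odot>\<^bsub>E\<^esub> w0) ?B"
      by (intro E.lim_add E.lim_scale fst z w st stK) auto
    then show ?thesis
      using E.lim_carrier(1)[OF w] E.lim_carrier(1)[OF z(1)] by (simp add: case_prod_unfold)
  qed
  have evus: "eventually (\<lambda>t. \<forall>u\<in>set us. u t \<in> carrier E) ?A"
  proof (subst eventually_ball_finite_distrib, simp, rule ballI)
    fix u assume "u \<in> set us"
    then obtain y where "limitin (vtop E) u y ?A"
      using us by (auto simp: list_all2_conv_all_nth in_set_conv_nth)
    then show "eventually (\<lambda>t. u t \<in> carrier E) ?A" by (rule E.lim_carrier(2))
  qed
  show ?thesis
  proof (rule lim_difference_quotient[OF E.lcs_axioms F.lcs_axioms open_dom,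
        where h' = "\<lambda>t x. D x (w t # map (\<lambda>\<eta>. \<eta> t) us)"])
    show "eventually (\<lambda>(t, s). z t \<oplus>\<^bsub>E\<^esub> (complex_of_real s * t) \<odot>\<^bsub>E\<^esub> w t \<in> U) ?B"
      using limitinD[OF zB open_dom z(2)] by (simp add: case_prod_unfold)
    show "eventually (\<lambda>t. z t \<in> carrier E \<and> w t \<in> carrier E \<and>
         (\<forall>x\<in>U. D x (map (\<lambda>\<eta>. \<eta> t) us) \<in> carrier F \<and>
          has_dir_deriv K E F (\<lambda>x. D x (map (\<lambda>\<eta>. \<eta> t) us)) (w t) x (D x (w t # map (\<lambda>\<eta>. \<eta> t) us)))) ?A"
      using eventually_conj[OF evus eventually_conj[OF E.lim_carrier(2)[OF z(1)] E.lim_carrier(2)[OF w]]]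
      by (rule eventually_mono)
        (use len len_us in \<open>auto intro!: tower_closed tower_deriv\<close>)
    have "limitin (vtop F) (\<lambda>p. D (case p of (t, s) \<Rightarrow> z t \<oplus>\<^bsub>E\<^esub> (complex_of_real s * t) \<odot>\<^bsub>E\<^esub> w t)
        (map (\<lambda>\<eta>. \<eta> p) (map (\<lambda>\<eta> p. \<eta> (fst p)) (w # us)))) (D z0 (w0 # ys)) ?B"
    proof (rule tower_lim[OF zB z(2)])
      show "list_all2 (\<lambda>\<eta> y. limitin (vtop E) \<eta> y ?B) (map (\<lambda>\<eta> p. \<eta> (fst p)) (w # us)) (w0 # ys)"
        using us w by (auto simp: list_all2_map1 intro!: fst elim!: list_all2_mono)
    qed (use len in simp)
    then show "limitin (vtop F) (\<lambda>(t, s). D (z t \<oplus>\<^bsub>E\<^esub> (complex_of_real s * t) \<odot>\<^bsub>E\<^esub> w t)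
        (w t # map (\<lambda>\<eta>. \<eta> t) us)) (D z0 (w0 # ys)) ?B"
      by (simp add: case_prod_unfold o_def)
  qed
qed

end

section \<open>Multilinearity and derivatives along curves\<close>

lemma filterlim_scale_at_0:
  assumes "c \<noteq> 0" "\<And>t. t \<in> K \<Longrightarrow> c * t \<in> K"
  shows "filterlim (\<lambda>t. c * t) (at (0::complex) within K) (at 0 within K)"
  unfolding filterlim_at
proof
  show "((\<lambda>t. c * t) \<longlongrightarrow> 0) (at 0 within K)"
    using tendsto_mult_right_zero[OF tendsto_ident_at] by blast
  show "eventually (\<lambda>t. c * t \<in> K \<and> c * t \<noteq> 0) (at 0 within K)"
    unfolding eventually_at_0_within_iff by (rule exI[of _ 1]) (use assms in auto)
qed

context hausdorff_lcs
begin

lemma curve_deriv_unique: "curve_deriv K E c d \<Longrightarrow> curve_deriv K E c d' \<Longrightarrow> d = d'"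
  unfolding curve_deriv_def by (rule lim_unique)

end

context tower
begin

lemma deriv_tower_line:
  assumes "x \<in> U" "y \<in> carrier E" "set ys \<subseteq> carrier E" "length ys < r"
  shows "curve_deriv K F (\<lambda>t. D (x \<oplus>\<^bsub>E\<^esub> t \<odot>\<^bsub>E\<^esub> y) ys) (D x (y # ys))"
  using tower_deriv[OF assms] assms(2) dom_carrier[OF assms(1)]
  by (simp add: E.has_dir_deriv_eq_curve_deriv)

lemma line_in_dom:
  assumes "x \<in> U" "y \<in> carrier E"
  shows "eventually (\<lambda>t. x \<oplus>\<^bsub>E\<^esub> t \<odot>\<^bsub>E\<^esub> y \<in> U) (at 0 within K)"
  by (rule E.line_in_open[OF open_dom assms])

text \<open>The increment along \<open>t \<odot> (a \<oplus> b)\<close> is the sum of an increment along \<open>t \<odot> a\<close> and one along \<open>t \<odot> b\<close>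
  that starts at the moving point \<open>x \<oplus> t \<odot> a\<close>.\<close>

lemma tower_add_head:
  assumes x: "x \<in> U" and ab: "a \<in> carrier E" "b \<in> carrier E"
    and ys: "set ys \<subseteq> carrier E" "length ys < r"
  shows "D x ((a \<oplus>\<^bsub>E\<^esub> b) # ys) = D x (a # ys) \<oplus>\<^bsub>F\<^esub> D x (b # ys)"
proof (rule F.curve_deriv_unique)
  let ?A = "at (0::complex) within K"
  let ?z = "\<lambda>t. x \<oplus>\<^bsub>E\<^esub> t \<odot>\<^bsub>E\<^esub> a"
  have xc: "x \<in> carrier E" using dom_carrier[OF x] .
  have "list_all2 (\<lambda>\<eta> y. limitin (vtop E) \<eta> y ?A) (map (\<lambda>y _. y) ys) ys"
    using ys(1) by (auto simp: list_all2_conv_all_nth)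
  from tower_difference_quotient[OF E.lim_line[OF xc ab(1)] x _ this ys(2), of "\<lambda>_. b" b]
  have 1: "limitin (vtop F) (\<lambda>t. inverse t \<odot>\<^bsub>F\<^esub> (D (?z t \<oplus>\<^bsub>E\<^esub> t \<odot>\<^bsub>E\<^esub> b) ys \<ominus>\<^bsub>F\<^esub> D (?z t) ys)) (D x (b # ys)) ?A"
    using ab by (simp add: o_def)
  have 2: "limitin (vtop F) (\<lambda>t. inverse t \<odot>\<^bsub>F\<^esub> (D (?z t) ys \<ominus>\<^bsub>F\<^esub> D x ys)) (D x (a # ys)) ?A"
    using tower_deriv[OF x ab(1) ys] by (simp add: has_dir_deriv_def)
  have ev: "eventually (\<lambda>t. t \<in> K \<and> t \<noteq> 0 \<and> ?z t \<in> U \<and> x \<oplus>\<^bsub>E\<^esub> t \<odot>\<^bsub>E\<^esub> (a \<oplus>\<^bsub>E\<^esub> b) \<in> U) ?A"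
    using eventually_conj[OF E.eventually_scalar eventually_conj[OF line_in_dom[OF x ab(1)] line_in_dom[OF x, of "a \<oplus>\<^bsub>E\<^esub> b"]]] ab
    by (simp add: conj_assoc)
  have "limitin (vtop F) (\<lambda>t. inverse t \<odot>\<^bsub>F\<^esub> (D (x \<oplus>\<^bsub>E\<^esub> t \<odot>\<^bsub>E\<^esub> (a \<oplus>\<^bsub>E\<^esub> b)) ys \<ominus>\<^bsub>F\<^esub> D x ys))
      (D x (a # ys) \<oplus>\<^bsub>F\<^esub> D x (b # ys)) ?A"
  proof (rule limitin_transform_eventually[OF eventually_mono[OF ev] F.lim_add[OF 2 1]], elim conjE)
    fix t assume t: "t \<in> K" "t \<noteq> 0" and U: "?z t \<in> U" "x \<oplus>\<^bsub>E\<^esub> t \<odot>\<^bsub>E\<^esub> (a \<oplus>\<^bsub>E\<^esub> b) \<in> U"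
    have e: "?z t \<oplus>\<^bsub>E\<^esub> t \<odot>\<^bsub>E\<^esub> b = x \<oplus>\<^bsub>E\<^esub> t \<odot>\<^bsub>E\<^esub> (a \<oplus>\<^bsub>E\<^esub> b)"
      using t xc ab by (simp add: E.scale_add_right E.a_assoc)
    have cl: "D x ys \<in> carrier F" "D (?z t) ys \<in> carrier F" "D (x \<oplus>\<^bsub>E\<^esub> t \<odot>\<^bsub>E\<^esub> (a \<oplus>\<^bsub>E\<^esub> b)) ys \<in> carrier F"
      using U x ys by (auto intro!: tower_closed)
    show "inverse t \<odot>\<^bsub>F\<^esub> (D (?z t) ys \<ominus>\<^bsub>F\<^esub> D x ys) \<oplus>\<^bsub>F\<^esub>
        inverse t \<odot>\<^bsub>F\<^esub> (D (?z t \<oplus>\<^bsub>E\<^esub> t \<odot>\<^bsub>E\<^esub> b) ys \<ominus>\<^bsub>F\<^esub> D (?z t) ys) =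
        inverse t \<odot>\<^bsub>F\<^esub> (D (x \<oplus>\<^bsub>E\<^esub> t \<odot>\<^bsub>E\<^esub> (a \<oplus>\<^bsub>E\<^esub> b)) ys \<ominus>\<^bsub>F\<^esub> D x ys)"
      unfolding e using cl t
      by (simp flip: F.scale_add_right add: F.a_comm[of "D (?z t) ys \<ominus>\<^bsub>F\<^esub> D x ys"] F.diff_diff_add)
  qed
  then show "curve_deriv K F (\<lambda>t. D (x \<oplus>\<^bsub>E\<^esub> t \<odot>\<^bsub>E\<^esub> (a \<oplus>\<^bsub>E\<^esub> b)) ys) (D x (a # ys) \<oplus>\<^bsub>F\<^esub> D x (b # ys))"
    using xc ab by (simp add: curve_deriv_def)
qed (use assms in \<open>auto intro: deriv_tower_line\<close>)

lemma tower_scale_head: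
  assumes x: "x \<in> U" and b: "c \<in> K" "b \<in> carrier E"
    and ys: "set ys \<subseteq> carrier E" "length ys < r"
  shows "D x ((c \<odot>\<^bsub>E\<^esub> b) # ys) = c \<odot>\<^bsub>F\<^esub> D x (b # ys)"
proof (cases "c = 0")
  case True
  have "D x (b # ys) \<in> carrier F" "D x ys \<in> carrier F"
    using x ys b(2) by (auto intro!: tower_closed)
  moreover have "D x (\<zero>\<^bsub>E\<^esub> # ys) = \<zero>\<^bsub>F\<^esub>"
  proof (rule F.curve_deriv_unique)
    show "curve_deriv K F (\<lambda>t. D (x \<oplus>\<^bsub>E\<^esub> t \<odot>\<^bsub>E\<^esub> \<zero>\<^bsub>E\<^esub>) ys) (D x (\<zero>\<^bsub>E\<^esub> # ys))"
      using assms by (intro deriv_tower_line) auto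
    have "curve_deriv K F (\<lambda>t. D x ys) \<zero>\<^bsub>F\<^esub>"
      by (rule F.curve_deriv_const) fact
    then show "curve_deriv K F (\<lambda>t. D (x \<oplus>\<^bsub>E\<^esub> t \<odot>\<^bsub>E\<^esub> \<zero>\<^bsub>E\<^esub>) ys) \<zero>\<^bsub>F\<^esub>"
      by (subst F.curve_deriv_cong)
        (use E.eventually_scalar dom_carrier[OF x] in \<open>auto elim!: eventually_mono\<close>)
  qed
  ultimately show ?thesis using True b by simp
next
  case False
  let ?A = "at (0::complex) within K"
  have xc: "x \<in> carrier E" using dom_carrier[OF x] .
  have cl: "D x ys \<in> carrier F" using x ys by (auto intro!: tower_closed)
  show ?thesis
  proof (rule F.lim_unique)
    show "limitin (vtop F) (\<lambda>t. inverse t \<odot>\<^bsub>F\<^esub> (D (x \<oplus>\<^bsub>E\<^esub> t \<odot>\<^bsub>E\<^esub> (c \<odot>\<^bsub>E\<^esub> b)) ys \<ominus>\<^bsub>F\<^esub> D x ys))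
        (D x ((c \<odot>\<^bsub>E\<^esub> b) # ys)) ?A"
      using tower_deriv[OF x _ ys, of "c \<odot>\<^bsub>E\<^esub> b"] b by (simp add: has_dir_deriv_def)
    have "limitin (vtop F) (\<lambda>t. inverse t \<odot>\<^bsub>F\<^esub> (D (x \<oplus>\<^bsub>E\<^esub> t \<odot>\<^bsub>E\<^esub> b) ys \<ominus>\<^bsub>F\<^esub> D x ys)) (D x (b # ys)) ?A"
      using tower_deriv[OF x b(2) ys] by (simp add: has_dir_deriv_def)
    from F.lim_scale_const[OF b(1) limitin_filterlim_compose[OF this filterlim_scale_at_0[OF False]]]
    have lim: "limitin (vtop F) (\<lambda>t. c \<odot>\<^bsub>F\<^esub> (inverse (c * t) \<odot>\<^bsub>F\<^esub> (D (x \<oplus>\<^bsub>E\<^esub> (c * t) \<odot>\<^bsub>E\<^esub> b) ys \<ominus>\<^bsub>F\<^esub> D x ys)))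
        (c \<odot>\<^bsub>F\<^esub> D x (b # ys)) ?A" using b by simp
    show "limitin (vtop F) (\<lambda>t. inverse t \<odot>\<^bsub>F\<^esub> (D (x \<oplus>\<^bsub>E\<^esub> t \<odot>\<^bsub>E\<^esub> (c \<odot>\<^bsub>E\<^esub> b)) ys \<ominus>\<^bsub>F\<^esub> D x ys))
        (c \<odot>\<^bsub>F\<^esub> D x (b # ys)) ?A"
    proof (rule limitin_transform_eventually[OF eventually_mono lim])
      show "eventually (\<lambda>t. (t \<in> K \<and> t \<noteq> 0) \<and> x \<oplus>\<^bsub>E\<^esub> t \<odot>\<^bsub>E\<^esub> (c \<odot>\<^bsub>E\<^esub> b) \<in> U) ?A"
        using eventually_conj[OF E.eventually_scalar line_in_dom[OF x, of "c \<odot>\<^bsub>E\<^esub> b"]] b by simp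
      fix t assume t: "(t \<in> K \<and> t \<noteq> 0) \<and> x \<oplus>\<^bsub>E\<^esub> t \<odot>\<^bsub>E\<^esub> (c \<odot>\<^bsub>E\<^esub> b) \<in> U"
      then have e: "x \<oplus>\<^bsub>E\<^esub> (c * t) \<odot>\<^bsub>E\<^esub> b = x \<oplus>\<^bsub>E\<^esub> t \<odot>\<^bsub>E\<^esub> (c \<odot>\<^bsub>E\<^esub> b)"
        using b by (simp add: E.scale_scale mult.commute)
      have "D (x \<oplus>\<^bsub>E\<^esub> t \<odot>\<^bsub>E\<^esub> (c \<odot>\<^bsub>E\<^esub> b)) ys \<in> carrier F"
        using t ys by (auto intro!: tower_closed)
      then show "c \<odot>\<^bsub>F\<^esub> (inverse (c * t) \<odot>\<^bsub>F\<^esub> (D (x \<oplus>\<^bsub>E\<^esub> (c * t) \<odot>\<^bsub>E\<^esub> b) ys \<ominus>\<^bsub>F\<^esub> D x ys)) =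
          inverse t \<odot>\<^bsub>F\<^esub> (D (x \<oplus>\<^bsub>E\<^esub> t \<odot>\<^bsub>E\<^esub> (c \<odot>\<^bsub>E\<^esub> b)) ys \<ominus>\<^bsub>F\<^esub> D x ys)"
        unfolding e using t b cl False
        by (simp add: F.scale_scale mult.assoc[symmetric] right_inverse)
    qed
  qed
qed

text \<open>Linearity in the first slot is an identity between functions of \<open>x\<close>; differentiating it in the
  directions \<open>us\<close> moves it to later slots.\<close>

lemma tower_linear:
  assumes x: "x \<in> U" and ab: "a \<in> carrier E" "c \<in> K" "b \<in> carrier E"
    and ys: "set us \<subseteq> carrier E" "set ys \<subseteq> carrier E" "length us + length ys < r"
  shows "D x (us @ (a \<oplus>\<^bsub>E\<^esub> c \<odot>\<^bsub>E\<^esub> b) # ys) = D x (us @ a # ys) \<oplus>\<^bsub>F\<^esub> c \<odot>\<^bsub>F\<^esub> D x (us @ b # ys)"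
  using ys x
proof (induction us arbitrary: x)
  case Nil
  then show ?case using ab tower_add_head[of x a "c \<odot>\<^bsub>E\<^esub> b" ys] tower_scale_head[of x c b ys] by simp
next
  case (Cons u us)
  let ?x = "\<lambda>t. x \<oplus>\<^bsub>E\<^esub> t \<odot>\<^bsub>E\<^esub> u"
  have u: "u \<in> carrier E" "set us \<subseteq> carrier E" using Cons.prems by auto
  have xc: "x \<in> carrier E" using dom_carrier Cons.prems by auto
  have line: "curve_deriv K F (\<lambda>t. D (?x t) (us @ v # ys)) (D x (u # us @ v # ys))" if "v \<in> carrier E" for v
    using Cons.prems that by (intro deriv_tower_line) auto
  have cl: "D x' (us @ v # ys) \<in> carrier F" if "v \<in> carrier E" "x' \<in> U" for v x'
    using Cons.prems that by (intro tower_closed) auto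
  have evU: "eventually (\<lambda>t. ?x t \<in> U) (at 0 within K)"
    using Cons.prems u by (intro line_in_dom) auto
  have evcl: "eventually (\<lambda>t. D (?x t) (us @ v # ys) \<in> carrier F) (at 0 within K)" if "v \<in> carrier E" for v
    using evU by (rule eventually_mono) (rule cl[OF that])
  have cl0: "D (?x 0) (us @ v # ys) \<in> carrier F" if "v \<in> carrier E" for v
    using cl[OF that Cons.prems(4)] xc u by simp
  have sc: "curve_deriv K F (\<lambda>t. c \<odot>\<^bsub>F\<^esub> D (?x t) (us @ b # ys)) (c \<odot>\<^bsub>F\<^esub> D x (u # us @ b # ys))"
    unfolding curve_deriv_def
  proof (rule limitin_transform_eventually[OF eventually_mono[OF eventually_conj[OF E.eventually_scalar evcl[OF ab(3)]]]
        F.lim_scale_const[OF ab(2) line[OF ab(3), unfolded curve_deriv_def]]])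
    fix t assume "(t \<in> K \<and> t \<noteq> 0) \<and> D (?x t) (us @ b # ys) \<in> carrier F"
    then show "c \<odot>\<^bsub>F\<^esub> (inverse t \<odot>\<^bsub>F\<^esub> (D (?x t) (us @ b # ys) \<ominus>\<^bsub>F\<^esub> D (?x 0) (us @ b # ys))) =
        inverse t \<odot>\<^bsub>F\<^esub> (c \<odot>\<^bsub>F\<^esub> D (?x t) (us @ b # ys) \<ominus>\<^bsub>F\<^esub> c \<odot>\<^bsub>F\<^esub> D (?x 0) (us @ b # ys))"
      using cl0[OF ab(3)] ab by (simp add: F.scale_diff_right F.scale_scale mult.commute)
  qed
  show ?case
  proof (simp, rule F.curve_deriv_unique)
    show "curve_deriv K F (\<lambda>t. D (?x t) (us @ (a \<oplus>\<^bsub>E\<^esub> c \<odot>\<^bsub>E\<^esub> b) # ys)) (D x (u # us @ (a \<oplus>\<^bsub>E\<^esub> c \<odot>\<^bsub>E\<^esub> b) # ys))"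
      using ab by (intro line) auto
    have "curve_deriv K F (\<lambda>t. D (?x t) (us @ a # ys) \<oplus>\<^bsub>F\<^esub> c \<odot>\<^bsub>F\<^esub> D (?x t) (us @ b # ys))
        (D x (u # us @ a # ys) \<oplus>\<^bsub>F\<^esub> c \<odot>\<^bsub>F\<^esub> D x (u # us @ b # ys))"
      using ab cl0 by (intro F.curve_deriv_add sc line evcl eventually_mono[OF evcl[OF ab(3)]]) auto
    moreover have "D x' (us @ (a \<oplus>\<^bsub>E\<^esub> c \<odot>\<^bsub>E\<^esub> b) # ys) = D x' (us @ a # ys) \<oplus>\<^bsub>F\<^esub> c \<odot>\<^bsub>F\<^esub> D x' (us @ b # ys)"
      if "x' \<in> U" for x' using Cons.IH[of x'] Cons.prems that by simp
    ultimately show "curve_deriv K F (\<lambda>t. D (?x t) (us @ (a \<oplus>\<^bsub>E\<^esub> c \<odot>\<^bsub>E\<^esub> b) # ys))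
        (D x (u # us @ a # ys) \<oplus>\<^bsub>F\<^esub> c \<odot>\<^bsub>F\<^esub> D x (u # us @ b # ys))"
      using Cons.prems xc u by (subst F.curve_deriv_cong) (auto intro: eventually_mono[OF evU])
  qed
qed

end

text \<open>The lists obtained by applying \<open>g\<close> to one entry and \<open>f\<close> to the others: these are the terms of the
  Leibniz rule, with \<open>g\<close> in the role of the derivative.\<close>

primrec replace_one :: "('a \<Rightarrow> 'b) \<Rightarrow> ('a \<Rightarrow> 'b) \<Rightarrow> 'a list \<Rightarrow> 'b list list" where
  "replace_one f g [] = []"
| "replace_one f g (x # xs) = (g x # map f xs) # map ((#) (f x)) (replace_one f g xs)"

context tower
begin

text \<open>The Leibniz rule for the multilinear map \<open>D x\<close>. The directions in \<open>as\<close> are those which have already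
  been frozen at \<open>t = 0\<close> when the list is processed from the left.\<close>

lemma tower_curve_directions:
  assumes x: "x \<in> U"
    and us: "\<And>b t. b \<in> set L \<Longrightarrow> eventually (\<lambda>t. u b t \<in> carrier E) (at 0 within K)"
      "\<And>b. b \<in> set L \<Longrightarrow> u b 0 \<in> carrier E"
      "\<And>b. b \<in> set L \<Longrightarrow> curve_deriv K E (u b) (u' b)"
    and as: "set as \<subseteq> carrier E" "length as + length L \<le> r"
  shows "curve_deriv K F (\<lambda>t. D x (as @ map (\<lambda>b. u b t) L))
           (vsum F (map (\<lambda>vs. D x (as @ vs)) (replace_one (\<lambda>b. u b 0) u' L)))"
  using us as
proof (induction L arbitrary: as)
  case Nil
  then show ?case using F.curve_deriv_const[of "D x as"] x tower_closed[of x as] by simp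
next
  case (Cons b L)
  let ?A = "at (0::complex) within K"
  let ?q = "\<lambda>t. inverse t \<odot>\<^bsub>E\<^esub> (u b t \<ominus>\<^bsub>E\<^esub> u b 0)"
  let ?v = "\<lambda>t. map (\<lambda>b. u b t) L"
  have b0: "u b 0 \<in> carrier E" using Cons.prems by simp
  have q: "limitin (vtop E) ?q (u' b) ?A" using Cons.prems(3)[of b] by (simp add: curve_deriv_def)
  have L: "list_all2 (\<lambda>\<eta> y. limitin (vtop E) \<eta> y ?A) (map u L) (map (\<lambda>b. u b 0) L)"
    using Cons.prems by (auto simp: list_all2_map1 list_all2_map2 list_all2_same intro!: E.curve_deriv_lim)
  have "limitin (vtop F) (\<lambda>t. D x (map (\<lambda>\<eta>. \<eta> t) (map (\<lambda>a _. a) as @ ?q # map u L)))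
      (D x (as @ u' b # map (\<lambda>b. u b 0) L)) ?A"
  proof (rule tower_lim)
    show "list_all2 (\<lambda>\<eta> y. limitin (vtop E) \<eta> y ?A) (map (\<lambda>a _. a) as @ ?q # map u L)
            (as @ u' b # map (\<lambda>b. u b 0) L)"
      using Cons.prems(4) q L
      by (intro list_all2_appendI list.rel_intros) (auto simp: list_all2_map1 list_all2_same)
  qed (use x dom_carrier Cons.prems in auto)
  then have lim1: "limitin (vtop F) (\<lambda>t. D x (as @ ?q t # ?v t)) (D x (as @ u' b # ?v 0)) ?A"
    by (simp add: o_def)
  have lim2: "limitin (vtop F) (\<lambda>t. inverse t \<odot>\<^bsub>F\<^esub> (D x (as @ u b 0 # ?v t) \<ominus>\<^bsub>F\<^esub> D x (as @ u b 0 # ?v 0)))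
      (vsum F (map (\<lambda>vs. D x (as @ u b 0 # vs)) (replace_one (\<lambda>b. u b 0) u' L))) ?A"
    using Cons.IH[of "as @ [u b 0]"] Cons.prems b0 by (simp add: curve_deriv_def)
  have "eventually (\<lambda>t. \<forall>c\<in>set (b # L). u c t \<in> carrier E) ?A"
    using Cons.prems(1) by (subst eventually_ball_finite_distrib) auto
  then have ev: "eventually (\<lambda>t. (t \<in> K \<and> t \<noteq> 0) \<and> (\<forall>c\<in>set (b # L). u c t \<in> carrier E)) ?A"
    using E.eventually_scalar by (simp add: eventually_conj_iff)
  have "limitin (vtop F) (\<lambda>t. inverse t \<odot>\<^bsub>F\<^esub> (D x (as @ u b t # ?v t) \<ominus>\<^bsub>F\<^esub> D x (as @ u b 0 # ?v 0)))
      (D x (as @ u' b # ?v 0) \<oplus>\<^bsub>F\<^esub> vsum F (map (\<lambda>vs. D x (as @ u b 0 # vs)) (replace_one (\<lambda>b. u b 0) u' L))) ?A"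
  proof (rule limitin_transform_eventually[OF eventually_mono[OF ev] F.lim_add[OF lim1 lim2]], elim conjE)
    fix t assume t: "t \<in> K" "t \<noteq> 0" and c: "\<forall>c\<in>set (b # L). u c t \<in> carrier E"
    have len: "length as + length (?v t) < r" using Cons.prems(5) by simp
    have sv: "set (?v t) \<subseteq> carrier E" "set (?v 0) \<subseteq> carrier E" "u b t \<in> carrier E"
      using c Cons.prems by auto
    have ub: "u b 0 \<oplus>\<^bsub>E\<^esub> t \<odot>\<^bsub>E\<^esub> ?q t = u b t"
      using t b0 sv(3) by (simp add: E.scale_scale)
    have "D x (as @ u b t # ?v t) = D x (as @ u b 0 # ?v t) \<oplus>\<^bsub>F\<^esub> t \<odot>\<^bsub>F\<^esub> D x (as @ ?q t # ?v t)"
      using tower_linear[OF x b0 t(1), of "?q t" as "?v t"] t b0 sv Cons.prems(4) len ub by simp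
    moreover have "D x (as @ u b 0 # ?v t) \<in> carrier F" "D x (as @ u b 0 # ?v 0) \<in> carrier F"
        "D x (as @ ?q t # ?v t) \<in> carrier F"
      using x t b0 sv Cons.prems(4,5) by (simp_all add: tower_closed)
    ultimately show "D x (as @ ?q t # ?v t) \<oplus>\<^bsub>F\<^esub>
          inverse t \<odot>\<^bsub>F\<^esub> (D x (as @ u b 0 # ?v t) \<ominus>\<^bsub>F\<^esub> D x (as @ u b 0 # ?v 0)) =
        inverse t \<odot>\<^bsub>F\<^esub> (D x (as @ u b t # ?v t) \<ominus>\<^bsub>F\<^esub> D x (as @ u b 0 # ?v 0))"
      using t by (simp add: F.scale_scale F.scale_diff_right F.scale_add_right F.minus_eq F.a_ac)
  qed
  then show ?case by (simp add: curve_deriv_def o_def)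
qed

text \<open>The chain rule for one derivative, along a curve of points with directions that vary as well: moving
  the point adds its velocity as a new direction, and moving the directions contributes the
  Leibniz terms.\<close>

lemma tower_curve:
  assumes c: "c 0 \<in> U" "eventually (\<lambda>t. c t \<in> carrier E) (at 0 within K)" "curve_deriv K E c c'"
    and us: "\<And>b t. b \<in> set L \<Longrightarrow> eventually (\<lambda>t. u b t \<in> carrier E) (at 0 within K)"
      "\<And>b. b \<in> set L \<Longrightarrow> u b 0 \<in> carrier E"
      "\<And>b. b \<in> set L \<Longrightarrow> curve_deriv K E (u b) (u' b)"
    and len: "length L < r"
  shows "curve_deriv K F (\<lambda>t. D (c t) (map (\<lambda>b. u b t) L))
           (vsum F (map (D (c 0)) ((c' # map (\<lambda>b. u b 0) L) # replace_one (\<lambda>b. u b 0) u' L)))"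
proof -
  let ?A = "at (0::complex) within K"
  let ?q = "\<lambda>t. inverse t \<odot>\<^bsub>E\<^esub> (c t \<ominus>\<^bsub>E\<^esub> c 0)"
  let ?v = "\<lambda>t. map (\<lambda>b. u b t) L"
  have c0: "c 0 \<in> carrier E" using c(1) dom_carrier by blast
  have L: "list_all2 (\<lambda>\<eta> y. limitin (vtop E) \<eta> y ?A) (map u L) (?v 0)"
    using us by (auto simp: list_all2_map1 list_all2_map2 list_all2_same intro!: E.curve_deriv_lim)
  have lim1: "limitin (vtop F) (\<lambda>t. inverse t \<odot>\<^bsub>F\<^esub>
        (D (c 0 \<oplus>\<^bsub>E\<^esub> t \<odot>\<^bsub>E\<^esub> ?q t) (?v t) \<ominus>\<^bsub>F\<^esub> D (c 0) (?v t))) (D (c 0) (c' # ?v 0)) ?A"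
    using tower_difference_quotient[of "\<lambda>_. c 0" "c 0" ?q c' "map u L" "?v 0"] c c0 L len
    by (simp add: curve_deriv_def o_def)
  have lim2: "limitin (vtop F) (\<lambda>t. inverse t \<odot>\<^bsub>F\<^esub> (D (c 0) (?v t) \<ominus>\<^bsub>F\<^esub> D (c 0) (?v 0)))
      (vsum F (map (D (c 0)) (replace_one (\<lambda>b. u b 0) u' L))) ?A"
    using tower_curve_directions[OF c(1), of L u u' "[]"] us len by (simp add: curve_deriv_def)
  have "eventually (\<lambda>t. \<forall>b\<in>set L. u b t \<in> carrier E) ?A"
    using us(1) by (subst eventually_ball_finite_distrib) auto
  moreover have "eventually (\<lambda>t. c t \<in> U) ?A"
    using limitinD[OF E.curve_deriv_lim[OF c(3) c0 c(2)] open_dom c(1)] .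
  ultimately have ev: "eventually (\<lambda>t. (t \<in> K \<and> t \<noteq> 0) \<and> (\<forall>b\<in>set L. u b t \<in> carrier E) \<and> c t \<in> U) ?A"
    using E.eventually_scalar by (simp add: eventually_conj_iff)
  have "limitin (vtop F) (\<lambda>t. inverse t \<odot>\<^bsub>F\<^esub> (D (c t) (?v t) \<ominus>\<^bsub>F\<^esub> D (c 0) (?v 0)))
      (D (c 0) (c' # ?v 0) \<oplus>\<^bsub>F\<^esub> vsum F (map (D (c 0)) (replace_one (\<lambda>b. u b 0) u' L))) ?A"
  proof (rule limitin_transform_eventually[OF eventually_mono[OF ev] F.lim_add[OF lim1 lim2]], elim conjE)
    fix t assume t: "t \<in> K" "t \<noteq> 0" and b: "\<forall>b\<in>set L. u b t \<in> carrier E" and ct: "c t \<in> U"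
    have e: "c 0 \<oplus>\<^bsub>E\<^esub> t \<odot>\<^bsub>E\<^esub> ?q t = c t"
      using t c0 dom_carrier[OF ct] by (simp add: E.scale_scale)
    have cl: "D (c t) (?v t) \<in> carrier F" "D (c 0) (?v t) \<in> carrier F" "D (c 0) (?v 0) \<in> carrier F"
      using ct c(1) b us(2) len by (auto intro!: tower_closed)
    show "inverse t \<odot>\<^bsub>F\<^esub> (D (c 0 \<oplus>\<^bsub>E\<^esub> t \<odot>\<^bsub>E\<^esub> ?q t) (?v t) \<ominus>\<^bsub>F\<^esub> D (c 0) (?v t)) \<oplus>\<^bsub>F\<^esub>
        inverse t \<odot>\<^bsub>F\<^esub> (D (c 0) (?v t) \<ominus>\<^bsub>F\<^esub> D (c 0) (?v 0)) =
        inverse t \<odot>\<^bsub>F\<^esub> (D (c t) (?v t) \<ominus>\<^bsub>F\<^esub> D (c 0) (?v 0))"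
      unfolding e using cl t by (simp flip: F.scale_add_right add: F.diff_diff_add)
  qed
  then show ?thesis by (simp add: curve_deriv_def)
qed

end

section \<open>The chain rule\<close>

lemma (in hausdorff_lcs) dir_deriv_eq:
  "has_dir_deriv K E' E f y x d \<Longrightarrow> dir_deriv K E' E f y x = d"
  unfolding dir_deriv_def
  by (rule the_equality) (auto simp: has_dir_deriv_def intro: lim_unique)

lemma (in lcs) has_dir_deriv_cong:
  assumes "openin (vtop E) U" "x \<in> U" "y \<in> carrier E" "\<And>x. x \<in> U \<Longrightarrow> f x = g x"
  shows "has_dir_deriv K E F f y x d \<longleftrightarrow> has_dir_deriv K E F g y x d"
  unfolding has_dir_deriv_def
  by (rule limitin_cong_eventually, rule eventually_mono[OF line_in_open[OF assms(1-3)]])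
    (use assms in auto)

text \<open>It is enough to prove closure properties for finite orders of differentiability.\<close>

lemma C_map_infinity_iff: "C_map K \<infinity> E F U f \<longleftrightarrow> (\<forall>r. C_map K (enat r) E F U f)"
proof
  assume r: "\<forall>r. C_map K (enat r) E F U f"
  show "C_map K \<infinity> E F U f"
    unfolding C_map_def
  proof (intro conjI allI impI)
    show "continuous_map (subtopology (vtop E) U) (vtop F) f"
      using r by (simp add: C_map_def)
  next
    fix k :: nat assume "1 \<le> k \<and> enat k \<le> \<infinity>"
    then have "1 \<le> k \<and> enat k \<le> enat k" by simp
    with r[rule_format, of k, unfolded C_map_def, THEN conjunct2, rule_format, OF this]
    show "\<forall>x\<in>U. \<forall>y\<in>carrier E. \<forall>ys. set ys \<subseteq> carrier E \<and> Suc (length ys) = k \<longrightarrow>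
           (\<exists>d. has_dir_deriv K E F (iter_deriv K E F f ys) y x d)"
      and "jointly_continuous E F U k (\<lambda>x ys. iter_deriv K E F f ys x)"
      by simp_all
  qed
next
  assume "C_map K \<infinity> E F U f"
  then show "\<forall>r. C_map K (enat r) E F U f"
    unfolding C_map_def by (simp only: enat_ord_code(3) simp_thms) blast
qed

text \<open>In a Hausdorff space limits are unique, so the descriptions in \<open>dir_deriv\<close> denote the derivatives
  whose existence \<open>C_map\<close> demands.\<close>

lemma C_map_imp_tower:
  assumes "lcs K E" "hausdorff_lcs K F" "openin (vtop E) U" "C_map K (enat r) E F U f"
  shows "tower K E F r U (\<lambda>x ys. iter_deriv K E F f ys x)"
proof -
  interpret E: lcs K E by fact
  interpret F: hausdorff_lcs K F by fact
  have "deriv_tower K r E F U (\<lambda>x ys. iter_deriv K E F f ys x)"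
    unfolding deriv_tower_def
  proof (intro conjI allI impI ballI)
    fix k assume "k \<le> r"
    show "jointly_continuous E F U k (\<lambda>x ys. iter_deriv K E F f ys x)"
    proof (cases "k = 0")
      case True
      then show ?thesis
        using continuous_map_compose[OF continuous_map_fst, of "subtopology (vtop E) U" "vtop F" f] assms(4)
        by (simp add: C_map_def o_def case_prod_unfold)
    next
      case False
      then show ?thesis using assms(4) \<open>k \<le> r\<close> by (simp add: C_map_def)
    qed
  next
    fix x y ys assume *: "x \<in> U" "y \<in> carrier E" "set ys \<subseteq> carrier E \<and> length ys < r"
    then obtain d where d: "has_dir_deriv K E F (iter_deriv K E F f ys) y x d"
      using assms(4) unfolding C_map_def by (metis Suc_leI One_nat_def enat_ord_simps(1) le_add1 plus_1_eq_Suc)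
    then show "has_dir_deriv K E F (\<lambda>x. iter_deriv K E F f ys x) y x (iter_deriv K E F f (y # ys) x)"
      using F.dir_deriv_eq[OF d] by simp
  qed
  then show ?thesis
    by (intro tower.intro tower_axioms.intro assms)
qed

context tower
begin

lemma iter_deriv_eq:
  assumes "\<And>x. x \<in> U \<Longrightarrow> D x [] = f x" "x \<in> U" "set ys \<subseteq> carrier E" "length ys \<le> r"
  shows "iter_deriv K E F f ys x = D x ys"
  using assms(2-4)
proof (induction ys arbitrary: x)
  case (Cons y ys)
  have "has_dir_deriv K E F (\<lambda>x. D x ys) y x (D x (y # ys))"
    using Cons.prems by (intro tower_deriv) auto
  then have "has_dir_deriv K E F (iter_deriv K E F f ys) y x (D x (y # ys))"
    by (subst E.has_dir_deriv_cong[OF open_dom]) (use Cons in auto)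
  then show ?case using F.dir_deriv_eq by auto
qed (use assms(1) in simp)

lemma tower_C_map:
  assumes f: "\<And>x. x \<in> U \<Longrightarrow> D x [] = f x"
  shows "C_map K (enat r) E F U f"
  unfolding C_map_def
proof (intro conjI allI impI ballI)
  show "continuous_map (subtopology (vtop E) U) (vtop F) f"
    unfolding continuous_map_atin
  proof
    fix x assume x: "x \<in> topspace (subtopology (vtop E) U)"
    from limitin_ident_atin[OF x] have lim: "limitin (vtop E) (\<lambda>a. a) x (atin (subtopology (vtop E) U) x)"
      and ev: "eventually (\<lambda>a. a \<in> U) (atin (subtopology (vtop E) U) x)"
      by (simp_all add: limitin_subtopology)
    have "limitin (vtop F) (\<lambda>a. D a (map (\<lambda>\<eta>. \<eta> a) [])) (D x []) (atin (subtopology (vtop E) U) x)"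
      using x by (intro tower_lim[OF lim]) auto
    then show "limitin (vtop F) f (f x) (atin (subtopology (vtop E) U) x)"
      using f x by (subst limitin_cong_eventually[of f "\<lambda>a. D a []"]) (auto intro: eventually_mono[OF ev])
  qed
next
  fix k x y ys
  assume k: "1 \<le> k \<and> enat k \<le> enat r" and x: "x \<in> U" "y \<in> carrier E"
    and ys: "set ys \<subseteq> carrier E \<and> Suc (length ys) = k"
  have "has_dir_deriv K E F (\<lambda>x. D x ys) y x (D x (y # ys))"
    using k x ys by (intro tower_deriv) auto
  then have "has_dir_deriv K E F (iter_deriv K E F f ys) y x (D x (y # ys))"
    by (subst E.has_dir_deriv_cong[OF open_dom]) (use x ys k f iter_deriv_eq in auto)
  then show "\<exists>d. has_dir_deriv K E F (iter_deriv K E F f ys) y x d" by blast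
next
  fix k assume k: "1 \<le> k \<and> enat k \<le> enat r"
  then have "jointly_continuous E F U k D"
    using tower by (simp add: deriv_tower_def)
  then show "jointly_continuous E F U k (\<lambda>x ys. iter_deriv K E F f ys x)"
    by (rule continuous_map_eq)
      (use k f iter_deriv_eq in \<open>auto simp: image_subset_iff PiE_iff\<close>)
qed

end

lemma set_replace_oneD:
  "xs \<in> set (replace_one f g L) \<Longrightarrow> \<exists>L1 b L2. L = L1 @ b # L2 \<and> xs = map f L1 @ g b # map f L2"
proof (induction L arbitrary: xs)
  case (Cons c L)
  then consider "xs = g c # map f L" | zs where "xs = f c # zs" "zs \<in> set (replace_one f g L)" by auto
  then show ?case
  proof cases
    case 1
    then show ?thesis by (intro exI[of _ "[]"]) auto
  next
    case 2
    with Cons.IH obtain L1 b L2 where "L = L1 @ b # L2" "zs = map f L1 @ g b # map f L2" by blast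
    with 2 show ?thesis by (intro exI[of _ "c # L1"]) auto
  qed
qed simp

lemma replace_one_map: "replace_one f g (map h L) = replace_one (\<lambda>x. f (h x)) (\<lambda>x. g (h x)) L"
  by (induction L) (auto simp: o_def)

lemma map_replace_one: "map (map h) (replace_one f g L) = replace_one (\<lambda>x. h (f x)) (\<lambda>x. h (g x)) L"
proof (induction L)
  case (Cons a L)
  have "map (map h) (map ((#) (f a)) R) = map ((#) (h (f a))) (map (map h) R)" for R by simp
  then show ?case using Cons by (simp add: o_def del: map_map) (simp add: o_def)
qed simp

text \<open>A new direction forms a block of its own or joins one of the existing blocks.\<close>

definition extend_partition :: "'a \<Rightarrow> 'a list list \<Rightarrow> 'a list list list" where
  "extend_partition y P = ([y] # P) # replace_one (\<lambda>B. B) (\<lambda>B. y # B) P"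

text \<open>The partitions of the set of positions of a list, each given by the lists of entries in its
  blocks. They index the terms in the formula of Faa di Bruno.\<close>

primrec partitions :: "'a list \<Rightarrow> 'a list list list" where
  "partitions [] = [[]]"
| "partitions (y # ys) = concat (map (extend_partition y) (partitions ys))"

lemma partitions_bounds:
  assumes "P \<in> set (partitions ys)"
  shows "length P \<le> length ys \<and> (\<forall>B\<in>set P. set B \<subseteq> set ys \<and> length B \<le> length ys)"
  using assms
proof (induction ys arbitrary: P)
  case (Cons y ys)
  then obtain Q where Q: "Q \<in> set (partitions ys)" "P \<in> set (extend_partition y Q)" by auto
  note IH = Cons.IH[OF Q(1)]
  from Q(2) consider "P = [y] # Q" | "P \<in> set (replace_one (\<lambda>B. B) (\<lambda>B. y # B) Q)"
    by (auto simp: extend_partition_def)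
  then show ?case
  proof cases
    case 1
    show ?thesis unfolding 1
    proof (intro conjI ballI)
      fix B assume "B \<in> set ([y] # Q)"
      then have "B = [y] \<or> B \<in> set Q" by auto
      then show "set B \<subseteq> set (y # ys)" "length B \<le> length (y # ys)" using IH by auto
    qed (use IH in simp)
  next
    case 2
    then obtain L1 C L2 where *: "Q = L1 @ C # L2" "P = L1 @ (y # C) # L2"
      using set_replace_oneD[OF 2] by auto
    show ?thesis
    proof (intro conjI ballI)
      fix B assume "B \<in> set P"
      then have "B = y # C \<or> B \<in> set Q" using * by auto
      then show "set B \<subseteq> set (y # ys)" "length B \<le> length (y # ys)"
        using IH * by (auto intro: le_SucI)
    qed (use IH * in simp)
  qed
qed simp

lemma partitions_map: "partitions (map h ys) = map (map (map h)) (partitions ys)"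
proof (induction ys)
  case (Cons y ys)
  have "extend_partition (h y) (map (map h) P) = map (map (map h)) (extend_partition y P)" for P
    by (simp add: extend_partition_def replace_one_map map_replace_one)
  then show ?case using Cons by (simp add: map_concat o_def)
qed simp

text \<open>The formula of Faa di Bruno. A term belongs to a partition \<open>P\<close> of the list of directions: the outer
  map is differentiated once for each block, in the direction given by the derivative of the inner
  map along that block. Differentiating such a term in a further direction \<open>y\<close> differentiates the
  outer map once more, which adds the block \<open>[y]\<close>, or one of the inner derivatives, which adds \<open>y\<close>
  to its block.\<close>

lemma tower_compose:
  assumes f: "tower K E F r U Df" and g: "tower K F H r V Dg" and into: "\<And>x. x \<in> U \<Longrightarrow> Df x [] \<in> V"
  shows "tower K E H r U (\<lambda>x ys. vsum H (map (\<lambda>P. Dg (Df x []) (map (Df x) P)) (partitions ys)))"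
proof -
  interpret f: tower K E F r U Df by fact
  interpret g: tower K F H r V Dg by fact
  define T where "T = (\<lambda>x P. Dg (Df x []) (map (Df x) P))"
  have bd: "length P \<le> r" "\<And>B. B \<in> set P \<Longrightarrow> length B \<le> r" "\<And>B. B \<in> set P \<Longrightarrow> set B \<subseteq> set ys"
    if "P \<in> set (partitions ys)" "length ys \<le> r" for P ys
    using partitions_bounds[OF that(1)] that(2) by auto
  have Tcl: "T x P \<in> carrier H"
    if "P \<in> set (partitions ys)" "length ys \<le> r" "set ys \<subseteq> carrier E" "x \<in> U" for x P ys
    unfolding T_def using bd[OF that(1,2)] that(3,4)
    by (intro g.tower_closed into) (auto intro!: f.tower_closed)
  have "deriv_tower K r E H U (\<lambda>x ys. vsum H (map (T x) (partitions ys)))"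
    unfolding deriv_tower_def
  proof (intro conjI allI impI ballI)
    fix k assume k: "k \<le> r"
    show "jointly_continuous E H U k (\<lambda>x ys. vsum H (map (T x) (partitions ys)))"
    proof (rule continuous_map_jointlyI)
      show "U \<subseteq> topspace (vtop E)" using openin_subset[OF f.open_dom] .
      fix A :: "('a \<times> (nat \<Rightarrow> 'a)) filter" and X x \<eta>s ys
      assume X: "limitin (vtop E) X x A" "x \<in> U" "eventually (\<lambda>a. X a \<in> U) A"
        and \<eta>s: "list_all2 (\<lambda>\<eta> y. limitin (vtop E) \<eta> y A) \<eta>s ys" and len: "length ys = k"
      \<comment> \<open>Each converging map is paired with its limit, so that the partitions of one list \<open>q\<close>
        describe the terms before and after passing to the limit.\<close>
      define q where "q = zip \<eta>s ys"
      have len': "length \<eta>s = length ys" using \<eta>s by (rule list_all2_lengthD)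
      have q: "\<eta>s = map fst q" "ys = map snd q" using len' by (simp_all add: q_def)
      have qlim: "limitin (vtop E) (fst p) (snd p) A" if "p \<in> set q" for p
        using \<eta>s that by (auto simp: q_def list_all2_conv_all_nth in_set_zip)
      have part: "limitin (vtop H) (\<lambda>a. T (X a) (map (map (\<lambda>p. fst p a)) P)) (T x (map (map snd) P)) A"
        if P: "P \<in> set (partitions q)" for P
      proof -
        have lq: "length q \<le> r" using len len' k by (simp add: q_def)
        have Df: "limitin (vtop F) (\<lambda>a. Df (X a) (map (\<lambda>p. fst p a) B)) (Df x (map snd B)) A"
          if "set B \<subseteq> set q" "length B \<le> r" for B
        proof -
          have "list_all2 (\<lambda>\<eta> y. limitin (vtop E) \<eta> y A) (map fst B) (map snd B)"
            using that(1) by (auto simp: list_all2_map1 list_all2_map2 list_all2_same intro!: qlim[simplified])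
          from f.tower_lim[OF X(1,2) this] show ?thesis using that(2) by (simp add: o_def)
        qed
        have "limitin (vtop H) (\<lambda>a. Dg (Df (X a) []) (map (\<lambda>\<eta>. \<eta> a) (map (\<lambda>B a. Df (X a) (map (\<lambda>p. fst p a) B)) P)))
            (Dg (Df x []) (map (\<lambda>B. Df x (map snd B)) P)) A"
          using Df[of "[]"] bd[OF P lq] X(2) into
          by (intro g.tower_lim) (auto simp: list_all2_map1 list_all2_map2 list_all2_same intro!: Df)
        then show ?thesis by (simp add: T_def o_def)
      qed
      have "limitin (vtop H) (\<lambda>a. vsum H (map (\<lambda>P. T (X a) (map (map (\<lambda>p. fst p a)) P)) (partitions q)))
          (vsum H (map (\<lambda>P. T x (map (map snd) P)) (partitions q))) A"
        by (rule g.F.lim_vsum[OF part])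
      moreover have "map (\<lambda>\<eta>. \<eta> a) \<eta>s = map (\<lambda>p. fst p a) q" for a by (simp add: q)
      ultimately show "limitin (vtop H) (\<lambda>a. vsum H (map (T (X a)) (partitions (map (\<lambda>\<eta>. \<eta> a) \<eta>s))))
          (vsum H (map (T x) (partitions ys))) A"
        by (simp add: partitions_map o_def) (simp add: q(2) partitions_map o_def)
    qed
  next
    fix x y ys assume x: "x \<in> U" and y: "y \<in> carrier E" and ys: "set ys \<subseteq> carrier E \<and> length ys < r"
    have xc: "x \<in> carrier E" using f.dom_carrier[OF x] .
    let ?x = "\<lambda>t. x \<oplus>\<^bsub>E\<^esub> t \<odot>\<^bsub>E\<^esub> y"
    have x0: "?x 0 = x" using xc y by simp
    note evU = f.line_in_dom[OF x y]
    have evDf: "eventually (\<lambda>t. Df (?x t) B \<in> carrier F) (at 0 within K)"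
      if "set B \<subseteq> carrier E" "length B \<le> r" for B
      using evU by (rule eventually_mono) (rule f.tower_closed[OF _ that])
    have P: "curve_deriv K H (\<lambda>t. T (?x t) P) (vsum H (map (T x) (extend_partition y P)))"
      if P: "P \<in> set (partitions ys)" for P
    proof -
      have B: "set B \<subseteq> carrier E" "length B < r" if "B \<in> set P" for B
        using partitions_bounds[OF P] that ys by (auto simp: subset_iff)
      have "length P < r" using partitions_bounds[OF P] ys by auto
      have "curve_deriv K H (\<lambda>t. Dg (Df (?x t) []) (map (\<lambda>B. Df (?x t) B) P))
         (vsum H (map (Dg (Df (?x 0) [])) ((Df x [y] # map (\<lambda>B. Df (?x 0) B) P) #
            replace_one (\<lambda>B. Df (?x 0) B) (\<lambda>B. Df x (y # B)) P)))"
      proof (rule g.tower_curve)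
        show "Df (?x 0) [] \<in> V" using into x x0 by simp
        show "eventually (\<lambda>t. Df (?x t) [] \<in> carrier F) (at 0 within K)" by (intro evDf) auto
        show "curve_deriv K F (\<lambda>t. Df (?x t) []) (Df x [y])"
          using ys by (intro f.deriv_tower_line x y) auto
      next
        fix B assume "B \<in> set P"
        from B[OF this]
        show "eventually (\<lambda>t. Df (?x t) B \<in> carrier F) (at 0 within K)"
          "Df (?x 0) B \<in> carrier F" "curve_deriv K F (\<lambda>t. Df (?x t) B) (Df x (y # B))"
          using x by (auto intro!: evDf f.tower_closed f.deriv_tower_line y simp: x0)
      qed fact
      moreover have "replace_one (Df x) (\<lambda>B. Df x (y # B)) P =
          map (map (Df x)) (replace_one (\<lambda>B. B) (\<lambda>B. y # B) P)"
        by (simp add: map_replace_one)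
      ultimately show ?thesis
        by (simp add: x0 T_def[abs_def] extend_partition_def o_def)
    qed
    have deriv: "curve_deriv K H (\<lambda>t. vsum H (map (\<lambda>P. T (?x t) P) (partitions ys)))
        (vsum H (map (\<lambda>P. vsum H (map (T x) (extend_partition y P))) (partitions ys)))"
    proof (rule g.F.curve_deriv_vsum[OF P])
      fix P assume P: "P \<in> set (partitions ys)"
      show "eventually (\<lambda>t. T (?x t) P \<in> carrier H) (at 0 within K)"
        using evU by (rule eventually_mono) (use Tcl[OF P] ys in auto)
      show "T (?x 0) P \<in> carrier H" using Tcl[OF P] ys x x0 by auto
    qed
    have eq: "vsum H (map (T x) (partitions (y # ys))) =
        vsum H (map (\<lambda>P. vsum H (map (T x) (extend_partition y P))) (partitions ys))"
    proof -
      have cl: "set xs \<subseteq> carrier H"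
        if xs: "xs \<in> set (map (\<lambda>P. map (T x) (extend_partition y P)) (partitions ys))" for xs
      proof -
        obtain P where P: "P \<in> set (partitions ys)" "xs = map (T x) (extend_partition y P)"
          using xs by auto
        then have "Q \<in> set (partitions (y # ys))" if "Q \<in> set (extend_partition y P)" for Q
          using that by auto
        from Tcl[OF this, of _ x] show "set xs \<subseteq> carrier H" using P(2) x y ys by auto
      qed
      have "map (T x) (partitions (y # ys)) = concat (map (\<lambda>P. map (T x) (extend_partition y P)) (partitions ys))"
        by (simp add: map_concat o_def)
      then show ?thesis
        using g.F.vsum_concat[of "map (\<lambda>P. map (T x) (extend_partition y P)) (partitions ys)", OF cl]
        by (simp add: o_def)
    qed
    show "has_dir_deriv K E H (\<lambda>x. vsum H (map (T x) (partitions ys))) y x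
        (vsum H (map (T x) (partitions (y # ys))))"
      unfolding eq f.E.has_dir_deriv_eq_curve_deriv[OF xc y] by (rule deriv)
  qed
  then show ?thesis
    unfolding T_def by (intro tower.intro tower_axioms.intro f.open_dom f.E.lcs_axioms g.F.hausdorff_lcs_axioms)
qed

lemma C_map_compose_enat:
  assumes "lcs K E" "hausdorff_lcs K F" "hausdorff_lcs K H"
    and U: "openin (vtop E) U" and V: "openin (vtop F) V" and into: "f ` U \<subseteq> V"
    and f: "C_map K (enat r) E F U f" and g: "C_map K (enat r) F H V g"
  shows "C_map K (enat r) E H U (g \<circ> f)"
proof -
  have F: "lcs K F" using assms(2) by (simp add: hausdorff_lcs_def)
  define Df Dg where "Df = (\<lambda>x ys. iter_deriv K E F f ys x)" and "Dg = (\<lambda>x ys. iter_deriv K F H g ys x)"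
  define Dgf where "Dgf = (\<lambda>x ys. vsum H (map (\<lambda>P. Dg (Df x []) (map (Df x) P)) (partitions ys)))"
  have f': "tower K E F r U Df" unfolding Df_def by (rule C_map_imp_tower) fact+
  have g': "tower K F H r V Dg" unfolding Dg_def by (rule C_map_imp_tower) fact+
  have "Df x [] \<in> V" if "x \<in> U" for x using into that by (auto simp: Df_def)
  from tower_compose[OF f' g' this] have tower: "tower K E H r U Dgf" unfolding Dgf_def .
  interpret H: hausdorff_lcs K H by fact
  have "g (f x) \<in> carrier H" if "x \<in> U" for x
    using g into that openin_subset[OF V] unfolding C_map_def continuous_map_def
    by (auto simp: H.topspace_vtop)
  then show ?thesis by (intro tower.tower_C_map[OF tower]) (auto simp: Dgf_def Df_def Dg_def)
qed

lemma C_map_compose: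
  assumes "lcs K E" "hausdorff_lcs K F" "hausdorff_lcs K H"
    and "openin (vtop E) U" and "openin (vtop F) V" and "f ` U \<subseteq> V"
    and "C_map K r E F U f" and "C_map K r F H V g"
  shows "C_map K r E H U (g \<circ> f)"
  using assms C_map_compose_enat[OF assms(1-6)]
  by (cases r) (auto simp: C_map_infinity_iff)

section \<open>Products, linear maps and localization\<close>

lemma prod_tvs_simps [simp]:
  "carrier (prod_tvs E F) = carrier E \<times> carrier F"
  "\<zero>\<^bsub>prod_tvs E F\<^esub> = (\<zero>\<^bsub>E\<^esub>, \<zero>\<^bsub>F\<^esub>)"
  "p \<oplus>\<^bsub>prod_tvs E F\<^esub> q = (fst p \<oplus>\<^bsub>E\<^esub> fst q, snd p \<oplus>\<^bsub>F\<^esub> snd q)"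
  "c \<odot>\<^bsub>prod_tvs E F\<^esub> p = (c \<odot>\<^bsub>E\<^esub> fst p, c \<odot>\<^bsub>F\<^esub> snd p)"
  "vtop (prod_tvs E F) = prod_topology (vtop E) (vtop F)"
  by (simp_all add: prod_tvs_def case_prod_unfold)

lemma limitin_prod_iff:
  "limitin (prod_topology S T) f l A \<longleftrightarrow>
     limitin S (\<lambda>a. fst (f a)) (fst l) A \<and> limitin T (\<lambda>a. snd (f a)) (snd l) A"
  by (simp add: limitin_pairwise o_def)

lemma convex_in_times:
  "convex_in E C \<Longrightarrow> convex_in F D \<Longrightarrow> convex_in (prod_tvs E F) (C \<times> D)"
  unfolding convex_in_def by auto

lemma lcs_prod:
  assumes "lcs K E" "lcs K F"
  shows "lcs K (prod_tvs E F)"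
proof -
  interpret E: lcs K E by fact
  interpret F: lcs K F by fact
  let ?P = "prod_tvs E F"
  have "abelian_group ?P"
  proof (rule abelian_groupI)
    fix x assume "x \<in> carrier ?P"
    then show "\<exists>y\<in>carrier ?P. y \<oplus>\<^bsub>?P\<^esub> x = \<zero>\<^bsub>?P\<^esub>"
      by (intro bexI[of _ "(\<ominus>\<^bsub>E\<^esub> fst x, \<ominus>\<^bsub>F\<^esub> snd x)"]) (auto simp: E.l_neg F.l_neg)
  qed (auto simp: E.a_ac F.a_ac)
  then have mod: "module (scalar_field K) ?P"
    by (intro moduleI[OF E.R.is_cring])
      (auto simp: E.scale_add_left F.scale_add_left E.scale_add_right F.scale_add_right E.scale_scale F.scale_scale)
  have "continuous_map (prod_topology (vtop ?P) (vtop ?P)) (vtop ?P) (\<lambda>(x, y). x \<oplus>\<^bsub>?P\<^esub> y)"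
    unfolding continuous_map_atin
  proof
    fix p assume "p \<in> topspace (prod_topology (vtop ?P) (vtop ?P))"
    from limitin_ident_atin[OF this]
    show "limitin (vtop ?P) (\<lambda>(x, y). x \<oplus>\<^bsub>?P\<^esub> y) (case p of (x, y) \<Rightarrow> x \<oplus>\<^bsub>?P\<^esub> y)
        (atin (prod_topology (vtop ?P) (vtop ?P)) p)"
      by (auto simp: limitin_prod_iff case_prod_unfold intro!: E.lim_add F.lim_add)
  qed
  moreover have "continuous_map (prod_topology (top_of_set K) (vtop ?P)) (vtop ?P) (\<lambda>(c, x). c \<odot>\<^bsub>?P\<^esub> x)"
    unfolding continuous_map_atin
  proof
    fix p assume p: "p \<in> topspace (prod_topology (top_of_set K) (vtop ?P))"
    from limitin_ident_atin[OF p] p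
    show "limitin (vtop ?P) (\<lambda>(c, x). c \<odot>\<^bsub>?P\<^esub> x) (case p of (c, x) \<Rightarrow> c \<odot>\<^bsub>?P\<^esub> x)
        (atin (prod_topology (top_of_set K) (vtop ?P)) p)"
      by (auto simp: limitin_prod_iff case_prod_unfold limitin_subtopology intro!: E.lim_scale F.lim_scale)
  qed
  ultimately have "topological_vector_space K ?P"
    using mod by (simp add: topological_vector_space_def)
  moreover have "\<exists>C O'. convex_in ?P C \<and> openin (vtop ?P) O' \<and> \<zero>\<^bsub>?P\<^esub> \<in> O' \<and> O' \<subseteq> C \<and> C \<subseteq> W"
    if W: "openin (vtop ?P) W" "\<zero>\<^bsub>?P\<^esub> \<in> W" for W
  proof -
    have W': "openin (prod_topology (vtop E) (vtop F)) W" "(\<zero>\<^bsub>E\<^esub>, \<zero>\<^bsub>F\<^esub>) \<in> W"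
      using W by simp_all
    obtain U V where UV: "openin (vtop E) U" "openin (vtop F) V" "\<zero>\<^bsub>E\<^esub> \<in> U" "\<zero>\<^bsub>F\<^esub> \<in> V" "U \<times> V \<subseteq> W"
      using W'(1)[unfolded openin_prod_topology_alt, rule_format, OF W'(2)] by (elim exE conjE)
    obtain C N where C: "convex_in E C" "openin (vtop E) N" "\<zero>\<^bsub>E\<^esub> \<in> N" "N \<subseteq> C" "C \<subseteq> U"
      using E.nhd_convex[OF UV(1,3)] .
    obtain D M where D: "convex_in F D" "openin (vtop F) M" "\<zero>\<^bsub>F\<^esub> \<in> M" "M \<subseteq> D" "D \<subseteq> V"
      using F.nhd_convex[OF UV(2,4)] .
    show ?thesis
      using C D UV(5) convex_in_times[OF C(1) D(1)]
      by (intro exI[of _ "C \<times> D"] exI[of _ "N \<times> M"]) (auto simp: openin_prod_Times_iff)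
  qed
  ultimately show ?thesis
    by (intro lcs.intro E.ground) (simp add: locally_convex_space_def)
qed

lemma hausdorff_lcs_prod:
  assumes "hausdorff_lcs K E" "hausdorff_lcs K F"
  shows "hausdorff_lcs K (prod_tvs E F)"
proof -
  interpret E: hausdorff_lcs K E by fact
  interpret F: hausdorff_lcs K F by fact
  show ?thesis
    using lcs_prod[OF E.lcs_axioms F.lcs_axioms] E.Hausdorff F.Hausdorff
    by (simp add: hausdorff_lcs_def hausdorff_lcs_axioms_def Hausdorff_space_prod_topology)
qed

lemma prod_tvs_minus:
  assumes "lcs K E" "lcs K F" "p \<in> carrier (prod_tvs E F)" "q \<in> carrier (prod_tvs E F)"
  shows "p \<ominus>\<^bsub>prod_tvs E F\<^esub> q = (fst p \<ominus>\<^bsub>E\<^esub> fst q, snd p \<ominus>\<^bsub>F\<^esub> snd q)"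
proof -
  interpret E: lcs K E by fact
  interpret F: lcs K F by fact
  interpret P: lcs K "prod_tvs E F" by (rule lcs_prod) fact+
  have "p \<ominus>\<^bsub>prod_tvs E F\<^esub> q = p \<oplus>\<^bsub>prod_tvs E F\<^esub> (-1) \<odot>\<^bsub>prod_tvs E F\<^esub> q"
    using assms P.scale_neg_one[of q] by (simp only: P.minus_eq)
  also have "\<dots> = (fst p \<ominus>\<^bsub>E\<^esub> fst q, snd p \<ominus>\<^bsub>F\<^esub> snd q)"
    using assms(3,4) by (auto simp: E.scale_neg_one F.scale_neg_one E.minus_eq F.minus_eq)
  finally show ?thesis .
qed

lemma has_dir_deriv_pair:
  assumes E: "lcs K E" and F: "lcs K F" and H: "lcs K H"
    and U: "openin (vtop E) U" "x \<in> U" "y \<in> carrier E" "\<And>x. x \<in> U \<Longrightarrow> f x \<in> carrier F \<and> g x \<in> carrier H"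
  shows "has_dir_deriv K E (prod_tvs F H) (\<lambda>x. (f x, g x)) y x d \<longleftrightarrow>
     has_dir_deriv K E F f y x (fst d) \<and> has_dir_deriv K E H g y x (snd d)"
proof -
  interpret E: lcs K E by fact
  have "has_dir_deriv K E (prod_tvs F H) (\<lambda>x. (f x, g x)) y x d \<longleftrightarrow>
     limitin (vtop (prod_tvs F H)) (\<lambda>t. (inverse t \<odot>\<^bsub>F\<^esub> (f (x \<oplus>\<^bsub>E\<^esub> (t \<odot>\<^bsub>E\<^esub> y)) \<ominus>\<^bsub>F\<^esub> f x),
        inverse t \<odot>\<^bsub>H\<^esub> (g (x \<oplus>\<^bsub>E\<^esub> (t \<odot>\<^bsub>E\<^esub> y)) \<ominus>\<^bsub>H\<^esub> g x))) d (at 0 within K)"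
    unfolding has_dir_deriv_def
    by (rule limitin_cong_eventually, rule eventually_mono[OF E.line_in_open[OF U(1-3)]])
      (use U prod_tvs_minus[OF F H] in auto)
  then show ?thesis by (simp add: limitin_prod_iff has_dir_deriv_def)
qed

lemma tower_pair:
  assumes f: "tower K E F r U Df" and g: "tower K E H r U Dg"
  shows "tower K E (prod_tvs F H) r U (\<lambda>x ys. (Df x ys, Dg x ys))"
proof -
  interpret f: tower K E F r U Df by fact
  interpret g: tower K E H r U Dg by fact
  have "deriv_tower K r E (prod_tvs F H) U (\<lambda>x ys. (Df x ys, Dg x ys))"
    unfolding deriv_tower_def
  proof (intro conjI allI impI ballI)
    fix k assume "k \<le> r"
    then show "jointly_continuous E (prod_tvs F H) U k (\<lambda>x ys. (Df x ys, Dg x ys))"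
      using f.tower g.tower
      by (simp add: deriv_tower_def continuous_map_pairwise o_def case_prod_unfold)
  next
    fix x y ys assume "x \<in> U" "y \<in> carrier E" "set ys \<subseteq> carrier E \<and> length ys < r"
    then show "has_dir_deriv K E (prod_tvs F H) (\<lambda>x. (Df x ys, Dg x ys)) y x (Df x (y # ys), Dg x (y # ys))"
      by (subst has_dir_deriv_pair[OF f.E.lcs_axioms f.F.lcs_axioms g.F.lcs_axioms f.open_dom])
        (auto intro: f.tower_closed g.tower_closed f.tower_deriv g.tower_deriv)
  qed
  then show ?thesis
    by (intro tower.intro tower_axioms.intro f.open_dom f.E.lcs_axioms hausdorff_lcs_prod
        f.F.hausdorff_lcs_axioms g.F.hausdorff_lcs_axioms)
qed

lemma C_map_pair:
  assumes E: "lcs K E" and F: "hausdorff_lcs K F" and H: "hausdorff_lcs K H"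
    and U: "openin (vtop E) U" and f: "C_map K r E F U f" and g: "C_map K r E H U g"
  shows "C_map K r E (prod_tvs F H) U (\<lambda>x. (f x, g x))"
proof -
  have "C_map K (enat n) E (prod_tvs F H) U (\<lambda>x. (f x, g x))"
    if "C_map K (enat n) E F U f" "C_map K (enat n) E H U g" for n
    using tower.tower_C_map[OF tower_pair[OF C_map_imp_tower[OF E F U that(1)] C_map_imp_tower[OF E H U that(2)]]]
    by simp
  with f g show ?thesis by (cases r) (auto simp: C_map_infinity_iff)
qed

lemma tower_linear_map:
  assumes E: "lcs K E" and F: "hausdorff_lcs K F" and L: "continuous_linear K E F L"
    and U: "openin (vtop E) U"
  shows "tower K E F r U (\<lambda>x ys. case ys of [] \<Rightarrow> L x | y # zs \<Rightarrow> (if zs = [] then L y else \<zero>\<^bsub>F\<^esub>))"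
    (is "tower _ _ _ _ _ ?D")
proof -
  interpret E: lcs K E by fact
  interpret F: hausdorff_lcs K F by fact
  have Lc: "L x \<in> carrier F" if "x \<in> carrier E" for x
    using L that by (auto simp: continuous_linear_def)
  have Llim: "limitin (vtop F) (\<lambda>a. L (X a)) (L x) A" if "limitin (vtop E) X x A" for X x and A :: "'c filter"
    using continuous_map_limit[OF _ that, of "vtop F" L] L by (simp add: continuous_linear_def o_def)
  have "deriv_tower K r E F U ?D"
    unfolding deriv_tower_def
  proof (intro conjI allI impI ballI)
    fix k assume "k \<le> r"
    show "jointly_continuous E F U k ?D"
    proof (rule continuous_map_jointlyI)
      show "U \<subseteq> topspace (vtop E)" using openin_subset[OF U] .
      fix A :: "('a \<times> (nat \<Rightarrow> 'a)) filter" and X x \<eta>s ys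
      assume "limitin (vtop E) X x A" "list_all2 (\<lambda>\<eta> y. limitin (vtop E) \<eta> y A) \<eta>s ys"
      moreover from this(2) have "length (tl \<eta>s) = length (tl ys)" by (simp add: list_all2_lengthD)
      then have "tl \<eta>s = [] \<longleftrightarrow> tl ys = []" by (metis length_0_conv)
      ultimately show "limitin (vtop F) (\<lambda>a. ?D (X a) (map (\<lambda>\<eta>. \<eta> a) \<eta>s)) (?D x ys) A"
        by (cases ys) (auto simp: list_all2_Cons2 intro: Llim)
    qed
  next
    fix x y ys assume xy: "x \<in> U" "y \<in> carrier E" "set ys \<subseteq> carrier E \<and> length ys < r"
    have x: "x \<in> carrier E" using openin_subset[OF U] xy by auto
    show "has_dir_deriv K E F (\<lambda>x. ?D x ys) y x (?D x (y # ys))"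
    proof (cases ys)
      case Nil
      have "limitin (vtop F) (\<lambda>t::complex. L y) (L y) (at 0 within K)"
        using Lc xy by simp
      then have "has_dir_deriv K E F L y x (L y)"
        unfolding has_dir_deriv_def
      proof (rule limitin_transform_eventually[rotated, OF _ eventually_mono[OF E.eventually_scalar]])
        fix t assume t: "t \<in> K \<and> t \<noteq> 0"
        have "L (x \<oplus>\<^bsub>E\<^esub> t \<odot>\<^bsub>E\<^esub> y) = L x \<oplus>\<^bsub>F\<^esub> t \<odot>\<^bsub>F\<^esub> L y"
          using L t x xy by (auto simp: continuous_linear_def)
        then show "L y = inverse t \<odot>\<^bsub>F\<^esub> (L (x \<oplus>\<^bsub>E\<^esub> t \<odot>\<^bsub>E\<^esub> y) \<ominus>\<^bsub>F\<^esub> L x)"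
          using t Lc[OF x] Lc[OF xy(2)] by (simp add: F.scale_scale)
      qed
      then show ?thesis using Nil by simp
    next
      case (Cons z zs)
      then have "?D x ys = ?D x' ys" "?D x ys \<in> carrier F" for x x'
        using Lc xy by auto
      moreover have "limitin (vtop F) (\<lambda>t::complex. \<zero>\<^bsub>F\<^esub>) \<zero>\<^bsub>F\<^esub> (at 0 within K)" by simp
      then have "has_dir_deriv K E F (\<lambda>x. c) y x \<zero>\<^bsub>F\<^esub>" if "c \<in> carrier F" for c
        unfolding has_dir_deriv_def
        by (rule limitin_transform_eventually[rotated, OF _ eventually_mono[OF E.eventually_scalar]]) (use that in auto)
      ultimately show ?thesis using Cons Lc xy by auto
    qed
  qed
  then show ?thesis
    by (intro tower.intro tower_axioms.intro U E F)
qed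

lemma C_map_linear:
  assumes "lcs K E" "hausdorff_lcs K F" "continuous_linear K E F L" "openin (vtop E) U"
  shows "C_map K r E F U L"
  using tower.tower_C_map[OF tower_linear_map[OF assms]]
  by (cases r) (simp_all add: C_map_infinity_iff)

lemma continuous_linear_ident: "continuous_linear K E E (\<lambda>x. x)"
  using continuous_map_id[of "vtop E"] by (simp add: continuous_linear_def id_def)

lemma continuous_linear_fst: "continuous_linear K (prod_tvs E F) E fst"
  by (auto simp: continuous_linear_def continuous_map_fst)

lemma continuous_linear_snd: "continuous_linear K (prod_tvs E F) F snd"
  by (auto simp: continuous_linear_def continuous_map_snd)

lemma tower_const:
  assumes E: "lcs K E" and F: "hausdorff_lcs K F" and U: "openin (vtop E) U" and c: "c \<in> carrier F"
  shows "tower K E F r U (\<lambda>x ys. if ys = [] then c else \<zero>\<^bsub>F\<^esub>)" (is "tower _ _ _ _ _ ?D")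
proof -
  interpret E: lcs K E by fact
  interpret F: hausdorff_lcs K F by fact
  have "deriv_tower K r E F U ?D"
    unfolding deriv_tower_def
  proof (intro conjI allI impI ballI)
    fix k assume "k \<le> r"
    show "jointly_continuous E F U k ?D"
      using c by (simp add: case_prod_unfold)
  next
    fix x y ys
    have "limitin (vtop F) (\<lambda>t::complex. \<zero>\<^bsub>F\<^esub>) \<zero>\<^bsub>F\<^esub> (at 0 within K)" by simp
    then have "has_dir_deriv K E F (\<lambda>x. c) y x \<zero>\<^bsub>F\<^esub>" if "c \<in> carrier F" for c
      unfolding has_dir_deriv_def
      by (rule limitin_transform_eventually[rotated, OF _ eventually_mono[OF E.eventually_scalar]]) (use that in auto)
    then show "has_dir_deriv K E F (\<lambda>x. ?D x ys) y x (?D x (y # ys))" using c by simp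
  qed
  then show ?thesis
    by (intro tower.intro tower_axioms.intro U E F)
qed

lemma C_map_const:
  assumes "lcs K E" "hausdorff_lcs K F" "openin (vtop E) U" "c \<in> carrier F"
  shows "C_map K r E F U (\<lambda>x. c)"
  using tower.tower_C_map[OF tower_const[OF assms]]
  by (cases r) (simp_all add: C_map_infinity_iff)

lemma C_map_subset:
  assumes E: "hausdorff_lcs K E" and F: "hausdorff_lcs K F" and U: "openin (vtop E) U"
    and V: "openin (vtop E) V" "V \<subseteq> U" and f: "C_map K r E F U f"
  shows "C_map K r E F V f"
proof -
  have E': "lcs K E" using E by (simp add: hausdorff_lcs_def)
  show ?thesis
    using C_map_compose[OF E' E F V(1) U _ C_map_linear[OF E' E continuous_linear_ident V(1)] f] V(2)
    by (simp add: o_def)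
qed

text \<open>The iterated derivatives of \<open>f\<close> do not depend on the domain, so they form a single family, whose
  properties can be checked locally.\<close>

lemma C_map_local:
  assumes E: "lcs K E" and F: "hausdorff_lcs K F" and U: "openin (vtop E) U"
    and loc: "\<And>x. x \<in> U \<Longrightarrow> \<exists>V. openin (vtop E) V \<and> x \<in> V \<and> C_map K r E F V f"
  shows "C_map K r E F U f"
proof -
  have *: "C_map K (enat n) E F U f"
    if loc: "\<And>x. x \<in> U \<Longrightarrow> \<exists>V. openin (vtop E) V \<and> x \<in> V \<and> C_map K (enat n) E F V f" for n
  proof -
    let ?D = "\<lambda>x ys. iter_deriv K E F f ys x"
    have tw: "\<exists>V. x \<in> V \<and> tower K E F n V ?D" if "x \<in> U" for x
      using loc[OF that] C_map_imp_tower[OF E F] by blast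
    have "deriv_tower K n E F U ?D"
      unfolding deriv_tower_def
    proof (intro conjI allI impI ballI)
      fix k assume k: "k \<le> n"
      show "jointly_continuous E F U k ?D"
      proof (rule continuous_map_jointlyI)
        show "U \<subseteq> topspace (vtop E)" using openin_subset[OF U] .
        fix A :: "('a \<times> (nat \<Rightarrow> 'a)) filter" and X x \<eta>s ys
        assume *: "limitin (vtop E) X x A" "x \<in> U" "list_all2 (\<lambda>\<eta> y. limitin (vtop E) \<eta> y A) \<eta>s ys" "length ys = k"
        with tw obtain V where "x \<in> V" "tower K E F n V ?D" by blast
        then show "limitin (vtop F) (\<lambda>a. ?D (X a) (map (\<lambda>\<eta>. \<eta> a) \<eta>s)) (?D x ys) A"
          using tower.tower_lim[of K E F n V ?D X x A \<eta>s ys] * k by simp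
      qed
    next
      fix x y ys assume *: "x \<in> U" "y \<in> carrier E" "set ys \<subseteq> carrier E \<and> length ys < n"
      with tw obtain V where "x \<in> V" "tower K E F n V ?D" by blast
      then show "has_dir_deriv K E F (\<lambda>x. ?D x ys) y x (?D x (y # ys))"
        using tower.tower_deriv[of K E F n V ?D x y ys] * by simp
    qed
    then have "tower K E F n U ?D" by (intro tower.intro tower_axioms.intro U E F)
    from tower.tower_C_map[OF this] show ?thesis by simp
  qed
  show ?thesis
  proof (cases r)
    case (enat n)
    then show ?thesis using * loc by simp
  next
    case infinity
    have "C_map K (enat n) E F U f" for n
    proof (rule *)
      fix x assume "x \<in> U"
      from loc[OF this] show "\<exists>V. openin (vtop E) V \<and> x \<in> V \<and> C_map K (enat n) E F V f"
        unfolding infinity C_map_infinity_iff by blast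
    qed
    then show ?thesis unfolding infinity C_map_infinity_iff by blast
  qed
qed

lemma C_map_cong:
  assumes E: "lcs K E" and F: "hausdorff_lcs K F" and U: "openin (vtop E) U"
    and eq: "\<And>x. x \<in> U \<Longrightarrow> f x = g x" and f: "C_map K r E F U f"
  shows "C_map K r E F U g"
proof -
  have "C_map K (enat n) E F U g" if "C_map K (enat n) E F U f" for n
    using tower.tower_C_map[OF C_map_imp_tower[OF E F U that], of g] eq by simp
  with f show ?thesis by (cases r) (auto simp: C_map_infinity_iff)
qed

section \<open>The derivative as a function of point and direction\<close>

text \<open>The terms in the derivative of \<open>(x, y) \<mapsto> D x [y]\<close> in directions \<open>(v\<^sub>i, w\<^sub>i)\<close> in which some \<open>w\<^sub>i\<close>
  has been substituted for \<open>y\<close>. By linearity in \<open>y\<close> this happens at most once, and all other pairs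
  contribute their first component.\<close>

primrec velocity_slots :: "('v \<times> 'v) list \<Rightarrow> 'v list list" where
  "velocity_slots [] = []"
| "velocity_slots (p # ps) = (map fst ps @ [snd p]) # map ((#) (fst p)) (velocity_slots ps)"

lemma velocity_slots_map: "velocity_slots (map (map_prod h h) ps) = map (map h) (velocity_slots ps)"
  by (induction ps) (auto simp: o_def)

lemma velocity_slots_bounds:
  "s \<in> set (velocity_slots ps) \<Longrightarrow> length s = length ps \<and> set s \<subseteq> fst ` set ps \<union> snd ` set ps"
proof (induction ps arbitrary: s)
  case (Cons p ps)
  then consider "s = map fst ps @ [snd p]" | s' where "s = fst p # s'" "s' \<in> set (velocity_slots ps)" by auto
  then show ?case
  proof cases
    case 2
    from Cons.IH[OF 2(2)] show ?thesis using 2(1) by auto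
  qed auto
qed simp

text \<open>The first summand collects the differentiations with respect to \<open>x\<close> only. A direction \<open>(v, w)\<close> turns
  it into itself with \<open>v\<close> added plus the term with \<open>w\<close> in place of \<open>y\<close>; the other terms depend on \<open>x\<close>
  alone.\<close>

lemma tower_dir_deriv:
  assumes "hausdorff_lcs K E" and "tower K E F (Suc r) U D"
  shows "tower K (prod_tvs E E) F r (U \<times> carrier E)
     (\<lambda>p ps. D (fst p) (map fst ps @ [snd p]) \<oplus>\<^bsub>F\<^esub> vsum F (map (D (fst p)) (velocity_slots ps)))"
    (is "tower _ _ _ _ _ ?D")
proof -
  interpret tower K E F "Suc r" U D by fact
  let ?P = "prod_tvs E E"
  have opn: "openin (vtop ?P) (U \<times> carrier E)"
    using open_dom openin_topspace[of "vtop E"] by (simp add: openin_prod_Times_iff)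
  have slots: "set s \<subseteq> carrier E" "length s = length ps"
    if "s \<in> set (velocity_slots ps)" "set ps \<subseteq> carrier ?P" for s ps
  proof -
    have "fst ` set ps \<union> snd ` set ps \<subseteq> carrier E" using that(2) by auto
    then show "set s \<subseteq> carrier E" "length s = length ps"
      using velocity_slots_bounds[OF that(1)] by blast+
  qed
  have "deriv_tower K r ?P F (U \<times> carrier E) ?D"
    unfolding deriv_tower_def
  proof (intro conjI allI impI ballI)
    fix k assume k: "k \<le> r"
    show "jointly_continuous ?P F (U \<times> carrier E) k ?D"
    proof (rule continuous_map_jointlyI)
      show "U \<times> carrier E \<subseteq> topspace (vtop ?P)" using openin_subset[OF opn] .
      fix A :: "(('a \<times> 'a) \<times> (nat \<Rightarrow> 'a \<times> 'a)) filter" and X x \<eta>s ys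
      assume X: "limitin (vtop ?P) X x A" and x: "x \<in> U \<times> carrier E"
        and \<eta>s: "list_all2 (\<lambda>\<eta> y. limitin (vtop ?P) \<eta> y A) \<eta>s ys" and len: "length ys = k"
      show "limitin (vtop F) (\<lambda>a. ?D (X a) (map (\<lambda>\<eta>. \<eta> a) \<eta>s)) (?D x ys) A"
      proof -
        define q where "q = map (\<lambda>(\<eta>, y). ((\<lambda>a. fst (\<eta> a), fst y), (\<lambda>a. snd (\<eta> a), snd y))) (zip \<eta>s ys)"
        have len': "length \<eta>s = length ys" using \<eta>s by (rule list_all2_lengthD)
        have q: "map (\<lambda>\<eta>. \<eta> a) \<eta>s = map (map_prod (\<lambda>p. fst p a) (\<lambda>p. fst p a)) q" "ys = map (map_prod snd snd) q" for a
          using len' by (auto simp: q_def intro!: nth_equalityI)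
        have qlim: "limitin (vtop E) (fst p) (snd p) A" if "p \<in> fst ` set q \<union> snd ` set q" for p
          using \<eta>s that by (force simp: q_def list_all2_conv_all_nth in_set_zip limitin_prod_iff)
        have L: "limitin (vtop F) (\<lambda>a. D (fst (X a)) (map (\<lambda>p. fst p a) ps)) (D (fst x) (map snd ps)) A"
          if "\<And>p. p \<in> set ps \<Longrightarrow> limitin (vtop E) (fst p) (snd p) A" "length ps \<le> Suc r"
          for ps :: "((('a \<times> 'a) \<times> (nat \<Rightarrow> 'a \<times> 'a) \<Rightarrow> 'a) \<times> 'a) list"
        proof -
          have "list_all2 (\<lambda>\<eta> y. limitin (vtop E) \<eta> y A) (map fst ps) (map snd ps)"
            using that(1) by (simp add: list_all2_map1 list_all2_map2 list_all2_same)
          from tower_lim[OF _ _ this, of "\<lambda>a. fst (X a)" "fst x"] show ?thesis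
            using X x that(2) by (auto simp: o_def limitin_prod_iff)
        qed
        have lq: "length q \<le> r" using len k len' by (simp add: q_def)
        have "limitin (vtop F) (\<lambda>a. D (fst (X a)) (map (\<lambda>p. fst p a) (map fst q @ [(\<lambda>a. snd (X a), snd x)])))
            (D (fst x) (map snd (map fst q @ [(\<lambda>a. snd (X a), snd x)]))) A"
          using qlim X lq by (intro L) (auto simp: limitin_prod_iff)
        moreover have "limitin (vtop F) (\<lambda>a. vsum F (map (\<lambda>s. D (fst (X a)) (map (\<lambda>p. fst p a) s)) (velocity_slots q)))
            (vsum F (map (\<lambda>s. D (fst x) (map snd s)) (velocity_slots q))) A"
        proof (rule F.lim_vsum, rule L)
          fix s p assume "s \<in> set (velocity_slots q)" "p \<in> set s"
          then show "limitin (vtop E) (fst p) (snd p) A"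
            using velocity_slots_bounds[of s q] by (intro qlim) auto
        qed (use velocity_slots_bounds[of _ q] lq in auto)
        ultimately have "limitin (vtop F) (\<lambda>a. D (fst (X a)) (map (\<lambda>p. fst p a) (map fst q @ [(\<lambda>a. snd (X a), snd x)])) \<oplus>\<^bsub>F\<^esub>
             vsum F (map (\<lambda>s. D (fst (X a)) (map (\<lambda>p. fst p a) s)) (velocity_slots q)))
           (D (fst x) (map snd (map fst q @ [(\<lambda>a. snd (X a), snd x)])) \<oplus>\<^bsub>F\<^esub>
             vsum F (map (\<lambda>s. D (fst x) (map snd s)) (velocity_slots q))) A"
          by (rule F.lim_add)
        then show ?thesis
          unfolding q velocity_slots_map by (simp add: o_def)
      qed
    qed
  next
    fix p d ps
    assume p: "p \<in> U \<times> carrier E" and d: "d \<in> carrier ?P" and ps: "set ps \<subseteq> carrier ?P \<and> length ps < r"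
    obtain x y v w where pd: "p = (x, y)" "d = (v, w)" by fastforce
    let ?l = "map fst ps" and ?A = "at (0::complex) within K"
    have xy: "x \<in> U" "y \<in> carrier E" "v \<in> carrier E" "w \<in> carrier E" and xc: "x \<in> carrier E"
      using p d dom_carrier by (auto simp: pd)
    have l: "set ?l \<subseteq> carrier E" "length ?l < r" using ps by auto
    let ?x = "\<lambda>t. x \<oplus>\<^bsub>E\<^esub> t \<odot>\<^bsub>E\<^esub> v"
    have x0: "?x 0 = x" using xc xy by simp
    note evU = line_in_dom[OF xy(1,3)]
    have cl: "D x' zs \<in> carrier F" if "x' \<in> U" "set zs \<subseteq> carrier E" "length zs \<le> Suc r" for x' zs
      using that by (rule tower_closed)
    have evcl: "eventually (\<lambda>t. D (?x t) zs \<in> carrier F) ?A"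
      if "set zs \<subseteq> carrier E" "length zs \<le> Suc r" for zs
      using evU by (rule eventually_mono) (rule cl[OF _ that])
    have 1: "curve_deriv K F (\<lambda>t. D (?x t) (?l @ [y])) (D x (v # ?l @ [y]))"
      using l xy by (intro deriv_tower_line) auto
    have 2: "curve_deriv K F (\<lambda>t. t \<odot>\<^bsub>F\<^esub> D (?x t) (?l @ [w])) (D x (?l @ [w]))"
    proof -
      have "list_all2 (\<lambda>\<eta> y. limitin (vtop E) \<eta> y ?A) (map (\<lambda>z _. z) (?l @ [w])) (?l @ [w])"
        unfolding list_all2_map1 list_all2_same using l xy by auto
      from tower_lim[OF E.lim_line[OF xc xy(3)] xy(1) this]
      have "limitin (vtop F) (\<lambda>t. D (?x t) (?l @ [w])) (D x (?l @ [w])) ?A"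
        using l by (simp add: o_def)
      then show ?thesis
        unfolding curve_deriv_def
      proof (rule limitin_transform_eventually[rotated, OF _ eventually_mono])
        show "eventually (\<lambda>t. (t \<in> K \<and> t \<noteq> 0) \<and> D (?x t) (?l @ [w]) \<in> carrier F) ?A"
          using l xy by (intro eventually_conj E.eventually_scalar evcl) auto
        fix t assume "(t \<in> K \<and> t \<noteq> 0) \<and> D (?x t) (?l @ [w]) \<in> carrier F"
        moreover have "D (?x 0) (?l @ [w]) \<in> carrier F" unfolding x0 using l xy by (intro cl) auto
        ultimately show "D (?x t) (?l @ [w]) = inverse t \<odot>\<^bsub>F\<^esub>
            (t \<odot>\<^bsub>F\<^esub> D (?x t) (?l @ [w]) \<ominus>\<^bsub>F\<^esub> 0 \<odot>\<^bsub>F\<^esub> D (?x 0) (?l @ [w]))"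
          by (simp add: F.scale_scale)
      qed
    qed
    have 3: "curve_deriv K F (\<lambda>t. vsum F (map (\<lambda>s. D (?x t) s) (velocity_slots ps)))
        (vsum F (map (\<lambda>s. D x (v # s)) (velocity_slots ps)))"
      using slots ps xy x0 by (intro F.curve_deriv_vsum deriv_tower_line evcl) (auto intro!: cl)
    have scl: "vsum F (map (D x') (velocity_slots ps)) \<in> carrier F" if "x' \<in> U" for x'
      using slots ps that by (intro F.vsum_closed) (auto intro!: cl)
    have evs: "eventually (\<lambda>t. vsum F (map (D (?x t)) (velocity_slots ps)) \<in> carrier F) ?A"
      using evU by (rule eventually_mono) (rule scl)
    have evt: "eventually (\<lambda>t. t \<odot>\<^bsub>F\<^esub> D (?x t) (?l @ [w]) \<in> carrier F) ?A"
      by (rule eventually_mono[OF eventually_conj[OF E.eventually_scalar evcl[of "?l @ [w]"]]]) (use l xy in auto)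
    have cy: "D x (?l @ [y]) \<in> carrier F" "D x (?l @ [w]) \<in> carrier F" "D x (v # ?l @ [y]) \<in> carrier F"
      using l xy by (simp_all add: cl)
    \<comment> \<open>By linearity, \<open>D (?x t) (?l @ [y \<oplus> t \<odot> w])\<close> is the sum of the curves in \<open>1\<close> and \<open>2\<close>.\<close>
    have 12: "curve_deriv K F (\<lambda>t. D (?x t) (?l @ [y]) \<oplus>\<^bsub>F\<^esub> t \<odot>\<^bsub>F\<^esub> D (?x t) (?l @ [w]))
        (D x (v # ?l @ [y]) \<oplus>\<^bsub>F\<^esub> D x (?l @ [w]))"
      by (rule F.curve_deriv_add[OF 1 2 evcl _ evt]) (use l xy cy x0 in auto)
    have ev12: "eventually (\<lambda>t. D (?x t) (?l @ [y]) \<oplus>\<^bsub>F\<^esub> t \<odot>\<^bsub>F\<^esub> D (?x t) (?l @ [w]) \<in> carrier F) ?A"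
      by (rule eventually_mono[OF eventually_conj[OF evt evcl[of "?l @ [y]"]]]) (use l xy in auto)
    have "curve_deriv K F (\<lambda>t. (D (?x t) (?l @ [y]) \<oplus>\<^bsub>F\<^esub> t \<odot>\<^bsub>F\<^esub> D (?x t) (?l @ [w])) \<oplus>\<^bsub>F\<^esub>
          vsum F (map (D (?x t)) (velocity_slots ps)))
        ((D x (v # ?l @ [y]) \<oplus>\<^bsub>F\<^esub> D x (?l @ [w])) \<oplus>\<^bsub>F\<^esub> vsum F (map (\<lambda>s. D x (v # s)) (velocity_slots ps)))"
      by (rule F.curve_deriv_add[OF 12 3 ev12 _ evs]) (use scl[OF xy(1)] cy x0 in auto)
    also have "?this \<longleftrightarrow> curve_deriv K F (\<lambda>t. D (?x t) (?l @ [y \<oplus>\<^bsub>E\<^esub> t \<odot>\<^bsub>E\<^esub> w]) \<oplus>\<^bsub>F\<^esub>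
          vsum F (map (D (?x t)) (velocity_slots ps)))
        ((D x (v # ?l @ [y]) \<oplus>\<^bsub>F\<^esub> D x (?l @ [w])) \<oplus>\<^bsub>F\<^esub> vsum F (map (\<lambda>s. D x (v # s)) (velocity_slots ps)))"
    proof (rule F.curve_deriv_cong)
      have lin: "D x' (?l @ [y]) \<oplus>\<^bsub>F\<^esub> t \<odot>\<^bsub>F\<^esub> D x' (?l @ [w]) = D x' (?l @ [y \<oplus>\<^bsub>E\<^esub> t \<odot>\<^bsub>E\<^esub> w])"
        if "x' \<in> U" "t \<in> K" for x' t
        using tower_linear[of x' y t w ?l "[]"] l xy that by simp
      show "eventually (\<lambda>t. (D (?x t) (?l @ [y]) \<oplus>\<^bsub>F\<^esub> t \<odot>\<^bsub>F\<^esub> D (?x t) (?l @ [w])) \<oplus>\<^bsub>F\<^esub>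
          vsum F (map (D (?x t)) (velocity_slots ps)) =
          D (?x t) (?l @ [y \<oplus>\<^bsub>E\<^esub> t \<odot>\<^bsub>E\<^esub> w]) \<oplus>\<^bsub>F\<^esub> vsum F (map (D (?x t)) (velocity_slots ps))) ?A"
        by (rule eventually_mono[OF eventually_conj[OF E.eventually_scalar evU]]) (simp add: lin)
      show "(D (?x 0) (?l @ [y]) \<oplus>\<^bsub>F\<^esub> 0 \<odot>\<^bsub>F\<^esub> D (?x 0) (?l @ [w])) \<oplus>\<^bsub>F\<^esub>
          vsum F (map (D (?x 0)) (velocity_slots ps)) =
          D (?x 0) (?l @ [y \<oplus>\<^bsub>E\<^esub> 0 \<odot>\<^bsub>E\<^esub> w]) \<oplus>\<^bsub>F\<^esub> vsum F (map (D (?x 0)) (velocity_slots ps))"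
        unfolding x0 using lin[of x 0] xy by simp
    qed
    also have "(D x (v # ?l @ [y]) \<oplus>\<^bsub>F\<^esub> D x (?l @ [w])) \<oplus>\<^bsub>F\<^esub> vsum F (map (\<lambda>s. D x (v # s)) (velocity_slots ps))
        = ?D p (d # ps)"
    proof -
      have "vsum F (map (\<lambda>s. D x (v # s)) (velocity_slots ps)) \<in> carrier F"
      proof (rule F.vsum_closed, clarsimp)
        fix s assume "s \<in> set (velocity_slots ps)"
        with slots[of s ps] ps xy show "D x (v # s) \<in> carrier F" by (intro cl) simp_all
      qed
      then show ?thesis using cy by (simp add: pd o_def F.a_assoc)
    qed
    finally show "has_dir_deriv K ?P F (\<lambda>p. ?D p ps) d p (?D p (d # ps))"
      using xy xc
      by (subst lcs.has_dir_deriv_eq_curve_deriv[OF lcs_prod[OF E.lcs_axioms E.lcs_axioms]]) (auto simp: pd)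
  qed
  then show ?thesis
    by (intro tower.intro tower_axioms.intro opn lcs_prod E.lcs_axioms F.hausdorff_lcs_axioms)
qed

lemma C_map_dir_deriv:
  assumes E: "hausdorff_lcs K E" and F: "hausdorff_lcs K F" and U: "openin (vtop E) U"
    and f: "C_map K (enat (Suc r)) E F U f"
  shows "C_map K (enat r) (prod_tvs E E) F (U \<times> carrier E) (\<lambda>p. dir_deriv K E F f (snd p) (fst p))"
proof -
  interpret E: hausdorff_lcs K E by fact
  from C_map_imp_tower[OF E.lcs_axioms F U f]
  interpret tower K E F "Suc r" U "\<lambda>x ys. iter_deriv K E F f ys x" .
  show ?thesis
  proof (rule tower.tower_C_map[OF tower_dir_deriv[OF E tower_axioms]])
    fix p assume "p \<in> U \<times> carrier E"
    then have "iter_deriv K E F f [snd p] (fst p) \<in> carrier F"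
      by (intro tower_closed) auto
    then show "iter_deriv K E F f (map fst [] @ [snd p]) (fst p) \<oplus>\<^bsub>F\<^esub>
        vsum F (map (\<lambda>ys. iter_deriv K E F f ys (fst p)) (velocity_slots [])) = dir_deriv K E F f (snd p) (fst p)"
      by simp
  qed
qed

text \<open>The step by which regularity is gained. The further derivatives of \<open>f\<close> are those of its derivative
  \<open>h\<close> in directions of the form \<open>(v, 0)\<close>.\<close>

lemma C_map_Suc:
  assumes E: "hausdorff_lcs K E" and F: "hausdorff_lcs K F" and U: "openin (vtop E) U"
    and cont: "continuous_map (subtopology (vtop E) U) (vtop F) f"
    and der: "\<And>x y. x \<in> U \<Longrightarrow> y \<in> carrier E \<Longrightarrow> has_dir_deriv K E F f y x (h (x, y))"
    and h: "C_map K (enat r) (prod_tvs E E) F (U \<times> carrier E) h"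
  shows "C_map K (enat (Suc r)) E F U f"
proof -
  interpret E: hausdorff_lcs K E by fact
  interpret F: hausdorff_lcs K F by fact
  let ?P = "prod_tvs E E"
  have P: "lcs K ?P" by (intro lcs_prod E.lcs_axioms)
  have opn: "openin (vtop ?P) (U \<times> carrier E)"
    using U openin_topspace[of "vtop E"] by (simp add: openin_prod_Times_iff)
  define Dh where "Dh = (\<lambda>p ps. iter_deriv K ?P F h ps p)"
  have "tower K ?P F r (U \<times> carrier E) Dh"
    unfolding Dh_def by (rule C_map_imp_tower[OF P F opn h])
  then interpret h: tower K ?P F r "U \<times> carrier E" Dh .
  have Uc: "x \<in> carrier E" if "x \<in> U" for x using openin_subset[OF U] that by auto
  let ?e = "\<lambda>v. (v, \<zero>\<^bsub>E\<^esub>)"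
  \<comment> \<open>The last direction is the one in which \<open>f\<close> is differentiated first.\<close>
  let ?D = "\<lambda>x ys. if ys = [] then f x else Dh (x, last ys) (map ?e (butlast ys))"
  have "deriv_tower K (Suc r) E F U ?D"
    unfolding deriv_tower_def
  proof (intro conjI allI impI ballI)
    fix k assume k: "k \<le> Suc r"
    show "jointly_continuous E F U k ?D"
    proof (rule continuous_map_jointlyI)
      show "U \<subseteq> topspace (vtop E)" using openin_subset[OF U] .
      fix A :: "('a \<times> (nat \<Rightarrow> 'a)) filter" and X x \<eta>s ys
      assume X: "limitin (vtop E) X x A" "x \<in> U" "eventually (\<lambda>a. X a \<in> U) A"
        and \<eta>s: "list_all2 (\<lambda>\<eta> y. limitin (vtop E) \<eta> y A) \<eta>s ys" and len: "length ys = k"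
      have len': "length \<eta>s = length ys" using \<eta>s by (rule list_all2_lengthD)
      show "limitin (vtop F) (\<lambda>a. ?D (X a) (map (\<lambda>\<eta>. \<eta> a) \<eta>s)) (?D x ys) A"
      proof (cases ys rule: rev_cases)
        case Nil
        have "limitin (subtopology (vtop E) U) X x A" using X by (simp add: limitin_subtopology)
        from continuous_map_limit[OF cont this] show ?thesis using Nil len' by (simp add: o_def)
      next
        case (snoc zs y)
        then obtain \<eta>s' \<eta> where *: "\<eta>s = \<eta>s' @ [\<eta>]" "list_all2 (\<lambda>\<eta> y. limitin (vtop E) \<eta> y A) \<eta>s' zs"
            "limitin (vtop E) \<eta> y A"
          using \<eta>s by (auto simp: list_all2_append2 list_all2_Cons2)
        have "limitin (vtop F) (\<lambda>a. Dh (X a, \<eta> a) (map (\<lambda>\<eta>. \<eta> a) (map (\<lambda>\<eta> a. ?e (\<eta> a)) \<eta>s')))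
            (Dh (x, y) (map ?e zs)) A"
        proof (rule h.tower_lim)
          show "limitin (vtop ?P) (\<lambda>a. (X a, \<eta> a)) (x, y) A" using X * by (simp add: limitin_prod_iff)
          show "list_all2 (\<lambda>\<eta> y. limitin (vtop ?P) \<eta> y A) (map (\<lambda>\<eta> a. ?e (\<eta> a)) \<eta>s') (map ?e zs)"
            using *(2) by (auto simp: list_all2_map1 list_all2_map2 limitin_prod_iff elim!: list_all2_mono)
        qed (use X(2) E.lim_carrier(1)[OF *(3)] len snoc k in auto)
        then show ?thesis using snoc * by (simp add: o_def)
      qed
    qed
  next
    fix x y ys assume x: "x \<in> U" and y: "y \<in> carrier E" and ys: "set ys \<subseteq> carrier E \<and> length ys < Suc r"
    show "has_dir_deriv K E F (\<lambda>x. ?D x ys) y x (?D x (y # ys))"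
    proof (cases ys rule: rev_cases)
      case Nil
      then show ?thesis using der[OF x y] by (simp add: Dh_def)
    next
      case (snoc zs z)
      have z: "z \<in> carrier E" using snoc ys by auto
      have "has_dir_deriv K ?P F (\<lambda>p. Dh p (map ?e zs)) (?e y) (x, z) (Dh (x, z) (?e y # map ?e zs))"
        using x y z ys snoc by (intro h.tower_deriv) auto
      then have "curve_deriv K F (\<lambda>t. Dh ((x, z) \<oplus>\<^bsub>?P\<^esub> t \<odot>\<^bsub>?P\<^esub> ?e y) (map ?e zs)) (Dh (x, z) (?e y # map ?e zs))"
        using Uc[OF x] y z by (subst (asm) lcs.has_dir_deriv_eq_curve_deriv[OF P]) auto
      then have "curve_deriv K F (\<lambda>t. Dh (x \<oplus>\<^bsub>E\<^esub> t \<odot>\<^bsub>E\<^esub> y, z) (map ?e zs)) (Dh (x, z) (?e y # map ?e zs))"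
        by (subst F.curve_deriv_cong) (use z in \<open>auto intro!: eventually_mono[OF E.eventually_scalar]\<close>)
      then show ?thesis
        using Uc[OF x] y snoc by (simp add: E.has_dir_deriv_eq_curve_deriv)
    qed
  qed
  then have "tower K E F (Suc r) U ?D"
    by (intro tower.intro tower_axioms.intro U E.lcs_axioms F)
  from tower.tower_C_map[OF this] show ?thesis by simp
qed

lemma C_map_has_dir_deriv:
  assumes "lcs K E" "hausdorff_lcs K F" "openin (vtop E) V" "C_map K \<infinity> E F V f"
    and "x \<in> V" "y \<in> carrier E"
  shows "has_dir_deriv K E F f y x (dir_deriv K E F f y x)"
proof -
  have "C_map K (enat 1) E F V f" using assms(4) by (simp add: C_map_infinity_iff)
  from C_map_imp_tower[OF assms(1-3) this]
  interpret tower K E F 1 V "\<lambda>x ys. iter_deriv K E F f ys x" .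
  show ?thesis using tower_deriv[of x y "[]"] assms(5,6) by simp
qed

lemma C_map_dir_deriv_closed:
  assumes "lcs K E" "hausdorff_lcs K F" "openin (vtop E) V" "C_map K \<infinity> E F V f"
    and "x \<in> V" "y \<in> carrier E"
  shows "dir_deriv K E F f y x \<in> carrier F"
proof -
  interpret F: hausdorff_lcs K F by fact
  show ?thesis using F.lim_carrier(1)[OF C_map_has_dir_deriv[OF assms, unfolded has_dir_deriv_def]] .
qed

lemma C_map_closed:
  assumes "hausdorff_lcs K E" "hausdorff_lcs K F" "openin (vtop E) V" "C_map K r E F V f" "x \<in> V"
  shows "f x \<in> carrier F"
proof -
  have "continuous_map (subtopology (vtop E) V) (vtop F) f" using assms(4) by (simp add: C_map_def)
  moreover have "x \<in> topspace (subtopology (vtop E) V)" using assms(3,5) openin_subset by fastforce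
  ultimately have "f x \<in> topspace (vtop F)" by (auto simp: continuous_map_def Pi_iff)
  then show ?thesis using lcs.topspace_vtop[of K F] assms(2) by (simp add: hausdorff_lcs_def)
qed

text \<open>The chain rule along an arbitrary differentiable curve: this is more than the existence of directional
  derivatives, which only test straight lines.\<close>

lemma C_map_curve:
  assumes "lcs K E" "hausdorff_lcs K F" "openin (vtop E) V" "C_map K \<infinity> E F V f"
    and c: "c 0 \<in> V" "eventually (\<lambda>t. c t \<in> carrier E) (at 0 within K)" "curve_deriv K E c c'"
  shows "curve_deriv K F (\<lambda>t. f (c t)) (dir_deriv K E F f c' (c 0))"
proof -
  have "C_map K (enat 1) E F V f" using assms(4) by (simp add: C_map_infinity_iff)
  from C_map_imp_tower[OF assms(1-3) this]
  interpret tower K E F 1 V "\<lambda>x ys. iter_deriv K E F f ys x" .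
  have "c' \<in> carrier E" using c(3) E.lim_carrier(1) by (auto simp: curve_deriv_def)
  then have "dir_deriv K E F f c' (c 0) \<in> carrier F"
    using tower_closed[of "c 0" "[c']"] c(1) by simp
  with tower_curve[OF c, of "[]" "\<lambda>_ _. undefined" "\<lambda>_. undefined"] show ?thesis by simp
qed

lemma continuous_linear_curve:
  assumes E: "lcs K E" and F: "hausdorff_lcs K F" and L: "continuous_linear K E F L"
    and c: "c 0 \<in> carrier E" "eventually (\<lambda>t. c t \<in> carrier E) (at 0 within K)" "curve_deriv K E c c'"
  shows "curve_deriv K F (\<lambda>t. L (c t)) (L c')"
proof -
  interpret E: lcs K E by fact
  have U: "openin (vtop E) (carrier E)" using openin_topspace[of "vtop E"] by simp
  interpret tower K E F 1 "carrier E" "\<lambda>x ys. case ys of [] \<Rightarrow> L x | y # zs \<Rightarrow> (if zs = [] then L y else \<zero>\<^bsub>F\<^esub>)"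
    by (rule tower_linear_map[OF E F L U])
  have "c' \<in> carrier E" using c(3) E.lim_carrier(1) by (auto simp: curve_deriv_def)
  then have "L c' \<in> carrier F" using L by (auto simp: continuous_linear_def)
  with tower_curve[OF c, of "[]" "\<lambda>_ _. undefined" "\<lambda>_. undefined"] show ?thesis by simp
qed

lemma curve_deriv_pair:
  assumes E: "lcs K E" and F: "lcs K F"
    and c: "c 0 \<in> carrier E" "eventually (\<lambda>t. c t \<in> carrier E) (at 0 within K)" "curve_deriv K E c c'"
    and d: "d 0 \<in> carrier F" "eventually (\<lambda>t. d t \<in> carrier F) (at 0 within K)" "curve_deriv K F d d'"
  shows "curve_deriv K (prod_tvs E F) (\<lambda>t. (c t, d t)) (c', d')"
proof -
  have "limitin (vtop (prod_tvs E F)) (\<lambda>t. (inverse t \<odot>\<^bsub>E\<^esub> (c t \<ominus>\<^bsub>E\<^esub> c 0), inverse t \<odot>\<^bsub>F\<^esub> (d t \<ominus>\<^bsub>F\<^esub> d 0)))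
      (c', d') (at 0 within K)"
    using c(3) d(3) by (simp add: limitin_prod_iff curve_deriv_def)
  then show ?thesis
    unfolding curve_deriv_def
    by (rule limitin_transform_eventually[rotated, OF _ eventually_mono[OF eventually_conj[OF c(2) d(2)]]])
      (use c(1) d(1) in \<open>simp add: prod_tvs_minus[OF E F]\<close>)
qed

lemma C_map_dir_deriv_linear:
  assumes E: "lcs K E" and F: "hausdorff_lcs K F" and V: "openin (vtop E) V"
    and f: "C_map K \<infinity> E F V f" and x: "x \<in> V"
  shows "continuous_linear K E F (\<lambda>y. dir_deriv K E F f y x)"
proof -
  have "C_map K (enat 1) E F V f" using f by (simp add: C_map_infinity_iff)
  from C_map_imp_tower[OF E F V this]
  interpret tower K E F 1 V "\<lambda>x ys. iter_deriv K E F f ys x" .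
  have xc: "x \<in> carrier E" using dom_carrier x .
  have "continuous_map (vtop E) (vtop F) (\<lambda>y. dir_deriv K E F f y x)"
    unfolding continuous_map_atin
  proof
    fix y assume "y \<in> topspace (vtop E)"
    from limitin_ident_atin[OF this]
    have "list_all2 (\<lambda>\<eta> y'. limitin (vtop E) \<eta> y' (atin (vtop E) y)) [\<lambda>a. a] [y]" by simp
    from tower_lim[OF _ x this, of "\<lambda>_. x"] xc
    show "limitin (vtop F) (\<lambda>y. dir_deriv K E F f y x) (dir_deriv K E F f y x) (atin (vtop E) y)"
      by simp
  qed
  moreover have "dir_deriv K E F f y x \<in> carrier F" if "y \<in> carrier E" for y
    using tower_closed[of x "[y]"] x that by simp
  ultimately show ?thesis
    using tower_add_head[OF x, of _ _ "[]"] tower_scale_head[OF x, of _ _ "[]"]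
    by (simp add: continuous_linear_def)
qed

section \<open>Local smoothness in charts\<close>

lemma local_chart_dom:
  assumes "local_chart M U \<phi>"
  shows "openin (mtop M) U" "topspace (subtopology (mtop M) U) = U" "inj_on \<phi> U"
    "openin (vtop (model M)) (\<phi> ` U)"
proof -
  show U: "openin (mtop M) U" and "openin (vtop (model M)) (\<phi> ` U)"
    using assms by (auto simp: local_chart_def)
  show top: "topspace (subtopology (mtop M) U) = U" using openin_subset[OF U] by auto
  have "homeomorphic_map (subtopology (mtop M) U) (subtopology (vtop (model M)) (\<phi> ` U)) \<phi>"
    using assms by (simp add: local_chart_def)
  from homeomorphic_imp_injective_map[OF this] show "inj_on \<phi> U" unfolding top .
qed

lemma local_chart_inv [simp]: "local_chart M U \<phi> \<Longrightarrow> x \<in> U \<Longrightarrow> inv_into U \<phi> (\<phi> x) = x"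
  using local_chart_dom(3)[of M U \<phi>] by (simp add: inv_into_f_f)

lemma local_chart_continuous:
  assumes "local_chart M U \<phi>" shows "continuous_map (subtopology (mtop M) U) (vtop (model M)) \<phi>"
  using assms homeomorphic_imp_continuous_map
  by (fastforce simp: local_chart_def continuous_map_in_subtopology)

lemma local_chart_image_open:
  assumes c: "local_chart M U \<phi>" and V: "openin (mtop M) V" "V \<subseteq> U"
  shows "openin (vtop (model M)) (\<phi> ` V)"
proof -
  have hom: "homeomorphic_map (subtopology (mtop M) U) (subtopology (vtop (model M)) (\<phi> ` U)) \<phi>"
    using c by (simp add: local_chart_def)
  have "openin (subtopology (mtop M) U) V"
    using V openin_subtopology_Int[OF V(1), of U] by (simp add: Int_absorb2)
  then have "openin (subtopology (vtop (model M)) (\<phi> ` U)) (\<phi> ` V)"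
    using homeomorphic_imp_open_map[OF hom] by (simp add: open_map_def)
  then show ?thesis using openin_trans_full local_chart_dom(4)[OF c] by blast
qed

lemma local_chart_inv_continuous:
  assumes "local_chart M U \<phi>"
  shows "continuous_map (subtopology (vtop (model M)) (\<phi> ` U)) (mtop M) (inv_into U \<phi>)"
proof -
  have hom: "homeomorphic_map (subtopology (mtop M) U) (subtopology (vtop (model M)) (\<phi> ` U)) \<phi>"
    using assms by (simp add: local_chart_def)
  then obtain g where g: "homeomorphic_maps (subtopology (mtop M) U) (subtopology (vtop (model M)) (\<phi> ` U)) \<phi> g"
    by (auto simp: homeomorphic_map_maps)
  have gx: "g (\<phi> x) = x" if "x \<in> U" for x
    using g that local_chart_dom(2)[OF assms] by (simp add: homeomorphic_maps_def)
  have "continuous_map (subtopology (vtop (model M)) (\<phi> ` U)) (mtop M) g"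
    using g by (simp add: homeomorphic_maps_def continuous_map_in_subtopology)
  then show ?thesis
    by (rule continuous_map_eq) (use assms gx in auto)
qed

lemma smooth_manifold_model:
  "K = \<real> \<or> K = UNIV \<Longrightarrow> smooth_manifold K M \<Longrightarrow> hausdorff_lcs K (model M)"
  by (simp add: smooth_manifold_def hausdorff_lcs_def lcs_def hausdorff_lcs_axioms_def)

lemma smooth_manifold_atlas:
  "smooth_manifold K M \<Longrightarrow> (U, \<phi>) \<in> atlas M \<Longrightarrow> local_chart M U \<phi>"
  by (auto simp: smooth_manifold_def)

lemma smooth_manifold_atlas_chart:
  "smooth_manifold K M \<Longrightarrow> (U, \<phi>) \<in> atlas M \<Longrightarrow> chart K M U \<phi>"
  by (fastforce simp: smooth_manifold_def chart_def)

lemma smooth_manifold_atlas_cover: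
  assumes "smooth_manifold K M" "p \<in> topspace (mtop M)"
  obtains U \<phi> where "(U, \<phi>) \<in> atlas M" "p \<in> U"
proof -
  have "p \<in> (\<Union>(U, \<phi>)\<in>atlas M. U)" using assms by (simp add: smooth_manifold_def)
  then obtain c where "c \<in> atlas M" "p \<in> (case c of (U, \<phi>) \<Rightarrow> U)" by (rule UN_E)
  then show ?thesis by (cases c) (simp add: that)
qed

lemma chart_local: "chart K M U \<phi> \<Longrightarrow> local_chart M U \<phi>"
  by (simp add: chart_def)

text \<open>Smoothness around the point \<open>p\<close>, read in the given charts. Asking for some neighbourhood \<open>V\<close> instead
  of the largest domain on which the composition makes sense keeps domains out of the arguments
  about compositions and changes of charts.\<close>

definition smooth_near ::
    "complex set \<Rightarrow> ('m, 'v) manifold \<Rightarrow> ('n, 'w) manifold \<Rightarrow> ('m \<Rightarrow> 'n) \<Rightarrow>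
      'm set \<Rightarrow> ('m \<Rightarrow> 'v) \<Rightarrow> 'n set \<Rightarrow> ('n \<Rightarrow> 'w) \<Rightarrow> 'm \<Rightarrow> bool" where
  "smooth_near K M N f U \<phi> W \<kappa> p \<longleftrightarrow>
     (\<exists>V. openin (mtop M) V \<and> p \<in> V \<and> V \<subseteq> U \<and> f ` V \<subseteq> W \<and>
        C_map K \<infinity> (model M) (model N) (\<phi> ` V) (\<kappa> \<circ> f \<circ> inv_into U \<phi>))"

lemma smooth_near_compose:
  assumes E: "hausdorff_lcs K (model M)" "hausdorff_lcs K (model N)" "hausdorff_lcs K (model P)"
    and U: "local_chart M U \<phi>" and W: "local_chart N W \<kappa>"
    and f: "continuous_map (mtop M) (mtop N) f" "smooth_near K M N f U \<phi> W \<kappa> p"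
    and g: "smooth_near K N P g W \<kappa> Z \<zeta> (f p)"
  shows "smooth_near K M P (\<lambda>x. g (f x)) U \<phi> Z \<zeta> p"
proof -
  obtain V1 where V1: "openin (mtop M) V1" "p \<in> V1" "V1 \<subseteq> U" "f ` V1 \<subseteq> W"
    "C_map K \<infinity> (model M) (model N) (\<phi> ` V1) (\<kappa> \<circ> f \<circ> inv_into U \<phi>)"
    using f(2) by (auto simp: smooth_near_def)
  obtain V2 where V2: "openin (mtop N) V2" "f p \<in> V2" "V2 \<subseteq> W" "g ` V2 \<subseteq> Z"
    "C_map K \<infinity> (model N) (model P) (\<kappa> ` V2) (\<zeta> \<circ> g \<circ> inv_into W \<kappa>)"
    using g by (auto simp: smooth_near_def)
  have EM: "lcs K (model M)" using E(1) by (simp add: hausdorff_lcs_def)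
  define V where "V = V1 \<inter> {x \<in> topspace (mtop M). f x \<in> V2}"
  have V: "openin (mtop M) V" "V \<subseteq> V1" "V \<subseteq> U" "f ` V \<subseteq> V2" "p \<in> V"
    unfolding V_def using V1 V2 openin_continuous_map_preimage[OF f(1) V2(1)] openin_subset[OF V1(1)] by auto
  note opn = local_chart_image_open[OF U V(1,3)]
  have "C_map K \<infinity> (model M) (model N) (\<phi> ` V) (\<kappa> \<circ> f \<circ> inv_into U \<phi>)"
    by (rule C_map_subset[OF E(1,2) local_chart_image_open[OF U V1(1,3)] opn image_mono[OF V(2)] V1(5)])
  moreover have "(\<kappa> \<circ> f \<circ> inv_into U \<phi>) ` \<phi> ` V \<subseteq> \<kappa> ` V2"
    using U V by (auto simp: subset_iff)
  ultimately have "C_map K \<infinity> (model M) (model P) (\<phi> ` V) ((\<zeta> \<circ> g \<circ> inv_into W \<kappa>) \<circ> (\<kappa> \<circ> f \<circ> inv_into U \<phi>))"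
    by (intro C_map_compose[OF EM E(2,3) opn local_chart_image_open[OF W V2(1,3)] _ _ V2(5)])
  then have "C_map K \<infinity> (model M) (model P) (\<phi> ` V) (\<zeta> \<circ> (\<lambda>x. g (f x)) \<circ> inv_into U \<phi>)"
    by (rule C_map_cong[OF EM E(3) opn, rotated]) (use U W V V2 in \<open>auto simp: subset_iff image_subset_iff\<close>)
  moreover have "(\<lambda>x. g (f x)) ` V \<subseteq> Z" using V(4) V2(4) by (auto simp: image_subset_iff)
  ultimately show ?thesis
    unfolding smooth_near_def using V by (intro exI[of _ V]) auto
qed

lemma smooth_near_cong:
  assumes E: "hausdorff_lcs K (model M)" "hausdorff_lcs K (model N)"
    and U: "local_chart M U \<phi>"
    and eq: "\<And>x. x \<in> topspace (mtop M) \<Longrightarrow> f x = g x" and f: "smooth_near K M N f U \<phi> W \<kappa> p"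
  shows "smooth_near K M N g U \<phi> W \<kappa> p"
proof -
  obtain V where V: "openin (mtop M) V" "p \<in> V" "V \<subseteq> U" "f ` V \<subseteq> W"
    "C_map K \<infinity> (model M) (model N) (\<phi> ` V) (\<kappa> \<circ> f \<circ> inv_into U \<phi>)"
    using f by (auto simp: smooth_near_def)
  have eq': "f x = g x" if "x \<in> V" for x using eq that openin_subset[OF V(1)] by auto
  have "lcs K (model M)" using E(1) by (simp add: hausdorff_lcs_def)
  then have "C_map K \<infinity> (model M) (model N) (\<phi> ` V) (\<kappa> \<circ> g \<circ> inv_into U \<phi>)"
    by (rule C_map_cong[OF _ E(2) local_chart_image_open[OF U V(1,3)] _ V(5)])
      (use U V(3) eq' in \<open>auto simp: subset_iff\<close>)
  moreover have "g ` V \<subseteq> W" using V(4) eq' by (auto simp: image_subset_iff)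
  ultimately show ?thesis
    unfolding smooth_near_def using V by (intro exI[of _ V]) auto
qed

lemma smooth_map_near:
  assumes f: "smooth_map K M N f" and U: "(U, \<phi>) \<in> atlas M" "openin (mtop M) U"
    and W: "(W, \<kappa>) \<in> atlas N" "openin (mtop N) W" and p: "p \<in> U" "f p \<in> W"
  shows "smooth_near K M N f U \<phi> W \<kappa> p"
proof -
  have cont: "continuous_map (mtop M) (mtop N) f"
    and C: "C_map K \<infinity> (model M) (model N) (\<phi> ` (U \<inter> f -` W)) (\<kappa> \<circ> f \<circ> inv_into U \<phi>)"
    using f U(1) W(1) by (auto simp: smooth_map_def)
  have "U \<inter> f -` W = U \<inter> {x \<in> topspace (mtop M). f x \<in> W}"
    using openin_subset[OF U(2)] by auto
  then have "openin (mtop M) (U \<inter> f -` W)"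
    using U(2) openin_continuous_map_preimage[OF cont W(2)] by (simp add: openin_Int)
  then show ?thesis
    unfolding smooth_near_def using p C by (intro exI[of _ "U \<inter> f -` W"]) auto
qed

lemma compatible_near:
  assumes c: "compatible K (model M) U \<phi> U' \<phi>'" and U: "local_chart M U \<phi>" "local_chart M U' \<phi>'"
    and p: "p \<in> U" "p \<in> U'"
  shows "smooth_near K M M (\<lambda>x. x) U \<phi> U' \<phi>' p" "smooth_near K M M (\<lambda>x. x) U' \<phi>' U \<phi> p"
proof -
  have "openin (mtop M) (U \<inter> U')" using local_chart_dom(1) U by (blast intro: openin_Int)
  then show "smooth_near K M M (\<lambda>x. x) U \<phi> U' \<phi>' p" "smooth_near K M M (\<lambda>x. x) U' \<phi>' U \<phi> p"
    unfolding smooth_near_def using p c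
    by (auto simp: compatible_def o_def intro!: exI[of _ "U \<inter> U'"])
qed

text \<open>Charts of the maximal atlas are compatible with the stored atlas by definition, and are compared
  with each other through one of its charts.\<close>

lemma smooth_near_transition:
  assumes K: "K = \<real> \<or> K = UNIV" and M: "smooth_manifold K M"
    and U: "chart K M U \<phi>" "chart K M U' \<phi>'" and p: "p \<in> U" "p \<in> U'"
  shows "smooth_near K M M (\<lambda>x. x) U \<phi> U' \<phi>' p"
proof -
  note E = smooth_manifold_model[OF K M]
  have "p \<in> topspace (mtop M)" using openin_subset[OF local_chart_dom(1)[OF chart_local[OF U(1)]]] p by auto
  then obtain A \<alpha> where A: "(A, \<alpha>) \<in> atlas M" "p \<in> A" using smooth_manifold_atlas_cover[OF M] by blast
  have "compatible K (model M) U \<phi> A \<alpha>" "compatible K (model M) U' \<phi>' A \<alpha>"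
    using U A(1) by (auto simp: chart_def)
  note * = compatible_near[OF this(1) chart_local[OF U(1)] smooth_manifold_atlas[OF M A(1)] p(1) A(2)]
    compatible_near[OF this(2) chart_local[OF U(2)] smooth_manifold_atlas[OF M A(1)] p(2) A(2)]
  have "continuous_map (mtop M) (mtop M) (\<lambda>x. x)"
    using continuous_map_id[of "mtop M"] by (simp add: id_def)
  from smooth_near_compose[OF E E E chart_local[OF U(1)] smooth_manifold_atlas[OF M A(1)] this *(1) *(4)]
  show ?thesis .
qed

lemma smooth_near_change:
  assumes K: "K = \<real> \<or> K = UNIV" and M: "smooth_manifold K M" and N: "smooth_manifold K N"
    and f: "continuous_map (mtop M) (mtop N) f" "smooth_near K M N f U \<phi> W \<kappa> p"
    and U: "chart K M U \<phi>" "chart K M U' \<phi>'" and W: "chart K N W \<kappa>" "chart K N W' \<kappa>'"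
    and p: "p \<in> U'" "f p \<in> W'"
  shows "smooth_near K M N f U' \<phi>' W' \<kappa>' p"
proof -
  note EM = smooth_manifold_model[OF K M] and EN = smooth_manifold_model[OF K N]
  have pU: "p \<in> U" "f p \<in> W" using f(2) by (auto simp: smooth_near_def)
  have id: "continuous_map (mtop M) (mtop M) (\<lambda>x. x)" "continuous_map (mtop N) (mtop N) (\<lambda>x. x)"
    using continuous_map_id[of "mtop M"] continuous_map_id[of "mtop N"] by (simp_all add: id_def)
  have "smooth_near K M N f U' \<phi>' W \<kappa> p"
    using smooth_near_compose[OF EM EM EN chart_local[OF U(2)] chart_local[OF U(1)] id(1)
        smooth_near_transition[OF K M U(2,1) p(1) pU(1)] f(2)] .
  from smooth_near_compose[OF EM EN EN chart_local[OF U(2)] chart_local[OF W(1)] f(1) this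
      smooth_near_transition[OF K N W(1,2) pU(2) p(2)]]
  show ?thesis .
qed

lemma smooth_map_smooth_near:
  assumes K: "K = \<real> \<or> K = UNIV" and M: "smooth_manifold K M" and N: "smooth_manifold K N"
    and f: "smooth_map K M N f"
    and U: "chart K M U \<phi>" and W: "chart K N W \<kappa>" and p: "p \<in> U" "f p \<in> W"
  shows "smooth_near K M N f U \<phi> W \<kappa> p"
proof -
  have cont: "continuous_map (mtop M) (mtop N) f" using f by (simp add: smooth_map_def)
  have "p \<in> topspace (mtop M)" using openin_subset[OF local_chart_dom(1)[OF chart_local[OF U]]] p by auto
  then obtain A \<alpha> where A: "(A, \<alpha>) \<in> atlas M" "p \<in> A" using smooth_manifold_atlas_cover[OF M] by blast
  have "f p \<in> topspace (mtop N)" using openin_subset[OF local_chart_dom(1)[OF chart_local[OF W]]] p by auto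
  then obtain B \<beta> where B: "(B, \<beta>) \<in> atlas N" "f p \<in> B" using smooth_manifold_atlas_cover[OF N] by blast
  note AB = smooth_manifold_atlas_chart[OF M A(1)] smooth_manifold_atlas_chart[OF N B(1)]
  have "smooth_near K M N f A \<alpha> B \<beta> p"
    using AB by (intro smooth_map_near[OF f A(1) _ B(1) _ A(2) B(2)]) (auto dest: chart_local local_chart_dom)
  from smooth_near_change[OF K M N cont this AB(1) U AB(2) W p] show ?thesis .
qed

lemma smooth_map_of_near:
  assumes K: "K = \<real> \<or> K = UNIV" and M: "smooth_manifold K M" and N: "smooth_manifold K N"
    and f: "continuous_map (mtop M) (mtop N) f"
    and near: "\<And>U \<phi> W \<kappa> p. (U, \<phi>) \<in> atlas M \<Longrightarrow> (W, \<kappa>) \<in> atlas N \<Longrightarrow> p \<in> U \<Longrightarrow> f p \<in> W \<Longrightarrow>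
           smooth_near K M N f U \<phi> W \<kappa> p"
  shows "smooth_map K M N f"
proof -
  note EM = smooth_manifold_model[OF K M] and EN = smooth_manifold_model[OF K N]
  have EM': "lcs K (model M)" using EM by (simp add: hausdorff_lcs_def)
  have "C_map K \<infinity> (model M) (model N) (\<phi> ` (U \<inter> f -` W)) (\<kappa> \<circ> f \<circ> inv_into U \<phi>)"
    if UW: "(U, \<phi>) \<in> atlas M" "(W, \<kappa>) \<in> atlas N" for U \<phi> W \<kappa>
  proof (rule C_map_local[OF EM' EN])
    note cU = smooth_manifold_atlas[OF M UW(1)] and cW = smooth_manifold_atlas[OF N UW(2)]
    have "U \<inter> f -` W = U \<inter> {x \<in> topspace (mtop M). f x \<in> W}"
      using openin_subset[OF local_chart_dom(1)[OF cU]] by auto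
    then have "openin (mtop M) (U \<inter> f -` W)"
      using local_chart_dom(1)[OF cU] openin_continuous_map_preimage[OF f local_chart_dom(1)[OF cW]]
      by (simp add: openin_Int)
    then show "openin (vtop (model M)) (\<phi> ` (U \<inter> f -` W))"
      by (rule local_chart_image_open[OF cU]) auto
    fix x assume "x \<in> \<phi> ` (U \<inter> f -` W)"
    then obtain p where p: "x = \<phi> p" "p \<in> U" "f p \<in> W" by auto
    from near[OF UW p(2,3)] obtain V where V: "openin (mtop M) V" "p \<in> V" "V \<subseteq> U"
        "C_map K \<infinity> (model M) (model N) (\<phi> ` V) (\<kappa> \<circ> f \<circ> inv_into U \<phi>)"
      by (auto simp: smooth_near_def)
    then show "\<exists>V. openin (vtop (model M)) V \<and> x \<in> V \<and> C_map K \<infinity> (model M) (model N) V (\<kappa> \<circ> f \<circ> inv_into U \<phi>)"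
      using local_chart_image_open[OF cU V(1,3)] p by blast
  qed
  then show ?thesis using f by (auto simp: smooth_map_def)
qed

lemma prod_manifold_simps [simp]:
  "mtop (prod_manifold M N) = prod_topology (mtop M) (mtop N)"
  "model (prod_manifold M N) = prod_tvs (model M) (model N)"
  by (simp_all add: prod_manifold_def)

lemma prod_manifold_atlasI:
  "(U, \<phi>) \<in> atlas M \<Longrightarrow> (W, \<kappa>) \<in> atlas N \<Longrightarrow> (U \<times> W, map_prod \<phi> \<kappa>) \<in> atlas (prod_manifold M N)"
  by (auto simp: prod_manifold_def)

lemma map_prod_image_times: "map_prod f g ` (A \<times> B) = f ` A \<times> g ` B"
  by force

lemma local_chart_prod:
  assumes U: "local_chart M U \<phi>" and W: "local_chart N W \<kappa>"
  shows "local_chart (prod_manifold M N) (U \<times> W) (map_prod \<phi> \<kappa>)"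
proof -
  obtain \<phi>' \<kappa>' where
    "homeomorphic_maps (subtopology (mtop M) U) (subtopology (vtop (model M)) (\<phi> ` U)) \<phi> \<phi>'"
    "homeomorphic_maps (subtopology (mtop N) W) (subtopology (vtop (model N)) (\<kappa> ` W)) \<kappa> \<kappa>'"
    using U W by (auto simp: local_chart_def homeomorphic_map_maps)
  then have "homeomorphic_maps (subtopology (prod_topology (mtop M) (mtop N)) (U \<times> W))
      (subtopology (prod_topology (vtop (model M)) (vtop (model N))) (\<phi> ` U \<times> \<kappa> ` W))
      (\<lambda>(x, y). (\<phi> x, \<kappa> y)) (\<lambda>(x, y). (\<phi>' x, \<kappa>' y))"
    unfolding subtopology_Times homeomorphic_maps_prod by blast
  moreover have "(\<lambda>(x, y). (\<phi> x, \<kappa> y)) = map_prod \<phi> \<kappa>" by auto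
  ultimately have "homeomorphic_map (subtopology (prod_topology (mtop M) (mtop N)) (U \<times> W))
      (subtopology (prod_topology (vtop (model M)) (vtop (model N))) (\<phi> ` U \<times> \<kappa> ` W)) (map_prod \<phi> \<kappa>)"
    by (auto simp: homeomorphic_map_maps)
  then show ?thesis
    using local_chart_dom(1,4)[OF U] local_chart_dom(1,4)[OF W]
    by (simp add: local_chart_def map_prod_image_times openin_prod_Times_iff)
qed

lemma smooth_near_prod:
  assumes E: "hausdorff_lcs K (model M)" "hausdorff_lcs K (model N)"
      "hausdorff_lcs K (model M')" "hausdorff_lcs K (model N')"
    and U: "local_chart M U \<phi>" and U': "local_chart M' U' \<phi>'"
    and f: "smooth_near K M N f U \<phi> W \<kappa> p" and g: "smooth_near K M' N' g U' \<phi>' W' \<kappa>' q"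
  shows "smooth_near K (prod_manifold M M') (prod_manifold N N') (map_prod f g)
           (U \<times> U') (map_prod \<phi> \<phi>') (W \<times> W') (map_prod \<kappa> \<kappa>') (p, q)"
proof -
  obtain V where V: "openin (mtop M) V" "p \<in> V" "V \<subseteq> U" "f ` V \<subseteq> W"
    "C_map K \<infinity> (model M) (model N) (\<phi> ` V) (\<kappa> \<circ> f \<circ> inv_into U \<phi>)"
    using f by (auto simp: smooth_near_def)
  obtain V' where V': "openin (mtop M') V'" "q \<in> V'" "V' \<subseteq> U'" "g ` V' \<subseteq> W'"
    "C_map K \<infinity> (model M') (model N') (\<phi>' ` V') (\<kappa>' \<circ> g \<circ> inv_into U' \<phi>')"
    using g by (auto simp: smooth_near_def)
  have E': "lcs K (model M)" "lcs K (model N)" "lcs K (model M')" "lcs K (model N')"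
    using E by (auto simp: hausdorff_lcs_def)
  let ?P = "prod_tvs (model M) (model M')"
  have P: "lcs K ?P" by (intro lcs_prod E')
  note o1 = local_chart_image_open[OF U V(1,3)] and o2 = local_chart_image_open[OF U' V'(1,3)]
  have opn: "openin (vtop ?P) (\<phi> ` V \<times> \<phi>' ` V')" using o1 o2 by (simp add: openin_prod_Times_iff)
  have "C_map K \<infinity> ?P (model N) (\<phi> ` V \<times> \<phi>' ` V') ((\<kappa> \<circ> f \<circ> inv_into U \<phi>) \<circ> fst)"
    using E E' P opn o1 V(5)
    by (intro C_map_compose[OF P E(1,2) opn o1 _ C_map_linear[OF P E(1) continuous_linear_fst opn]]) auto
  moreover have "C_map K \<infinity> ?P (model N') (\<phi> ` V \<times> \<phi>' ` V') ((\<kappa>' \<circ> g \<circ> inv_into U' \<phi>') \<circ> snd)"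
    using E E' P opn o1 V'(5)
    by (intro C_map_compose[OF P E(3,4) opn o2 _ C_map_linear[OF P E(3) continuous_linear_snd opn]]) auto
  ultimately have "C_map K \<infinity> ?P (prod_tvs (model N) (model N')) (\<phi> ` V \<times> \<phi>' ` V')
      (\<lambda>x. (((\<kappa> \<circ> f \<circ> inv_into U \<phi>) \<circ> fst) x, ((\<kappa>' \<circ> g \<circ> inv_into U' \<phi>') \<circ> snd) x))"
    by (rule C_map_pair[OF P E(2,4) opn])
  then have "C_map K \<infinity> ?P (prod_tvs (model N) (model N')) (\<phi> ` V \<times> \<phi>' ` V')
      (map_prod \<kappa> \<kappa>' \<circ> map_prod f g \<circ> inv_into (U \<times> U') (map_prod \<phi> \<phi>'))"
  proof (rule C_map_cong[OF P hausdorff_lcs_prod[OF E(2,4)] opn, rotated])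
    fix x assume "x \<in> \<phi> ` V \<times> \<phi>' ` V'"
    then obtain a b where x: "x = map_prod \<phi> \<phi>' (a, b)" "a \<in> V" "b \<in> V'" by auto
    then have "inv_into (U \<times> U') (map_prod \<phi> \<phi>') x = (a, b)"
      using local_chart_inv[OF local_chart_prod[OF U U'], of "(a, b)"] V(3) V'(3) by auto
    then show "(((\<kappa> \<circ> f \<circ> inv_into U \<phi>) \<circ> fst) x, ((\<kappa>' \<circ> g \<circ> inv_into U' \<phi>') \<circ> snd) x) =
        (map_prod \<kappa> \<kappa>' \<circ> map_prod f g \<circ> inv_into (U \<times> U') (map_prod \<phi> \<phi>')) x"
      using x V(3) V'(3) U U' by auto
  qed
  then show ?thesis
    unfolding smooth_near_def using V V'
    by (intro exI[of _ "V \<times> V'"]) (auto simp: map_prod_image_times openin_prod_Times_iff)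
qed

text \<open>Together with smoothness of the multiplication, this makes left translations smooth.\<close>

lemma smooth_near_slice:
  assumes E: "hausdorff_lcs K (model M)" "hausdorff_lcs K (model P)"
    and U: "local_chart M U \<phi>" "p \<in> U" and Z: "local_chart P Z \<zeta>" "a \<in> Z"
  shows "smooth_near K M (prod_manifold P M) (\<lambda>x. (a, x)) U \<phi> (Z \<times> U) (map_prod \<zeta> \<phi>) p"
proof -
  have E': "lcs K (model M)" using E by (auto simp: hausdorff_lcs_def)
  note o = local_chart_dom(4)[OF U(1)]
  have "\<zeta> a \<in> carrier (model P)"
    using openin_subset[OF local_chart_dom(4)[OF Z(1)]] Z(2) lcs.topspace_vtop E(2) by (fastforce simp: hausdorff_lcs_def)
  then have "C_map K \<infinity> (model M) (prod_tvs (model P) (model M)) (\<phi> ` U) (\<lambda>x. (\<zeta> a, x))"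
    by (intro C_map_pair[OF E' E(2,1) o] C_map_const[OF E' E(2) o]
        C_map_linear[OF E' E(1) continuous_linear_ident o])
  then have "C_map K \<infinity> (model M) (prod_tvs (model P) (model M)) (\<phi> ` U)
      (map_prod \<zeta> \<phi> \<circ> (\<lambda>x. (a, x)) \<circ> inv_into U \<phi>)"
    by (rule C_map_cong[OF E' hausdorff_lcs_prod[OF E(2,1)] o, rotated]) (use U in auto)
  then show ?thesis
    unfolding smooth_near_def using U Z local_chart_dom(1)[OF U(1)] by (intro exI[of _ U]) auto
qed

section \<open>Translations in Lie groups\<close>

lemma lie_groupD:
  assumes "lie_group K G"
  shows "group G" "smooth_manifold K (man G)" "topspace (mtop (man G)) = carrier G"
    "smooth_map K (prod_manifold (man G) (man G)) (man G) (\<lambda>(x, y). x \<otimes>\<^bsub>G\<^esub> y)"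
    "smooth_map K (man G) (man G) (\<lambda>x. inv\<^bsub>G\<^esub> x)"
    "continuous_map (prod_topology (mtop (man G)) (mtop (man G))) (mtop (man G)) (\<lambda>(x, y). x \<otimes>\<^bsub>G\<^esub> y)"
    "continuous_map (mtop (man G)) (mtop (man G)) (\<lambda>x. inv\<^bsub>G\<^esub> x)"
  using assms by (auto simp: lie_group_def smooth_map_def)

lemma lie_group_chart_carrier:
  "lie_group K G \<Longrightarrow> chart K (man G) U \<phi> \<Longrightarrow> x \<in> U \<Longrightarrow> x \<in> carrier G"
  using openin_subset[OF local_chart_dom(1)[OF chart_local]] lie_groupD(3) by fastforce

lemma lie_mult_near:
  assumes G: "lie_group K G" and A: "(A, \<alpha>) \<in> atlas (man G)" "a \<in> A" and B: "(B, \<beta>) \<in> atlas (man G)" "b \<in> B"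
    and C: "(C, \<gamma>) \<in> atlas (man G)" "a \<otimes>\<^bsub>G\<^esub> b \<in> C"
  shows "smooth_near K (prod_manifold (man G) (man G)) (man G) (\<lambda>(x, y). x \<otimes>\<^bsub>G\<^esub> y)
           (A \<times> B) (map_prod \<alpha> \<beta>) C \<gamma> (a, b)"
proof -
  note M = lie_groupD(2)[OF G]
  note loc = smooth_manifold_atlas[OF M]
  show ?thesis
    using A B C local_chart_dom(1)[OF local_chart_prod[OF loc[OF A(1)] loc[OF B(1)]]]
      local_chart_dom(1)[OF loc[OF C(1)]]
    by (intro smooth_map_near[OF lie_groupD(4)[OF G]] prod_manifold_atlasI) auto
qed

lemma lie_left_translation_continuous:
  assumes G: "lie_group K G" and a: "a \<in> carrier G"
  shows "continuous_map (mtop (man G)) (mtop (man G)) (\<lambda>x. a \<otimes>\<^bsub>G\<^esub> x)"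
proof -
  have "continuous_map (mtop (man G)) (prod_topology (mtop (man G)) (mtop (man G))) (\<lambda>x. (a, x))"
    using a lie_groupD(3)[OF G] continuous_map_id[of "mtop (man G)"]
    by (simp add: continuous_map_pairwise o_def id_def)
  from continuous_map_compose[OF this lie_groupD(6)[OF G]] show ?thesis by (simp add: o_def)
qed

lemma lie_left_translation_near:
  assumes K: "K = \<real> \<or> K = UNIV" and G: "lie_group K G" and a: "a \<in> carrier G"
    and U: "chart K (man G) U \<phi>" "b \<in> U" and W: "chart K (man G) W \<kappa>" "a \<otimes>\<^bsub>G\<^esub> b \<in> W"
  shows "smooth_near K (man G) (man G) (\<lambda>x. a \<otimes>\<^bsub>G\<^esub> x) U \<phi> W \<kappa> b"
proof -
  note M = lie_groupD(2)[OF G]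
  note E = smooth_manifold_model[OF K M]
  note loc = smooth_manifold_atlas[OF M]
  have carr: "a \<in> topspace (mtop (man G))" "b \<in> topspace (mtop (man G))" "a \<otimes>\<^bsub>G\<^esub> b \<in> topspace (mtop (man G))"
    using a lie_group_chart_carrier[OF G U] lie_group_chart_carrier[OF G W] lie_groupD(3)[OF G] by auto
  obtain A \<alpha> where A: "(A, \<alpha>) \<in> atlas (man G)" "a \<in> A" using smooth_manifold_atlas_cover[OF M carr(1)] .
  obtain B \<beta> where B: "(B, \<beta>) \<in> atlas (man G)" "b \<in> B" using smooth_manifold_atlas_cover[OF M carr(2)] .
  obtain C \<gamma> where C: "(C, \<gamma>) \<in> atlas (man G)" "a \<otimes>\<^bsub>G\<^esub> b \<in> C" using smooth_manifold_atlas_cover[OF M carr(3)] .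
  have EP: "hausdorff_lcs K (model (prod_manifold (man G) (man G)))"
    using hausdorff_lcs_prod[OF E E] by simp
  have cont: "continuous_map (mtop (man G)) (mtop (prod_manifold (man G) (man G))) (\<lambda>x. (a, x))"
    using carr(1) continuous_map_id[of "mtop (man G)"]
    by (simp add: continuous_map_pairwise o_def id_def)
  have "smooth_near K (man G) (man G) (\<lambda>x. case (a, x) of (x, y) \<Rightarrow> x \<otimes>\<^bsub>G\<^esub> y) B \<beta> C \<gamma> b"
    by (rule smooth_near_compose[OF E EP E loc[OF B(1)] local_chart_prod[OF loc[OF A(1)] loc[OF B(1)]] cont
          smooth_near_slice[OF E E loc[OF B(1)] B(2) loc[OF A(1)] A(2)] lie_mult_near[OF G A B C]])
  then have "smooth_near K (man G) (man G) (\<lambda>x. a \<otimes>\<^bsub>G\<^esub> x) B \<beta> C \<gamma> b" by simp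
  from smooth_near_change[OF K M M lie_left_translation_continuous[OF G a] this
      smooth_manifold_atlas_chart[OF M B(1)] U(1) smooth_manifold_atlas_chart[OF M C(1)] W(1) U(2) W(2)]
  show ?thesis .
qed

lemma lie_left_division_near:
  assumes K: "K = \<real> \<or> K = UNIV" and G: "lie_group K G"
    and U: "chart K (man G) U \<phi>" "a \<in> U" and V: "chart K (man G) V \<theta>" "b \<in> V"
    and W: "chart K (man G) W \<kappa>" "inv\<^bsub>G\<^esub> a \<otimes>\<^bsub>G\<^esub> b \<in> W"
  shows "smooth_near K (prod_manifold (man G) (man G)) (man G) (\<lambda>(x, y). inv\<^bsub>G\<^esub> x \<otimes>\<^bsub>G\<^esub> y)
           (U \<times> V) (map_prod \<phi> \<theta>) W \<kappa> (a, b)"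
proof -
  note M = lie_groupD(2)[OF G]
  note E = smooth_manifold_model[OF K M]
  note loc = smooth_manifold_atlas[OF M]
  let ?P = "prod_manifold (man G) (man G)"
  interpret group G by (rule lie_groupD(1)[OF G])
  have carr: "inv\<^bsub>G\<^esub> a \<in> topspace (mtop (man G))" "b \<in> topspace (mtop (man G))"
      "inv\<^bsub>G\<^esub> a \<otimes>\<^bsub>G\<^esub> b \<in> topspace (mtop (man G))"
    using lie_group_chart_carrier[OF G U] lie_group_chart_carrier[OF G V] lie_groupD(3)[OF G] by auto
  obtain A \<alpha> where A: "(A, \<alpha>) \<in> atlas (man G)" "inv\<^bsub>G\<^esub> a \<in> A" using smooth_manifold_atlas_cover[OF M carr(1)] .
  obtain B \<beta> where B: "(B, \<beta>) \<in> atlas (man G)" "b \<in> B" using smooth_manifold_atlas_cover[OF M carr(2)] .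
  obtain C \<gamma> where C: "(C, \<gamma>) \<in> atlas (man G)" "inv\<^bsub>G\<^esub> a \<otimes>\<^bsub>G\<^esub> b \<in> C" using smooth_manifold_atlas_cover[OF M carr(3)] .
  note chA = smooth_manifold_atlas_chart[OF M A(1)] and chB = smooth_manifold_atlas_chart[OF M B(1)]
    and chC = smooth_manifold_atlas_chart[OF M C(1)]
  have EP: "hausdorff_lcs K (model ?P)" using hausdorff_lcs_prod[OF E E] by simp
  have "smooth_near K (man G) (man G) (\<lambda>x. inv\<^bsub>G\<^esub> x) U \<phi> A \<alpha> a"
    by (rule smooth_map_smooth_near[OF K M M lie_groupD(5)[OF G] U(1) chA U(2) A(2)])
  from smooth_near_prod[OF E E E E chart_local[OF U(1)] chart_local[OF V(1)] this
      smooth_near_transition[OF K M V(1) chB V(2) B(2)]]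
  have 1: "smooth_near K ?P ?P (map_prod (\<lambda>x. inv\<^bsub>G\<^esub> x) (\<lambda>x. x)) (U \<times> V) (map_prod \<phi> \<theta>) (A \<times> B) (map_prod \<alpha> \<beta>) (a, b)" .
  have cont: "continuous_map (mtop ?P) (mtop ?P) (map_prod (\<lambda>x. inv\<^bsub>G\<^esub> x) (\<lambda>x. x))"
    using continuous_map_compose[OF continuous_map_fst lie_groupD(7)[OF G], of "mtop (man G)"]
      continuous_map_snd[of "mtop (man G)" "mtop (man G)"]
    by (auto simp: continuous_map_pairwise o_def map_prod_def case_prod_unfold)
  have 2: "smooth_near K ?P (man G) (\<lambda>(x, y). x \<otimes>\<^bsub>G\<^esub> y) (A \<times> B) (map_prod \<alpha> \<beta>) C \<gamma>
      (map_prod (\<lambda>x. inv\<^bsub>G\<^esub> x) (\<lambda>x. x) (a, b))"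
    using lie_mult_near[OF G A B C] by simp
  note lUV = local_chart_prod[OF chart_local[OF U(1)] chart_local[OF V(1)]]
  have 3: "smooth_near K ?P (man G) (\<lambda>p. case map_prod (\<lambda>x. inv\<^bsub>G\<^esub> x) (\<lambda>x. x) p of (x, y) \<Rightarrow> x \<otimes>\<^bsub>G\<^esub> y)
      (U \<times> V) (map_prod \<phi> \<theta>) C \<gamma> (a, b)"
    by (rule smooth_near_compose[OF EP EP E lUV local_chart_prod[OF loc[OF A(1)] loc[OF B(1)]] cont 1 2])
  have cont3: "continuous_map (mtop ?P) (mtop (man G)) (\<lambda>p. case map_prod (\<lambda>x. inv\<^bsub>G\<^esub> x) (\<lambda>x. x) p of (x, y) \<Rightarrow> x \<otimes>\<^bsub>G\<^esub> y)"
    using continuous_map_compose[OF cont, of "mtop (man G)" "\<lambda>(x, y). x \<otimes>\<^bsub>G\<^esub> y"] lie_groupD(6)[OF G] by (simp add: o_def)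
  have "smooth_near K ?P (man G) (\<lambda>p. case map_prod (\<lambda>x. inv\<^bsub>G\<^esub> x) (\<lambda>x. x) p of (x, y) \<Rightarrow> x \<otimes>\<^bsub>G\<^esub> y)
      (U \<times> V) (map_prod \<phi> \<theta>) W \<kappa> (a, b)"
  proof (rule smooth_near_compose[OF EP E E lUV loc[OF C(1)] cont3 3])
    show "smooth_near K (man G) (man G) (\<lambda>x. x) C \<gamma> W \<kappa>
        (case map_prod (\<lambda>x. inv\<^bsub>G\<^esub> x) (\<lambda>x. x) (a, b) of (x, y) \<Rightarrow> x \<otimes>\<^bsub>G\<^esub> y)"
      using smooth_near_transition[OF K M chC W(1) C(2) W(2)] by simp
  qed
  then show ?thesis
    by (simp add: map_prod_def case_prod_unfold)
qed

section \<open>The tangent map of a homomorphism on a direct limit\<close>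

text \<open>A homomorphism \<open>\<psi>\<close> that is smooth on each \<open>Gs n\<close>, together with the data of a direct limit chart
  \<open>(U, \<phi>)\<close> around the neutral element of \<open>G\<close> and a chart \<open>(W, \<kappa>)\<close> around that of \<open>Y\<close>.\<close>

locale limit_homomorphism =
  fixes K :: "complex set" and G :: "('g, 'v) lie" and Gs :: "nat \<Rightarrow> ('g, 'w) lie"
    and n0 :: nat and j :: "nat \<Rightarrow> nat \<Rightarrow> 'w \<Rightarrow> 'w" and js :: "nat \<Rightarrow> 'w \<Rightarrow> 'v"
    and U :: "'g set" and \<phi> :: "'g \<Rightarrow> 'v" and Us :: "nat \<Rightarrow> 'g set" and \<phi>s :: "nat \<Rightarrow> 'g \<Rightarrow> 'w"
    and Y :: "('h, 'e) lie" and \<psi> :: "'g \<Rightarrow> 'h" and \<psi>s :: "nat \<Rightarrow> 'g \<Rightarrow> 'h"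
    and W :: "'h set" and \<kappa> :: "'h \<Rightarrow> 'e"
  assumes ground: "K = \<real> \<or> K = UNIV"
    and union: "lie_ascending_union K G Gs"
    and Y: "lie_group K Y"
    and \<psi>_hom: "\<psi> \<in> hom G Y"
    and \<psi>_cont: "continuous_map (mtop (man G)) (mtop (man Y)) \<psi>"
    and \<psi>s: "\<And>n. lie_hom K (Gs n) Y (\<psi>s n)"
    and \<psi>_eq: "\<And>n x. x \<in> carrier (Gs n) \<Longrightarrow> \<psi> x = \<psi>s n x"
    and chart: "chart K (man G) U \<phi>"
    and sys: "lcs_direct_system K n0 (\<lambda>n. model (man (Gs n))) j"
    and lim: "lcs_direct_limit TYPE(nat \<times> 'w) K n0 (\<lambda>n. model (man (Gs n))) j (model (man G)) js"
    and model_union: "carrier (model (man G)) = (\<Union>n\<in>{n0..}. js n ` carrier (model (man (Gs n))))"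
    and charts: "\<And>n. n \<ge> n0 \<Longrightarrow> chart K (man (Gs n)) (Us n) (\<phi>s n)"
    and nest: "\<And>m n. n0 \<le> m \<Longrightarrow> m \<le> n \<Longrightarrow> Us m \<subseteq> Us n"
      "\<And>m n. n0 \<le> m \<Longrightarrow> m \<le> n \<Longrightarrow> j n m ` (\<phi>s m ` Us m) \<subseteq> \<phi>s n ` Us n"
    and U_union: "U = (\<Union>n\<in>{n0..}. Us n)"
    and \<phi>_eq: "\<And>n x. n \<ge> n0 \<Longrightarrow> x \<in> Us n \<Longrightarrow> \<phi> x = js n (\<phi>s n x)"
    and one_U: "\<one>\<^bsub>G\<^esub> \<in> U"
    and W: "(W, \<kappa>) \<in> atlas (man Y)" "\<one>\<^bsub>Y\<^esub> \<in> W"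
begin

abbreviation "E \<equiv> model (man G)"
abbreviation "Es n \<equiv> model (man (Gs n))"
abbreviation "F \<equiv> model (man Y)"

lemma G: "lie_group K G" and Gs: "lie_group K (Gs n)"
  using union by (auto simp: lie_ascending_union_def)

sublocale G: group G by (rule lie_groupD(1)[OF G])
sublocale Y: group Y by (rule lie_groupD(1)[OF Y])
sublocale Gs: group "Gs n" for n by (rule lie_groupD(1)[OF Gs])
sublocale \<psi>: group_hom G Y \<psi> by unfold_locales (rule \<psi>_hom)

lemma incl: "(\<lambda>x. x) \<in> hom (Gs n) G" "carrier (Gs n) \<subseteq> carrier G"
proof -
  show *: "(\<lambda>x. x) \<in> hom (Gs n) G" using union by (simp add: lie_ascending_union_def lie_hom_def)
  then show "carrier (Gs n) \<subseteq> carrier G" by (auto simp: hom_def)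
qed

sublocale incl: group_hom "Gs n" G "\<lambda>x. x" for n by unfold_locales (rule incl)

text \<open>The groups \<open>Gs n\<close> and \<open>G\<close> are different records, and their operations agree because the inclusion
  is a homomorphism.\<close>

lemma division_Gs:
  assumes "x \<in> carrier (Gs n)" "y \<in> carrier (Gs n)"
  shows "inv\<^bsub>Gs n\<^esub> x \<otimes>\<^bsub>Gs n\<^esub> y = inv\<^bsub>G\<^esub> x \<otimes>\<^bsub>G\<^esub> y"
proof -
  have "inv\<^bsub>Gs n\<^esub> x \<otimes>\<^bsub>Gs n\<^esub> y = inv\<^bsub>Gs n\<^esub> x \<otimes>\<^bsub>G\<^esub> y"
    by (rule incl.hom_mult[OF Gs.inv_closed[OF assms(1)] assms(2)])
  moreover have "inv\<^bsub>Gs n\<^esub> x = inv\<^bsub>G\<^esub> x" by (rule incl.hom_inv) (use assms in simp)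
  ultimately show ?thesis by simp
qed

sublocale E: hausdorff_lcs K E by (rule smooth_manifold_model[OF ground lie_groupD(2)[OF G]])
sublocale Es: hausdorff_lcs K "Es n" for n by (rule smooth_manifold_model[OF ground lie_groupD(2)[OF Gs]])
sublocale F: hausdorff_lcs K F by (rule smooth_manifold_model[OF ground lie_groupD(2)[OF Y]])

lemma chart_W: "chart K (man Y) W \<kappa>"
  by (rule smooth_manifold_atlas_chart[OF lie_groupD(2)[OF Y] W(1)])

lemma local_charts: "n \<ge> n0 \<Longrightarrow> local_chart (man (Gs n)) (Us n) (\<phi>s n)"
  by (rule chart_local[OF charts])

lemma \<psi>s_near:
  assumes "n \<ge> n0" "\<one>\<^bsub>G\<^esub> \<in> Us n"
  shows "smooth_near K (man (Gs n)) (man Y) \<psi> (Us n) (\<phi>s n) W \<kappa> \<one>\<^bsub>G\<^esub>"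
proof -
  have one: "\<one>\<^bsub>G\<^esub> \<in> carrier (Gs n)" using incl.hom_one[of n] Gs.one_closed[of n] by simp
  have "\<psi>s n \<one>\<^bsub>G\<^esub> \<in> W" using \<psi>_eq[OF one] \<psi>.hom_one W(2) by simp
  then have "smooth_near K (man (Gs n)) (man Y) (\<psi>s n) (Us n) (\<phi>s n) W \<kappa> \<one>\<^bsub>G\<^esub>"
    using \<psi>s[of n] assms
    by (intro smooth_map_smooth_near[OF ground lie_groupD(2)[OF Gs] lie_groupD(2)[OF Y] _ charts chart_W])
      (auto simp: lie_hom_def)
  then show ?thesis
    by (rule smooth_near_cong[OF Es.hausdorff_lcs_axioms F.hausdorff_lcs_axioms local_charts[OF assms(1)], rotated])
      (simp add: lie_groupD(3)[OF Gs] \<psi>_eq)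
qed

lemma js_linear: "n \<ge> n0 \<Longrightarrow> continuous_linear K (Es n) E (js n)"
  and js_j: "n0 \<le> m \<Longrightarrow> m \<le> n \<Longrightarrow> x \<in> carrier (Es m) \<Longrightarrow> js n (j n m x) = js m x"
  using lim by (auto simp: lcs_direct_limit_def)

lemma j_linear: "n0 \<le> m \<Longrightarrow> m \<le> n \<Longrightarrow> continuous_linear K (Es m) (Es n) (j n m)"
  and j_comp: "n0 \<le> l \<Longrightarrow> l \<le> m \<Longrightarrow> m \<le> n \<Longrightarrow> x \<in> carrier (Es l) \<Longrightarrow> j n m (j m l x) = j n l x"
  using sys by (auto simp: lcs_direct_system_def)

lemma \<phi>s_carrier: "n \<ge> n0 \<Longrightarrow> x \<in> Us n \<Longrightarrow> \<phi>s n x \<in> carrier (Es n)"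
  using openin_subset[OF local_chart_dom(4)[OF local_charts]] Es.topspace_vtop by fastforce

lemma Us_carrier: "n \<ge> n0 \<Longrightarrow> x \<in> Us n \<Longrightarrow> x \<in> carrier (Gs n)"
  using lie_group_chart_carrier[OF Gs charts] by blast

text \<open>By assumption \<open>j n m\<close> maps the image of the chart \<open>\<phi>s m\<close> into that of \<open>\<phi>s n\<close>, where \<open>js n\<close> is
  injective because \<open>\<phi>\<close> is; and \<open>js n\<close> maps both sides to \<open>\<phi> x\<close>.\<close>

lemma \<phi>s_j:
  assumes "n0 \<le> m" "m \<le> n" "x \<in> Us m"
  shows "\<phi>s n x = j n m (\<phi>s m x)"
proof -
  obtain y where y: "y \<in> Us n" "j n m (\<phi>s m x) = \<phi>s n y" using nest(2)[OF assms(1,2)] assms(3) by blast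
  have x: "x \<in> Us n" using nest(1)[OF assms(1,2)] assms(3) by blast
  have "\<phi> y = js n (j n m (\<phi>s m x))" using \<phi>_eq[of n y] y assms by simp
  also have "\<dots> = \<phi> x" using js_j[OF assms(1,2)] \<phi>_eq[of m x] \<phi>s_carrier assms by simp
  finally have "x = y"
    by (intro inj_onD[OF local_chart_dom(3)[OF chart_local[OF chart]]]) (use x y(1) assms U_union in auto)
  then show ?thesis using y by simp
qed

text \<open>The homomorphism in the charts \<open>\<phi>s n\<close> and \<open>\<kappa>\<close>, and its tangent map at the neutral element.\<close>

definition "k n = \<kappa> \<circ> \<psi> \<circ> inv_into (Us n) (\<phi>s n)"

definition "tangent n y = dir_deriv K (Es n) F (k n) y (\<phi>s n \<one>\<^bsub>G\<^esub>)"

lemma k_smooth: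
  assumes "n \<ge> n0" "\<one>\<^bsub>G\<^esub> \<in> Us n"
  obtains V where "openin (mtop (man (Gs n))) V" "\<one>\<^bsub>G\<^esub> \<in> V" "V \<subseteq> Us n" "\<psi> ` V \<subseteq> W"
    "openin (vtop (Es n)) (\<phi>s n ` V)" "C_map K \<infinity> (Es n) F (\<phi>s n ` V) (k n)"
proof -
  obtain V where V: "openin (mtop (man (Gs n))) V" "\<one>\<^bsub>G\<^esub> \<in> V" "V \<subseteq> Us n" "\<psi> ` V \<subseteq> W"
    "C_map K \<infinity> (Es n) F (\<phi>s n ` V) (k n)"
    using \<psi>s_near[OF assms] by (auto simp: smooth_near_def k_def)
  show ?thesis
    by (rule that[OF V(1-4) local_chart_image_open[OF local_charts[OF assms(1)] V(1,3)] V(5)])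
qed

lemma tangent_linear:
  assumes "n \<ge> n0" "\<one>\<^bsub>G\<^esub> \<in> Us n"
  shows "continuous_linear K (Es n) F (tangent n)"
proof -
  obtain V where "openin (mtop (man (Gs n))) V" and V: "\<one>\<^bsub>G\<^esub> \<in> V" and "V \<subseteq> Us n" "\<psi> ` V \<subseteq> W"
    and V': "openin (vtop (Es n)) (\<phi>s n ` V)" "C_map K \<infinity> (Es n) F (\<phi>s n ` V) (k n)"
    by (rule k_smooth[OF assms])
  show ?thesis
    unfolding tangent_def[abs_def]
    by (rule C_map_dir_deriv_linear[OF Es.lcs_axioms F.hausdorff_lcs_axioms V']) (use V in blast)
qed

lemma k_curve:
  assumes n: "n \<ge> n0" "\<one>\<^bsub>G\<^esub> \<in> Us n"
    and c: "c 0 = \<phi>s n \<one>\<^bsub>G\<^esub>" "eventually (\<lambda>t. c t \<in> carrier (Es n)) (at 0 within K)" "curve_deriv K (Es n) c c'"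
  shows "curve_deriv K F (\<lambda>t. k n (c t)) (tangent n c')"
proof -
  obtain V where "openin (mtop (man (Gs n))) V" and V: "\<one>\<^bsub>G\<^esub> \<in> V" and "V \<subseteq> Us n" "\<psi> ` V \<subseteq> W"
    and V': "openin (vtop (Es n)) (\<phi>s n ` V)" "C_map K \<infinity> (Es n) F (\<phi>s n ` V) (k n)"
    by (rule k_smooth[OF n])
  show ?thesis
    using C_map_curve[OF Es.lcs_axioms F.hausdorff_lcs_axioms V' _ c(2,3)] c(1) V
    by (simp add: tangent_def)
qed

text \<open>Where the bonding map carries one chart to the other, \<open>k n \<circ> j n m = k m\<close>.\<close>

lemma tangent_j:
  assumes m: "n0 \<le> m" "m \<le> n" "\<one>\<^bsub>G\<^esub> \<in> Us m" and y: "y \<in> carrier (Es m)"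
  shows "tangent n (j n m y) = tangent m y"
proof -
  let ?x = "\<phi>s m \<one>\<^bsub>G\<^esub>"
  let ?c = "\<lambda>t. ?x \<oplus>\<^bsub>Es m\<^esub> t \<odot>\<^bsub>Es m\<^esub> y"
  have n: "n \<ge> n0" "\<one>\<^bsub>G\<^esub> \<in> Us n" using m nest(1)[OF m(1,2)] by auto
  have x: "?x \<in> carrier (Es m)" using \<phi>s_carrier m by simp
  have c0: "?c 0 = ?x" using x y by simp
  have c: "curve_deriv K (Es m) ?c y" by (rule Es.curve_deriv_line[OF x y])
  have evc: "eventually (\<lambda>t. ?c t \<in> carrier (Es m)) (at 0 within K)"
    using x y by (auto intro: eventually_mono[OF Es.eventually_scalar])
  have dm: "curve_deriv K F (\<lambda>t. k m (?c t)) (tangent m y)"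
    by (rule k_curve[OF m(1,3) c0 evc c])
  have jc: "curve_deriv K (Es n) (\<lambda>t. j n m (?c t)) (j n m y)"
    by (rule continuous_linear_curve[OF Es.lcs_axioms Es.hausdorff_lcs_axioms j_linear[OF m(1,2)] _ evc c])
      (use c0 x in simp)
  have jcl: "j n m z \<in> carrier (Es n)" if "z \<in> carrier (Es m)" for z
    using j_linear[OF m(1,2)] that by (auto simp: continuous_linear_def)
  have jc0: "j n m (?c 0) = \<phi>s n \<one>\<^bsub>G\<^esub>" unfolding c0 using \<phi>s_j[OF m] by simp
  have kj: "k n (j n m (\<phi>s m b)) = k m (\<phi>s m b)" if "b \<in> Us m" for b
  proof -
    have "b \<in> Us n" using that nest(1)[OF m(1,2)] by blast
    then have "inv_into (Us n) (\<phi>s n) (j n m (\<phi>s m b)) = b"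
      unfolding \<phi>s_j[OF m(1,2) that, symmetric] by (rule local_chart_inv[OF local_charts[OF n(1)]])
    then show ?thesis using local_chart_inv[OF local_charts[OF m(1)] that] by (simp add: k_def)
  qed
  have "eventually (\<lambda>t. ?c t \<in> \<phi>s m ` Us m) (at 0 within K)"
    using m y by (intro Es.line_in_open[OF local_chart_dom(4)[OF local_charts]]) auto
  then have ev: "eventually (\<lambda>t. k n (j n m (?c t)) = k m (?c t)) (at 0 within K)"
    by (rule eventually_mono) (use kj in auto)
  have "curve_deriv K F (\<lambda>t. k n (j n m (?c t))) (tangent n (j n m y))"
    by (rule k_curve[OF n jc0 _ jc]) (use jcl in \<open>auto intro: eventually_mono[OF evc]\<close>)
  then have "curve_deriv K F (\<lambda>t. k m (?c t)) (tangent n (j n m y))"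
    by (subst (asm) F.curve_deriv_cong[OF ev]) (use kj[of "\<one>\<^bsub>G\<^esub>"] m c0 in simp_all)
  then show ?thesis using dm by (rule F.curve_deriv_unique)
qed

lemma one_stage: obtains N where "n0 \<le> N" "\<one>\<^bsub>G\<^esub> \<in> Us N"
  using one_U U_union by auto

text \<open>The tangent maps of the homomorphisms on the \<open>Gs n\<close> form a cone, which factors over the modelling
  space \<open>E\<close> because that space is a direct limit of locally convex spaces. Stages whose chart does
  not contain the neutral element are first mapped to a stage \<open>N\<close> whose chart does.\<close>

lemma limit_tangent:
  obtains L where "continuous_linear K E F L"
    "\<And>n y. n0 \<le> n \<Longrightarrow> \<one>\<^bsub>G\<^esub> \<in> Us n \<Longrightarrow> y \<in> carrier (Es n) \<Longrightarrow> L (js n y) = tangent n y"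
proof -
  obtain N where N: "n0 \<le> N" "\<one>\<^bsub>G\<^esub> \<in> Us N" by (rule one_stage)
  define fs where "fs = (\<lambda>n y. tangent (max n N) (j (max n N) n y))"
  have NM: "n0 \<le> max n N" "\<one>\<^bsub>G\<^esub> \<in> Us (max n N)" for n
    using N nest(1)[OF N(1), of "max n N"] by auto
  have lin: "continuous_linear K (Es n) F (fs n)" if "n0 \<le> n" for n
  proof -
    have 1: "continuous_linear K (Es n) (Es (max n N)) (j (max n N) n)"
      by (rule j_linear[OF that]) simp
    note 2 = tangent_linear[OF NM, of n]
    have "continuous_map (vtop (Es n)) (vtop F) (\<lambda>y. tangent (max n N) (j (max n N) n y))"
      using continuous_map_compose[of "vtop (Es n)" "vtop (Es (max n N))" "j (max n N) n" "vtop F" "tangent (max n N)"] 1 2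
      by (simp add: continuous_linear_def o_def)
    with 1 2 show ?thesis unfolding fs_def continuous_linear_def by (auto simp: Pi_iff)
  qed
  have comp: "fs n (j n m y) = fs m y" if "n0 \<le> m" "m \<le> n" "y \<in> carrier (Es m)" for m n y
  proof -
    have "fs n (j n m y) = tangent (max n N) (j (max n N) m y)"
      unfolding fs_def using j_comp[OF that(1,2), of "max n N"] that by simp
    also have "j (max n N) m y = j (max n N) (max m N) (j (max m N) m y)"
      using j_comp[OF that(1), of "max m N" "max n N"] that by auto
    also have "tangent (max n N) \<dots> = tangent (max m N) (j (max m N) m y)"
      using j_linear[OF that(1), of "max m N"] that
      by (intro tangent_j NM) (auto simp: continuous_linear_def)
    finally show ?thesis by (simp add: fs_def)
  qed
  have "lcs_direct_limit TYPE('e) K n0 Es j E js"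
    by (rule lcs_direct_limit_any_type[OF ground sys lim model_union])
  note univ = this[unfolded lcs_direct_limit_def, THEN conjunct2, THEN conjunct2, THEN conjunct2,
      THEN spec, of F, THEN spec, of fs, THEN mp]
  have "\<exists>!f. f \<in> extensional (carrier E) \<and> continuous_linear K E F f \<and>
              (\<forall>n\<ge>n0. \<forall>x\<in>carrier (Es n). f (js n x) = fs n x)"
    by (rule univ) (simp add: F.lcs lin comp)
  then obtain L where "L \<in> extensional (carrier E) \<and> continuous_linear K E F L \<and>
              (\<forall>n\<ge>n0. \<forall>x\<in>carrier (Es n). L (js n x) = fs n x)" by (rule ex1E)
  then have L: "continuous_linear K E F L" "\<And>n x. n \<ge> n0 \<Longrightarrow> x \<in> carrier (Es n) \<Longrightarrow> L (js n x) = fs n x"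
    by simp_all
  show ?thesis
  proof (rule that[OF L(1)])
    fix n y assume n: "n0 \<le> n" "\<one>\<^bsub>G\<^esub> \<in> Us n" and y: "y \<in> carrier (Es n)"
    then show "L (js n y) = tangent n y"
      using L(2)[OF n(1) y] tangent_j[OF n(1) _ n(2) y, of "max n N"] by (simp add: fs_def)
  qed
qed

end

section \<open>The derivative of the homomorphism in a direct limit chart\<close>

context limit_homomorphism
begin

text \<open>In the charts \<open>\<phi>\<close> and \<open>\<kappa>\<close>, \<open>g\<close> is the homomorphism, \<open>\<delta>\<close> the left division \<open>(x, y) \<mapsto> x\<inverse> y\<close> of \<open>G\<close>
  near the diagonal, where its values are close to the neutral element, and \<open>\<mu>\<close> the multiplication
  of \<open>Y\<close>.\<close>

definition "g = \<kappa> \<circ> \<psi> \<circ> inv_into U \<phi>"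
definition "chart_dom = {x \<in> U. \<psi> x \<in> W}"
definition "\<delta> = \<phi> \<circ> (\<lambda>(x, y). inv\<^bsub>G\<^esub> x \<otimes>\<^bsub>G\<^esub> y) \<circ> inv_into (U \<times> U) (map_prod \<phi> \<phi>)"
definition "\<mu> = \<kappa> \<circ> (\<lambda>(x, y). x \<otimes>\<^bsub>Y\<^esub> y) \<circ> inv_into (W \<times> W) (map_prod \<kappa> \<kappa>)"
definition "mult_dom = map_prod \<kappa> \<kappa> ` ((W \<times> W) \<inter> (\<lambda>(x, y). x \<otimes>\<^bsub>Y\<^esub> y) -` W)"

lemma local_U: "local_chart (man G) U \<phi>" by (rule chart_local[OF chart])
lemma local_W: "local_chart (man Y) W \<kappa>" by (rule chart_local[OF chart_W])

lemma U_carrier: "x \<in> U \<Longrightarrow> x \<in> carrier G" by (rule lie_group_chart_carrier[OF G chart])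
lemma W_carrier: "x \<in> W \<Longrightarrow> x \<in> carrier Y" by (rule lie_group_chart_carrier[OF Y chart_W])

lemma \<phi>_carrier: "x \<in> U \<Longrightarrow> \<phi> x \<in> carrier E"
  using openin_subset[OF local_chart_dom(4)[OF local_U]] by auto
lemma \<kappa>_carrier: "x \<in> W \<Longrightarrow> \<kappa> x \<in> carrier F"
  using openin_subset[OF local_chart_dom(4)[OF local_W]] by auto

lemma open_chart_dom: "openin (mtop (man G)) chart_dom"
proof -
  have "chart_dom = U \<inter> {x \<in> topspace (mtop (man G)). \<psi> x \<in> W}"
    using U_carrier lie_groupD(3)[OF G] by (auto simp: chart_dom_def)
  then show ?thesis
    using local_chart_dom(1)[OF local_U] openin_continuous_map_preimage[OF \<psi>_cont local_chart_dom(1)[OF local_W]]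
    by (simp add: openin_Int)
qed

lemma open_\<phi>_chart_dom: "openin (vtop E) (\<phi> ` chart_dom)"
  by (rule local_chart_image_open[OF local_U open_chart_dom]) (auto simp: chart_dom_def)

lemma g_\<phi>: "x \<in> U \<Longrightarrow> g (\<phi> x) = \<kappa> (\<psi> x)"
  using local_chart_inv[OF local_U] by (simp add: g_def)

lemma \<delta>_\<phi>: "x \<in> U \<Longrightarrow> y \<in> U \<Longrightarrow> \<delta> (\<phi> x, \<phi> y) = \<phi> (inv\<^bsub>G\<^esub> x \<otimes>\<^bsub>G\<^esub> y)"
  using local_chart_inv[OF local_chart_prod[OF local_U local_U], of "(x, y)"] by (simp add: \<delta>_def)

lemma \<mu>_\<kappa>: "x \<in> W \<Longrightarrow> y \<in> W \<Longrightarrow> \<mu> (\<kappa> x, \<kappa> y) = \<kappa> (x \<otimes>\<^bsub>Y\<^esub> y)"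
  using local_chart_inv[OF local_chart_prod[OF local_W local_W], of "(x, y)"] by (simp add: \<mu>_def)

text \<open>Because \<open>(W, \<kappa>)\<close> belongs to the stored atlas, this is part of the definition of a Lie group. For \<open>\<delta>\<close>
  in the chart \<open>\<phi>\<close>, which need not belong to the atlas, smoothness near the diagonal is enough.\<close>

lemma \<mu>_smooth: "openin (vtop (prod_tvs F F)) mult_dom" "C_map K \<infinity> (prod_tvs F F) F mult_dom \<mu>"
proof -
  let ?m = "\<lambda>(x, y). x \<otimes>\<^bsub>Y\<^esub> y"
  let ?D = "(W \<times> W) \<inter> ?m -` W"
  note lW = local_chart_prod[OF local_W local_W]
  have "?D = (W \<times> W) \<inter> {p \<in> topspace (prod_topology (mtop (man Y)) (mtop (man Y))). ?m p \<in> W}"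
    using W_carrier lie_groupD(3)[OF Y] by auto
  then have "openin (mtop (prod_manifold (man Y) (man Y))) ?D"
    using local_chart_dom(1)[OF lW] openin_continuous_map_preimage[OF lie_groupD(6)[OF Y] local_chart_dom(1)[OF local_W]]
    by (simp add: openin_Int)
  from local_chart_image_open[OF lW this] show "openin (vtop (prod_tvs F F)) mult_dom"
    by (auto simp: mult_dom_def)
  show "C_map K \<infinity> (prod_tvs F F) F mult_dom \<mu>"
    using lie_groupD(4)[OF Y] prod_manifold_atlasI[OF W(1) W(1)] W(1)
    by (fastforce simp: smooth_map_def mult_dom_def \<mu>_def)
qed

lemma mult_domI: "x \<in> W \<Longrightarrow> (\<kappa> x, \<kappa> \<one>\<^bsub>Y\<^esub>) \<in> mult_dom"
  using W(2) W_carrier by (auto simp: mult_dom_def intro!: image_eqI[of _ _ "(x, \<one>\<^bsub>Y\<^esub>)"])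

lemma \<delta>_smooth:
  assumes "a \<in> U"
  obtains D where "openin (vtop (prod_tvs E E)) D" "(\<phi> a, \<phi> a) \<in> D"
    "C_map K \<infinity> (prod_tvs E E) E D \<delta>"
proof -
  have "inv\<^bsub>G\<^esub> a \<otimes>\<^bsub>G\<^esub> a \<in> U" using one_U U_carrier[OF assms] by simp
  then have "smooth_near K (prod_manifold (man G) (man G)) (man G) (\<lambda>(x, y). inv\<^bsub>G\<^esub> x \<otimes>\<^bsub>G\<^esub> y)
      (U \<times> U) (map_prod \<phi> \<phi>) U \<phi> (a, a)"
    by (intro lie_left_division_near[OF ground G chart assms chart assms chart])
  then obtain V where V: "openin (mtop (prod_manifold (man G) (man G))) V" "(a, a) \<in> V" "V \<subseteq> U \<times> U"
    "C_map K \<infinity> (prod_tvs E E) E (map_prod \<phi> \<phi> ` V) \<delta>"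
    by (auto simp: smooth_near_def \<delta>_def)
  show ?thesis
  proof (rule that)
    show "openin (vtop (prod_tvs E E)) (map_prod \<phi> \<phi> ` V)"
      using local_chart_image_open[OF local_chart_prod[OF local_U local_U] V(1,3)] by simp
    show "(\<phi> a, \<phi> a) \<in> map_prod \<phi> \<phi> ` V" using V(2) by force
  qed fact
qed

lemma lcs_EE: "lcs K (prod_tvs E E)" by (rule lcs_prod) (rule E.lcs_axioms)+
lemma lcs_FF: "lcs K (prod_tvs F F)" by (rule lcs_prod) (rule F.lcs_axioms)+
lemma hausdorff_lcs_EE: "hausdorff_lcs K (prod_tvs E E)" by (rule hausdorff_lcs_prod) (rule E.hausdorff_lcs_axioms)+
lemma hausdorff_lcs_FF: "hausdorff_lcs K (prod_tvs F F)" by (rule hausdorff_lcs_prod) (rule F.hausdorff_lcs_axioms)+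

text \<open>Choose a stage \<open>n\<close> to which the point \<open>a\<close> and the direction \<open>y\<close> belong. The line \<open>\<phi> a \<oplus> t \<odot> y\<close> is
  \<open>\<phi> (b t)\<close> for a curve \<open>b\<close> in \<open>Gs n\<close> with \<open>b 0 = a\<close>, and \<open>c t = a\<inverse> (b t)\<close> is a curve in \<open>Gs n\<close> through
  the neutral element, so that \<open>\<psi> (b t) = \<psi> a (\<psi> (c t))\<close>. The curve \<open>c\<close> is not straight in the chart.
  Its image under \<open>\<psi>\<close> can be differentiated all the same, since on \<open>Gs n\<close> the map \<open>\<psi>\<close> is known to be
  smooth.\<close>

lemma has_dir_deriv_g:
  assumes L: "\<And>n y. n0 \<le> n \<Longrightarrow> \<one>\<^bsub>G\<^esub> \<in> Us n \<Longrightarrow> y \<in> carrier (Es n) \<Longrightarrow> L (js n y) = tangent n y"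
    and a: "a \<in> chart_dom" and y: "y \<in> carrier E"
  shows "has_dir_deriv K E F g y (\<phi> a)
    (dir_deriv K (prod_tvs F F) F \<mu>
      (\<zero>\<^bsub>F\<^esub>, L (dir_deriv K (prod_tvs E E) E \<delta> (\<zero>\<^bsub>E\<^esub>, y) (\<phi> a, \<phi> a))) (g (\<phi> a), \<kappa> \<one>\<^bsub>Y\<^esub>))"
proof -
  let ?A = "at (0::complex) within K"
  have aU: "a \<in> U" and \<psi>a: "\<psi> a \<in> W" and ac: "a \<in> carrier G" using a U_carrier by (auto simp: chart_dom_def)
  obtain N where N: "n0 \<le> N" "\<one>\<^bsub>G\<^esub> \<in> Us N" by (rule one_stage)
  obtain p where p: "n0 \<le> p" "a \<in> Us p" using aU U_union by auto
  obtain q yq where q: "n0 \<le> q" "yq \<in> carrier (Es q)" "y = js q yq" using y model_union by auto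
  \<comment> \<open>a common stage for the neutral element, \<open>a\<close> and \<open>y\<close>\<close>
  define n where "n = max N (max p q)"
  have n: "n0 \<le> n" "N \<le> n" "p \<le> n" "q \<le> n" using N(1) by (auto simp: n_def)
  have one: "\<one>\<^bsub>G\<^esub> \<in> Us n" and an: "a \<in> Us n" using nest(1)[OF N(1) n(2)] nest(1)[OF p(1) n(3)] N p by auto
  define yn where "yn = j n q yq"
  have yn: "yn \<in> carrier (Es n)" "js n yn = y"
    using j_linear[OF q(1) n(4)] js_j[OF q(1) n(4) q(2)] q by (auto simp: yn_def continuous_linear_def)
  note loc = local_charts[OF n(1)]
  have aGn: "a \<in> carrier (Gs n)" using Us_carrier[OF n(1) an] .
  define xn where "xn = \<phi>s n a"
  have xn: "xn \<in> carrier (Es n)" using \<phi>s_carrier[OF n(1) an] by (simp add: xn_def)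
  have js_xn: "js n xn = \<phi> a" using \<phi>_eq[OF n(1) an] by (simp add: xn_def)
  let ?l = "\<lambda>t. xn \<oplus>\<^bsub>Es n\<^esub> t \<odot>\<^bsub>Es n\<^esub> yn"
  have l0: "?l 0 = xn" using xn yn by simp
  define b where "b = (\<lambda>t. inv_into (Us n) (\<phi>s n) (?l t))"
  have b0: "b 0 = a" unfolding b_def l0 unfolding xn_def by (rule local_chart_inv[OF loc an])
  have evb: "eventually (\<lambda>t. b t \<in> Us n \<and> \<phi>s n (b t) = ?l t) ?A"
  proof -
    have "eventually (\<lambda>t. ?l t \<in> \<phi>s n ` Us n) ?A"
      using an yn(1) by (intro Es.line_in_open[OF local_chart_dom(4)[OF loc]]) (auto simp: xn_def)
    then show ?thesis
      by (rule eventually_mono) (auto simp: b_def inv_into_into f_inv_into_f)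
  qed
  have evl: "eventually (\<lambda>t. t \<in> K \<and> t \<noteq> 0 \<and> b t \<in> Us n \<and> \<phi>s n (b t) = ?l t \<and> \<phi> (b t) = \<phi> a \<oplus>\<^bsub>E\<^esub> t \<odot>\<^bsub>E\<^esub> y) ?A"
    using eventually_conj[OF Es.eventually_scalar evb]
  proof (rule eventually_mono, elim conjE, intro conjI)
    fix t assume t: "t \<in> K" "t \<noteq> 0" "b t \<in> Us n" "\<phi>s n (b t) = ?l t"
    show "\<phi> (b t) = \<phi> a \<oplus>\<^bsub>E\<^esub> t \<odot>\<^bsub>E\<^esub> y"
      using \<phi>_eq[OF n(1) t(3)] t js_linear[OF n(1)] xn yn js_xn by (simp add: continuous_linear_def)
  qed
  \<comment> \<open>the curve \<open>a\<inverse> b(t)\<close> through the neutral element, as a curve in the chart of \<open>Gs n\<close>\<close>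
  define c where "c = (\<lambda>t. inv\<^bsub>G\<^esub> a \<otimes>\<^bsub>G\<^esub> b t)"
  have c0: "c 0 = \<one>\<^bsub>G\<^esub>" using ac by (simp add: c_def b0)
  define d where "d = \<phi>s n \<circ> (\<lambda>x. inv\<^bsub>Gs n\<^esub> a \<otimes>\<^bsub>Gs n\<^esub> x) \<circ> inv_into (Us n) (\<phi>s n)"
  have "inv\<^bsub>Gs n\<^esub> a \<otimes>\<^bsub>Gs n\<^esub> a \<in> Us n"
    unfolding division_Gs[OF aGn aGn] using one ac by simp
  then have "smooth_near K (man (Gs n)) (man (Gs n)) (\<lambda>x. inv\<^bsub>Gs n\<^esub> a \<otimes>\<^bsub>Gs n\<^esub> x) (Us n) (\<phi>s n) (Us n) (\<phi>s n) a"
    by (intro lie_left_translation_near[OF ground Gs _ charts[OF n(1)] an charts[OF n(1)]] Gs.inv_closed[OF aGn])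
  then obtain V where V: "openin (mtop (man (Gs n))) V" "a \<in> V" "V \<subseteq> Us n"
      "(\<lambda>x. inv\<^bsub>Gs n\<^esub> a \<otimes>\<^bsub>Gs n\<^esub> x) ` V \<subseteq> Us n" "C_map K \<infinity> (Es n) (Es n) (\<phi>s n ` V) d"
    by (auto simp: smooth_near_def d_def)
  note opV = local_chart_image_open[OF loc V(1,3)]
  have xnV: "xn \<in> \<phi>s n ` V" using V(2) by (simp add: xn_def)
  define An where "An = dir_deriv K (Es n) (Es n) d yn xn"
  have An: "An \<in> carrier (Es n)"
    unfolding An_def by (rule C_map_dir_deriv_closed[OF Es.lcs_axioms Es.hausdorff_lcs_axioms opV V(5) xnV yn(1)])
  have "has_dir_deriv K (Es n) (Es n) d yn xn An"
    unfolding An_def by (rule C_map_has_dir_deriv[OF Es.lcs_axioms Es.hausdorff_lcs_axioms opV V(5) xnV yn(1)])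
  then have d_curve: "curve_deriv K (Es n) (\<lambda>t. d (?l t)) An"
    using xn yn(1) by (simp add: Es.has_dir_deriv_eq_curve_deriv)
  have dc: "d (\<phi>s n x) = \<phi>s n (inv\<^bsub>G\<^esub> a \<otimes>\<^bsub>G\<^esub> x)" if "x \<in> Us n" for x
    using local_chart_inv[OF loc that] division_Gs[OF aGn Us_carrier[OF n(1) that]] by (simp add: d_def)
  have evV: "eventually (\<lambda>t. b t \<in> V \<and> c t \<in> Us n) ?A"
  proof -
    have "eventually (\<lambda>t. ?l t \<in> \<phi>s n ` V) ?A"
      by (rule Es.line_in_open[OF opV xnV yn(1)])
    then show ?thesis
    proof (rule eventually_mono)
      fix t assume "?l t \<in> \<phi>s n ` V"
      then obtain v where v: "v \<in> V" "?l t = \<phi>s n v" by blast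
      then have bv: "b t = v" unfolding b_def using local_chart_inv[OF loc] V(3) by auto
      have "inv\<^bsub>Gs n\<^esub> a \<otimes>\<^bsub>Gs n\<^esub> v \<in> Us n" using V(4) v(1) by blast
      then show "b t \<in> V \<and> c t \<in> Us n"
        using division_Gs[OF aGn Us_carrier[OF n(1)], of v] V(3) v(1) bv by (auto simp: c_def)
    qed
  qed
  have c_curve: "curve_deriv K (Es n) (\<lambda>t. \<phi>s n (c t)) An"
  proof (subst Es.curve_deriv_cong[of _ "\<lambda>t. d (?l t)"])
    show "eventually (\<lambda>t. \<phi>s n (c t) = d (?l t)) ?A"
      using evb
    proof (rule eventually_mono)
      fix t assume "b t \<in> Us n \<and> \<phi>s n (b t) = ?l t"
      then show "\<phi>s n (c t) = d (?l t)" using dc[of "b t"] by (simp add: c_def)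
    qed
    show "\<phi>s n (c 0) = d (?l 0)" unfolding l0 unfolding xn_def dc[OF an] by (simp add: c_def b0)
  qed (rule d_curve)
  have evc: "eventually (\<lambda>t. \<phi>s n (c t) \<in> carrier (Es n)) ?A"
    using evV by (rule eventually_mono) (simp add: \<phi>s_carrier[OF n(1)])
  have cc0: "\<phi>s n (c 0) \<in> carrier (Es n)" using \<phi>s_carrier[OF n(1) one] by (simp add: c0)
  \<comment> \<open>its derivative in the chart of \<open>G\<close>\<close>
  have js_curve: "curve_deriv K E (\<lambda>t. js n (\<phi>s n (c t))) (js n An)"
    by (rule continuous_linear_curve[OF Es.lcs_axioms E.hausdorff_lcs_axioms js_linear[OF n(1)] cc0 evc c_curve])
  obtain D where D: "openin (vtop (prod_tvs E E)) D" "(\<phi> a, \<phi> a) \<in> D"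
      "C_map K \<infinity> (prod_tvs E E) E D \<delta>"
    by (rule \<delta>_smooth[OF aU])
  have ydir: "(\<zero>\<^bsub>E\<^esub>, y) \<in> carrier (prod_tvs E E)" using y by simp
  define A where "A = dir_deriv K (prod_tvs E E) E \<delta> (\<zero>\<^bsub>E\<^esub>, y) (\<phi> a, \<phi> a)"
  have "has_dir_deriv K (prod_tvs E E) E \<delta> (\<zero>\<^bsub>E\<^esub>, y) (\<phi> a, \<phi> a) A"
    unfolding A_def by (rule C_map_has_dir_deriv[OF lcs_EE E.hausdorff_lcs_axioms D(1,3,2) ydir])
  then have "curve_deriv K E (\<lambda>t. \<delta> ((\<phi> a, \<phi> a) \<oplus>\<^bsub>prod_tvs E E\<^esub> t \<odot>\<^bsub>prod_tvs E E\<^esub> (\<zero>\<^bsub>E\<^esub>, y))) A"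
    using \<phi>_carrier[OF aU] y by (subst (asm) lcs.has_dir_deriv_eq_curve_deriv[OF lcs_EE]) auto
  then have "curve_deriv K E (\<lambda>t. js n (\<phi>s n (c t))) A"
  proof (subst E.curve_deriv_cong)
    show "eventually (\<lambda>t. js n (\<phi>s n (c t)) = \<delta> ((\<phi> a, \<phi> a) \<oplus>\<^bsub>prod_tvs E E\<^esub> t \<odot>\<^bsub>prod_tvs E E\<^esub> (\<zero>\<^bsub>E\<^esub>, y))) ?A"
      using eventually_conj[OF evl evV]
    proof (rule eventually_mono, elim conjE)
      fix t assume t: "t \<in> K" "b t \<in> Us n" "\<phi> (b t) = \<phi> a \<oplus>\<^bsub>E\<^esub> t \<odot>\<^bsub>E\<^esub> y" "c t \<in> Us n"
      have "b t \<in> U" using t(2) U_union n(1) by auto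
      then show "js n (\<phi>s n (c t)) = \<delta> ((\<phi> a, \<phi> a) \<oplus>\<^bsub>prod_tvs E E\<^esub> t \<odot>\<^bsub>prod_tvs E E\<^esub> (\<zero>\<^bsub>E\<^esub>, y))"
        using \<delta>_\<phi>[OF aU, of "b t"] \<phi>_eq[OF n(1) t(4)] t \<phi>_carrier[OF aU] by (simp add: c_def)
    qed
    show "js n (\<phi>s n (c 0)) = \<delta> ((\<phi> a, \<phi> a) \<oplus>\<^bsub>prod_tvs E E\<^esub> 0 \<odot>\<^bsub>prod_tvs E E\<^esub> (\<zero>\<^bsub>E\<^esub>, y))"
      using \<delta>_\<phi>[OF aU aU] \<phi>_eq[OF n(1) one] c0 ac y \<phi>_carrier[OF aU] by simp
  qed
  then have A: "A = js n An" using js_curve by (rule E.curve_deriv_unique)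
  \<comment> \<open>its derivative in the chart of \<open>Y\<close>\<close>
  have "curve_deriv K F (\<lambda>t. k n (\<phi>s n (c t))) (tangent n An)"
    by (rule k_curve[OF n(1) one _ evc c_curve]) (simp add: c0)
  then have k_c: "curve_deriv K F (\<lambda>t. k n (\<phi>s n (c t))) (L A)"
    using L[OF n(1) one An] A by simp
  obtain V1 where "openin (mtop (man (Gs n))) V1" and V1: "\<one>\<^bsub>G\<^esub> \<in> V1" "V1 \<subseteq> Us n" "\<psi> ` V1 \<subseteq> W"
    "openin (vtop (Es n)) (\<phi>s n ` V1)" and "C_map K \<infinity> (Es n) F (\<phi>s n ` V1) (k n)"
    by (rule k_smooth[OF n(1) one])
  have "limitin (vtop (Es n)) (\<lambda>t. \<phi>s n (c t)) (\<phi>s n (c 0)) ?A"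
    by (rule Es.curve_deriv_lim[OF c_curve cc0 evc])
  then have "eventually (\<lambda>t. \<phi>s n (c t) \<in> \<phi>s n ` V1) ?A"
    by (rule limitinD[OF _ V1(4)]) (use V1(1) c0 in auto)
  then have ev1: "eventually (\<lambda>t. c t \<in> V1) ?A"
    using evV
  proof (rule eventually_elim2)
    fix t assume "\<phi>s n (c t) \<in> \<phi>s n ` V1" "b t \<in> V \<and> c t \<in> Us n"
    then show "c t \<in> V1"
      using local_chart_dom(3)[OF loc] V1(2) by (auto simp: inj_on_def)
  qed
  have \<psi>c0: "\<psi> (c 0) = \<one>\<^bsub>Y\<^esub>" using \<psi>.hom_one by (simp add: c0)
  have kc: "k n (\<phi>s n x) = \<kappa> (\<psi> x)" if "x \<in> Us n" for x
    using local_chart_inv[OF loc that] by (simp add: k_def)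
  have \<psi>_curve: "curve_deriv K F (\<lambda>t. \<kappa> (\<psi> (c t))) (L A)"
  proof (subst F.curve_deriv_cong[of _ "\<lambda>t. k n (\<phi>s n (c t))"])
    show "eventually (\<lambda>t. \<kappa> (\<psi> (c t)) = k n (\<phi>s n (c t))) ?A"
      using evV by (rule eventually_mono) (simp add: kc)
    show "\<kappa> (\<psi> (c 0)) = k n (\<phi>s n (c 0))" using kc[OF one] by (simp add: c0)
  qed (rule k_c)
  \<comment> \<open>translate back by \<open>\<psi> a\<close>\<close>
  have gx: "g (\<phi> a) \<in> carrier F" using g_\<phi>[OF aU] \<kappa>_carrier[OF \<psi>a] by simp
  have ev\<psi>: "eventually (\<lambda>t. \<kappa> (\<psi> (c t)) \<in> carrier F) ?A"
    using ev1 by (rule eventually_mono) (use V1(3) \<kappa>_carrier in auto)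
  have pair: "curve_deriv K (prod_tvs F F) (\<lambda>t. (g (\<phi> a), \<kappa> (\<psi> (c t)))) (\<zero>\<^bsub>F\<^esub>, L A)"
    by (rule curve_deriv_pair[OF F.lcs_axioms F.lcs_axioms _ _ F.curve_deriv_const[OF gx] _ ev\<psi> \<psi>_curve])
      (use gx \<psi>c0 \<kappa>_carrier[OF W(2)] in auto)
  have "curve_deriv K F (\<lambda>t. \<mu> (g (\<phi> a), \<kappa> (\<psi> (c t))))
      (dir_deriv K (prod_tvs F F) F \<mu> (\<zero>\<^bsub>F\<^esub>, L A) (g (\<phi> a), \<kappa> (\<psi> (c 0))))"
  proof (rule C_map_curve[OF lcs_FF F.hausdorff_lcs_axioms \<mu>_smooth, of "\<lambda>t. (g (\<phi> a), \<kappa> (\<psi> (c t)))"])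
    show "(g (\<phi> a), \<kappa> (\<psi> (c 0))) \<in> mult_dom" using g_\<phi>[OF aU] mult_domI[OF \<psi>a] \<psi>c0 by simp
    show "eventually (\<lambda>t. (g (\<phi> a), \<kappa> (\<psi> (c t))) \<in> carrier (prod_tvs F F)) ?A"
      using ev\<psi> by (rule eventually_mono) (simp add: gx)
  qed (rule pair)
  then have res: "curve_deriv K F (\<lambda>t. \<mu> (g (\<phi> a), \<kappa> (\<psi> (c t))))
      (dir_deriv K (prod_tvs F F) F \<mu> (\<zero>\<^bsub>F\<^esub>, L A) (g (\<phi> a), \<kappa> \<one>\<^bsub>Y\<^esub>))"
    by (simp add: \<psi>c0)
  have \<mu>g: "\<mu> (g (\<phi> a), \<kappa> (\<psi> (inv\<^bsub>G\<^esub> a \<otimes>\<^bsub>G\<^esub> x))) = g (\<phi> x)"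
    if "x \<in> U" "\<psi> (inv\<^bsub>G\<^esub> a \<otimes>\<^bsub>G\<^esub> x) \<in> W" for x
  proof -
    have xc: "x \<in> carrier G" using U_carrier that by simp
    have "\<psi> a \<otimes>\<^bsub>Y\<^esub> \<psi> (inv\<^bsub>G\<^esub> a \<otimes>\<^bsub>G\<^esub> x) = \<psi> (a \<otimes>\<^bsub>G\<^esub> (inv\<^bsub>G\<^esub> a \<otimes>\<^bsub>G\<^esub> x))"
      by (rule \<psi>.hom_mult[symmetric]) (use ac xc in auto)
    also have "a \<otimes>\<^bsub>G\<^esub> (inv\<^bsub>G\<^esub> a \<otimes>\<^bsub>G\<^esub> x) = x" using ac xc by (simp add: G.m_assoc[symmetric])
    finally show ?thesis using \<mu>_\<kappa>[OF \<psi>a that(2)] g_\<phi>[OF aU] g_\<phi>[OF that(1)] by simp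
  qed
  have "curve_deriv K F (\<lambda>t. g (\<phi> a \<oplus>\<^bsub>E\<^esub> t \<odot>\<^bsub>E\<^esub> y))
      (dir_deriv K (prod_tvs F F) F \<mu> (\<zero>\<^bsub>F\<^esub>, L A) (g (\<phi> a), \<kappa> \<one>\<^bsub>Y\<^esub>))"
  proof (subst F.curve_deriv_cong[of _ "\<lambda>t. \<mu> (g (\<phi> a), \<kappa> (\<psi> (c t)))"])
    show "eventually (\<lambda>t. g (\<phi> a \<oplus>\<^bsub>E\<^esub> t \<odot>\<^bsub>E\<^esub> y) = \<mu> (g (\<phi> a), \<kappa> (\<psi> (c t)))) ?A"
      using eventually_conj[OF evl ev1]
    proof (rule eventually_mono, elim conjE)
      fix t assume t: "b t \<in> Us n" "\<phi> (b t) = \<phi> a \<oplus>\<^bsub>E\<^esub> t \<odot>\<^bsub>E\<^esub> y" "c t \<in> V1"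
      have "b t \<in> U" using t(1) U_union n(1) by auto
      moreover have "\<psi> (inv\<^bsub>G\<^esub> a \<otimes>\<^bsub>G\<^esub> b t) \<in> W" using t(3) V1(3) by (auto simp: c_def)
      ultimately show "g (\<phi> a \<oplus>\<^bsub>E\<^esub> t \<odot>\<^bsub>E\<^esub> y) = \<mu> (g (\<phi> a), \<kappa> (\<psi> (c t)))"
        using \<mu>g[of "b t"] t(2) by (simp add: c_def)
    qed
    show "g (\<phi> a \<oplus>\<^bsub>E\<^esub> 0 \<odot>\<^bsub>E\<^esub> y) = \<mu> (g (\<phi> a), \<kappa> (\<psi> (c 0)))"
      using \<mu>g[OF aU] ac y \<phi>_carrier[OF aU] W(2) \<psi>c0 c0 by simp
  qed (rule res)
  then show ?thesis
    using \<phi>_carrier[OF aU] y by (simp add: E.has_dir_deriv_eq_curve_deriv A_def)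
qed

end

section \<open>Smoothness of the homomorphism\<close>

context limit_homomorphism
begin

lemma continuous_g: "continuous_map (subtopology (vtop E) (\<phi> ` chart_dom)) (vtop F) g"
proof -
  let ?S = "subtopology (vtop E) (\<phi> ` chart_dom)"
  have sub: "\<phi> ` chart_dom \<subseteq> \<phi> ` U" by (auto simp: chart_dom_def)
  have inv: "inv_into U \<phi> (\<phi> x) = x" if "x \<in> chart_dom" for x
    using that local_chart_inv[OF local_U] by (simp add: chart_dom_def)
  have "continuous_map ?S (mtop (man G)) (inv_into U \<phi>)"
    using continuous_map_from_subtopology_mono[OF local_chart_inv_continuous[OF local_U] sub] .
  from continuous_map_compose[OF this \<psi>_cont]
  have "continuous_map ?S (subtopology (mtop (man Y)) W) (\<psi> \<circ> inv_into U \<phi>)"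
    unfolding continuous_map_in_subtopology by (auto simp: inv) (auto simp: chart_dom_def)
  from continuous_map_compose[OF this local_chart_continuous[OF local_W]]
  show ?thesis by (simp add: g_def comp_assoc)
qed

text \<open>Induction on the order: the formula for the derivative is composed of smooth maps, of \<open>L\<close> and of \<open>g\<close>,
  so with \<open>g\<close> also its derivative is \<open>C\<^sup>r\<close>.\<close>

lemma C_map_g:
  assumes L: "continuous_linear K E F L"
    and LT: "\<And>n y. n0 \<le> n \<Longrightarrow> \<one>\<^bsub>G\<^esub> \<in> Us n \<Longrightarrow> y \<in> carrier (Es n) \<Longrightarrow> L (js n y) = tangent n y"
  shows "C_map K (enat r) E F (\<phi> ` chart_dom) g"
proof (induction r)
  case 0
  show ?case using continuous_g by (auto simp: C_map_def)
next
  case (Suc r)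
  let ?EE = "prod_tvs E E" and ?FF = "prod_tvs F F"
  show ?case
  proof (rule C_map_local[OF E.lcs_axioms F.hausdorff_lcs_axioms open_\<phi>_chart_dom])
    fix x assume "x \<in> \<phi> ` chart_dom"
    then obtain a where a: "a \<in> chart_dom" "x = \<phi> a" by auto
    then have "a \<in> U" by (simp add: chart_dom_def)
    then obtain D where D: "openin (vtop ?EE) D" "(\<phi> a, \<phi> a) \<in> D"
      "C_map K \<infinity> ?EE E D \<delta>"
      by (rule \<delta>_smooth)
    define N where "N = \<phi> ` chart_dom \<inter> {x \<in> topspace (vtop E). (x, x) \<in> D}"
    have "continuous_map (vtop E) (vtop ?EE) (\<lambda>x. (x, x))"
      using continuous_map_id[of "vtop E"] by (simp add: continuous_map_pairwise o_def id_def)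
    then have N: "openin (vtop E) N" "x \<in> N" "N \<subseteq> \<phi> ` chart_dom" "\<And>x. x \<in> N \<Longrightarrow> (x, x) \<in> D"
      using openin_continuous_map_preimage[OF _ D(1), of "vtop E" "\<lambda>x. (x, x)"] open_\<phi>_chart_dom a D(2)
        \<phi>_carrier[OF \<open>a \<in> U\<close>]
      unfolding N_def by (auto intro: openin_Int)
    let ?N = "N \<times> carrier E"
    have opN: "openin (vtop ?EE) ?N"
      using N(1) openin_topspace[of "vtop E"] by (simp add: openin_prod_Times_iff)
    have opD: "openin (vtop (prod_tvs ?EE ?EE)) (D \<times> carrier ?EE)"
      using D(1) openin_topspace[of "vtop ?EE"] by (simp add: openin_prod_Times_iff)
    have opM: "openin (vtop (prod_tvs ?FF ?FF)) (mult_dom \<times> carrier ?FF)"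
      using \<mu>_smooth(1) openin_topspace[of "vtop ?FF"] by (simp add: openin_prod_Times_iff)
    have opE: "openin (vtop E) (carrier E)" using openin_topspace[of "vtop E"] by simp
    note EE = hausdorff_lcs_EE and FF = hausdorff_lcs_FF
    note E' = E.lcs_axioms E.hausdorff_lcs_axioms and F' = F.lcs_axioms F.hausdorff_lcs_axioms
    note fst = C_map_linear[OF lcs_EE E'(2) continuous_linear_fst opN, of "enat r"]
    note snd = C_map_linear[OF lcs_EE E'(2) continuous_linear_snd opN, of "enat r"]
    \<comment> \<open>the tangent vector at the neutral element obtained by left translation\<close>
    define A where "A = (\<lambda>p. dir_deriv K ?EE E \<delta> (\<zero>\<^bsub>E\<^esub>, snd p) (fst p, fst p))"
    have q1: "C_map K (enat r) ?EE (prod_tvs ?EE ?EE) ?N (\<lambda>p. ((fst p, fst p), (\<zero>\<^bsub>E\<^esub>, snd p)))"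
      by (intro C_map_pair[OF lcs_EE EE EE opN] C_map_pair[OF lcs_EE E'(2) E'(2) opN] fst snd
          C_map_const[OF lcs_EE E'(2) opN]) simp
    have "C_map K (enat (Suc r)) ?EE E D \<delta>" using D(3) by (simp add: C_map_infinity_iff)
    note q2 = C_map_dir_deriv[OF EE E'(2) D(1) this]
    have A: "C_map K (enat r) ?EE E ?N A"
    proof -
      have "(\<lambda>p. ((fst p, fst p), (\<zero>\<^bsub>E\<^esub>, snd p))) ` ?N \<subseteq> D \<times> carrier ?EE"
        using N(4) by auto
      from C_map_compose[OF lcs_EE hausdorff_lcs_prod[OF EE EE] E'(2) opN opD this q1 q2]
      show ?thesis by (simp add: A_def o_def)
    qed
    have Ac: "A p \<in> carrier E" if "p \<in> ?N" for p
      by (rule C_map_closed[OF EE E'(2) opN A that])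
    have LA: "C_map K (enat r) ?EE F ?N (\<lambda>p. L (A p))"
      using C_map_compose[OF lcs_EE E'(2) F'(2) opN opE _ A C_map_linear[OF E'(1) F'(2) L opE]] Ac
      by (auto simp: o_def)
    have LAc: "L (A p) \<in> carrier F" if "p \<in> ?N" for p
      using L Ac[OF that] by (auto simp: continuous_linear_def)
    have g: "C_map K (enat r) ?EE F ?N (\<lambda>p. g (fst p))"
      using C_map_compose[OF lcs_EE E'(2) F'(2) opN open_\<phi>_chart_dom _ fst Suc] N(3) by (auto simp: o_def)
    have gW: "(g x, \<kappa> \<one>\<^bsub>Y\<^esub>) \<in> mult_dom" if "x \<in> N" for x
      using N(3) that mult_domI g_\<phi> by (auto simp: chart_dom_def)
    have "\<kappa> \<one>\<^bsub>Y\<^esub> \<in> carrier F" by (rule \<kappa>_carrier[OF W(2)])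
    then have q3: "C_map K (enat r) ?EE (prod_tvs ?FF ?FF) ?N (\<lambda>p. ((g (fst p), \<kappa> \<one>\<^bsub>Y\<^esub>), (\<zero>\<^bsub>F\<^esub>, L (A p))))"
      by (intro C_map_pair[OF lcs_EE FF FF opN] C_map_pair[OF lcs_EE F'(2) F'(2) opN] g LA
          C_map_const[OF lcs_EE F'(2) opN]) simp_all
    have "C_map K (enat (Suc r)) ?FF F mult_dom \<mu>" using \<mu>_smooth(2) by (simp add: C_map_infinity_iff)
    note q4 = C_map_dir_deriv[OF FF F'(2) \<mu>_smooth(1) this]
    have h: "C_map K (enat r) ?EE F ?N (\<lambda>p. dir_deriv K ?FF F \<mu> (\<zero>\<^bsub>F\<^esub>, L (A p)) (g (fst p), \<kappa> \<one>\<^bsub>Y\<^esub>))"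
    proof -
      have "(\<lambda>p. ((g (fst p), \<kappa> \<one>\<^bsub>Y\<^esub>), (\<zero>\<^bsub>F\<^esub>, L (A p)))) ` ?N \<subseteq> mult_dom \<times> carrier ?FF"
        using gW LAc by auto
      from C_map_compose[OF lcs_EE hausdorff_lcs_prod[OF FF FF] F'(2) opN opM this q3 q4]
      show ?thesis by (simp add: o_def)
    qed
    have "C_map K (enat (Suc r)) E F N g"
    proof (rule C_map_Suc[OF E'(2) F'(2) N(1) _ _ h])
      show "continuous_map (subtopology (vtop E) N) (vtop F) g"
        by (rule continuous_map_from_subtopology_mono[OF continuous_g N(3)])
      fix x y assume xy: "x \<in> N" "y \<in> carrier E"
      then obtain b where "b \<in> chart_dom" "x = \<phi> b" using N(3) by auto
      with has_dir_deriv_g[OF LT this(1) xy(2)]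
      show "has_dir_deriv K E F g y x (dir_deriv K ?FF F \<mu> (\<zero>\<^bsub>F\<^esub>, L (A (x, y))) (g (fst (x, y)), \<kappa> \<one>\<^bsub>Y\<^esub>))"
        by (simp add: A_def)
    qed
    with N show "\<exists>V. openin (vtop E) V \<and> x \<in> V \<and> C_map K (enat (Suc r)) E F V g" by blast
  qed
qed

lemma \<psi>_near_one: "smooth_near K (man G) (man Y) \<psi> U \<phi> W \<kappa> \<one>\<^bsub>G\<^esub>"
proof (rule limit_tangent)
  fix L
  assume L: "continuous_linear K E F L"
    "\<And>n y. n0 \<le> n \<Longrightarrow> \<one>\<^bsub>G\<^esub> \<in> Us n \<Longrightarrow> y \<in> carrier (Es n) \<Longrightarrow> L (js n y) = tangent n y"
  have "C_map K \<infinity> E F (\<phi> ` chart_dom) (\<kappa> \<circ> \<psi> \<circ> inv_into U \<phi>)"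
    using C_map_g[OF L] by (simp add: C_map_infinity_iff g_def)
  moreover have "\<one>\<^bsub>G\<^esub> \<in> chart_dom" using one_U W(2) \<psi>.hom_one by (simp add: chart_dom_def)
  ultimately show ?thesis
    unfolding smooth_near_def using open_chart_dom
    by (intro exI[of _ chart_dom]) (auto simp: chart_dom_def)
qed

text \<open>Around \<open>p\<close>, write \<open>\<psi> x = \<psi> p (\<psi> (p\<inverse> x))\<close>.\<close>

lemma smooth_map_\<psi>: "smooth_map K (man G) (man Y) \<psi>"
proof (rule smooth_map_of_near[OF ground lie_groupD(2)[OF G] lie_groupD(2)[OF Y] \<psi>_cont])
  fix U' \<phi>' W' \<kappa>' p
  assume U': "(U', \<phi>') \<in> atlas (man G)" "p \<in> U'" and W': "(W', \<kappa>') \<in> atlas (man Y)" "\<psi> p \<in> W'"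
  note cU' = smooth_manifold_atlas_chart[OF lie_groupD(2)[OF G] U'(1)]
    and cW' = smooth_manifold_atlas_chart[OF lie_groupD(2)[OF Y] W'(1)]
  have p: "p \<in> carrier G" using lie_group_chart_carrier[OF G cU' U'(2)] .
  have pp: "inv\<^bsub>G\<^esub> p \<otimes>\<^bsub>G\<^esub> p = \<one>\<^bsub>G\<^esub>" using p by simp
  note E' = E.hausdorff_lcs_axioms and F' = F.hausdorff_lcs_axioms
  let ?l = "\<lambda>x. inv\<^bsub>G\<^esub> p \<otimes>\<^bsub>G\<^esub> x"
  have cont1: "continuous_map (mtop (man G)) (mtop (man G)) ?l"
    using lie_left_translation_continuous[OF G] p by simp
  have near1: "smooth_near K (man G) (man G) ?l U' \<phi>' U \<phi> p"
    using p one_U by (intro lie_left_translation_near[OF ground G _ cU' U'(2) chart]) auto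
  have cont2: "continuous_map (mtop (man G)) (mtop (man Y)) (\<lambda>x. \<psi> (?l x))"
    using continuous_map_compose[OF cont1 \<psi>_cont] by (simp add: o_def)
  have near2: "smooth_near K (man G) (man Y) (\<lambda>x. \<psi> (?l x)) U' \<phi>' W \<kappa> p"
    using smooth_near_compose[OF E' E' F' chart_local[OF cU'] local_U cont1 near1, of \<psi> W \<kappa>] \<psi>_near_one
    by (simp add: pp)
  have near3: "smooth_near K (man Y) (man Y) (\<lambda>y. \<psi> p \<otimes>\<^bsub>Y\<^esub> y) W \<kappa> W' \<kappa>' (\<psi> (?l p))"
    unfolding pp \<psi>.hom_one using p W'(2) W(2)
    by (intro lie_left_translation_near[OF ground Y _ chart_W W(2) cW']) auto
  have "smooth_near K (man G) (man Y) (\<lambda>x. \<psi> p \<otimes>\<^bsub>Y\<^esub> \<psi> (?l x)) U' \<phi>' W' \<kappa>' p"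
    by (rule smooth_near_compose[OF E' F' F' chart_local[OF cU'] local_W cont2 near2 near3])
  then show "smooth_near K (man G) (man Y) \<psi> U' \<phi>' W' \<kappa>' p"
  proof (rule smooth_near_cong[OF E' F' chart_local[OF cU'], rotated])
    fix x assume "x \<in> topspace (mtop (man G))"
    then have x: "x \<in> carrier G" using lie_groupD(3)[OF G] by simp
    have "\<psi> p \<otimes>\<^bsub>Y\<^esub> \<psi> (?l x) = \<psi> (p \<otimes>\<^bsub>G\<^esub> ?l x)"
      by (rule \<psi>.hom_mult[symmetric]) (use p x in auto)
    also have "p \<otimes>\<^bsub>G\<^esub> ?l x = x" using p x by (simp add: G.m_assoc[symmetric])
    finally show "\<psi> p \<otimes>\<^bsub>Y\<^esub> \<psi> (?l x) = \<psi> x" .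
  qed
qed

end

text \<open>The universal property of topological groups quantifies over records without the manifold field.\<close>

lemma lie_group_topological_group:
  assumes "lie_group K Y"
  shows "topological_group (monoid.truncate Y) (mtop (man Y))"
proof -
  interpret Y: group Y by (rule lie_groupD(1)[OF assms])
  have [simp]: "carrier (monoid.truncate Y) = carrier Y" "mult (monoid.truncate Y) = mult Y"
    "one (monoid.truncate Y) = one Y"
    by (simp_all add: monoid.truncate_def)
  have "m_inv (monoid.truncate Y) x = m_inv Y x" for x by (simp add: m_inv_def)
  moreover have "group (monoid.truncate Y)"
    by (rule groupI) (auto simp: Y.m_assoc intro: Y.l_inv)
  ultimately show ?thesis
    using lie_groupD(3,6,7)[OF assms] by (simp add: topological_group_def)
qed

lemma hom_truncate: "hom G (monoid.truncate Y) = hom G Y"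
  by (auto simp: hom_def monoid.truncate_def)

theorem theorem2p6:
  fixes K :: "complex set"
    and G :: "('g, 'v) lie"
    and Gs :: "nat \<Rightarrow> ('g, 'w) lie"
  assumes "K = \<real> \<or> K = UNIV"
    and "lie_ascending_union K G Gs"
    and "topgroup_direct_limit TYPE('g) G (mtop (man G)) Gs (\<lambda>n. mtop (man (Gs n)))"
    and "admits_direct_limit_chart K G Gs"
  shows "lie_direct_limit TYPE('h) TYPE('e) K G Gs"
proof -
  have un: "carrier G = (\<Union>n. carrier (Gs n))"
    using assms(2) by (simp add: lie_ascending_union_def)
  have "\<exists>!\<psi>. \<psi> \<in> extensional (carrier G) \<and> lie_hom K G Y \<psi> \<and> (\<forall>n. \<forall>x\<in>carrier (Gs n). \<psi> x = \<psi>s n x)"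
    if Y: "lie_group K Y" and \<psi>s: "\<forall>n. lie_hom K (Gs n) Y (\<psi>s n)"
      and comp: "\<forall>n. \<forall>x\<in>carrier (Gs n). \<psi>s (Suc n) x = \<psi>s n x"
    for Y :: "('h, 'e) lie" and \<psi>s
  proof -
    let ?Y = "monoid.truncate Y"
    have "topgroup_hom (Gs n) (mtop (man (Gs n))) ?Y (mtop (man Y)) (\<psi>s n)" for n
      using \<psi>s by (simp add: topgroup_hom_def hom_truncate lie_hom_def smooth_map_def)
    moreover have "topgroup_direct_limit TYPE('h) G (mtop (man G)) Gs (\<lambda>n. mtop (man (Gs n)))"
      by (rule topgroup_direct_limit_any_type[OF assms(3) un])
    ultimately have "\<exists>!\<psi>. \<psi> \<in> extensional (carrier G) \<and> topgroup_hom G (mtop (man G)) ?Y (mtop (man Y)) \<psi> \<and>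
               (\<forall>n. \<forall>x\<in>carrier (Gs n). \<psi> x = \<psi>s n x)"
      using comp lie_group_topological_group[OF Y] by (simp add: topgroup_direct_limit_def)
    then obtain \<psi> where "\<psi> \<in> extensional (carrier G) \<and> topgroup_hom G (mtop (man G)) ?Y (mtop (man Y)) \<psi> \<and>
               (\<forall>n. \<forall>x\<in>carrier (Gs n). \<psi> x = \<psi>s n x)" by (rule ex1E)
    then have \<psi>: "\<psi> \<in> extensional (carrier G)" "\<psi> \<in> hom G Y" "continuous_map (mtop (man G)) (mtop (man Y)) \<psi>"
      "\<And>n x. x \<in> carrier (Gs n) \<Longrightarrow> \<psi> x = \<psi>s n x"
      by (simp_all add: topgroup_hom_def hom_truncate)
    interpret Y: group Y by (rule lie_groupD(1)[OF Y])
    have "\<one>\<^bsub>Y\<^esub> \<in> topspace (mtop (man Y))" using lie_groupD(3)[OF Y] by simp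
    then obtain W \<kappa> where W: "(W, \<kappa>) \<in> atlas (man Y)" "\<one>\<^bsub>Y\<^esub> \<in> W"
      by (rule smooth_manifold_atlas_cover[OF lie_groupD(2)[OF Y]])
    obtain U \<phi> n0 j js Us \<phi>s where c: "\<one>\<^bsub>G\<^esub> \<in> U" "chart K (man G) U \<phi>"
      "lcs_direct_system K n0 (\<lambda>n. model (man (Gs n))) j"
      "lcs_direct_limit TYPE(nat \<times> 'w) K n0 (\<lambda>n. model (man (Gs n))) j (model (man G)) js"
      "carrier (model (man G)) = (\<Union>n\<in>{n0..}. js n ` carrier (model (man (Gs n))))"
      "\<forall>n\<ge>n0. chart K (man (Gs n)) (Us n) (\<phi>s n)"
      "\<forall>m\<ge>n0. \<forall>n\<ge>m. Us m \<subseteq> Us n \<and> j n m ` (\<phi>s m ` Us m) \<subseteq> \<phi>s n ` Us n"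
      "U = (\<Union>n\<in>{n0..}. Us n)" "\<forall>n\<ge>n0. \<forall>x\<in>Us n. \<phi> x = js n (\<phi>s n x)"
      using assms(4) unfolding admits_direct_limit_chart_def direct_limit_chart_def Let_def
      by (elim exE conjE) (rule that)
    interpret limit_homomorphism K G Gs n0 j js U \<phi> Us \<phi>s Y \<psi> \<psi>s W \<kappa>
      by (rule limit_homomorphism.intro) (use assms(1,2) Y \<psi> \<psi>s c W in \<open>simp_all\<close>)
    have "lie_hom K G Y \<psi>" using \<psi>(2) smooth_map_\<psi> by (simp add: lie_hom_def)
    moreover have "\<psi>' = \<psi>" if "\<psi>' \<in> extensional (carrier G)" "\<forall>n. \<forall>x\<in>carrier (Gs n). \<psi>' x = \<psi>s n x" for \<psi>'
      by (rule extensionalityI[OF that(1) \<psi>(1)]) (use that(2) \<psi>(4) un in auto)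
    moreover have "\<forall>n. \<forall>x\<in>carrier (Gs n). \<psi> x = \<psi>s n x" using \<psi>(4) by simp
    ultimately show ?thesis
      using \<psi>(1) by (intro ex1I[of _ \<psi>]) (assumption | elim conjE | intro conjI)+
  qed
  then show ?thesis
    using assms(2) by (simp add: lie_direct_limit_def lie_ascending_union_def)
qed

end
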